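(* Assume the Riemann Hypothesis. Let $\ell$ be a fixed positive integer, let $\beta\in(0,1)$ be fixed, and let $\sigma$ be fixed with $1/2<\sigma<1$. Let $\kappa$ be a fixed positive real number with $$ \kappa<\frac{1-\beta}{\sigma(1+c(\sigma))}, $$ where $c(\sigma) = \int_0^1 \frac{\mathrm{d}t}{2t^{-\sigma}-1}$. Then, for all sufficiently large $T$, $$ \max_{t \in [T^\beta,T]}\prod_{j=1}^\ell |\zeta(\sigma+ijt)| \ge \exp\bigg\{ \kappa^{1-\sigma} \big(S(\sigma,\ell)+o(1)\big)\frac{(\log T)^{1-\sigma}}{(\log_2 T)^\sigma}\bigg\}, $$ where $o(1)\to 0$ as $T\to\infty$, and $$ S(\sigma,\ell) = \frac{\ell}{1-\sigma} + \sum_{m=1}^\ell (-1)^m \binom{\ell+1}{m+1} \frac{1}{1+\sigma(m-1)}. $$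
   Context: $\zeta$ denotes the Riemann zeta function and $\log_2 T=\log\log T$. The Riemann Hypothesis asserts that all nontrivial zeros of $\zeta$ have real part $1/2$. *)

theory Defs
  imports "HOL-Analysis.Analysis"
begin

definition eta :: "complex \<Rightarrow> complex" where
  "eta s = (\<Sum>n. (-1) ^ n / (of_nat (Suc n)) powr s)"

text \<open>Riemann zeta function in the half plane Re s > 0 (analytic continuation via
  zeta(s) = eta(s) / (1 - 2^(1-s))); for Re s > 1 this is the usual Dirichlet series.
  Outside Re s > 0 it is not needed and left unspecified (0).\<close>
definition zeta :: "complex \<Rightarrow> complex" where
  "zeta s = (if 0 < Re s then eta s / (1 - 2 powr (1 - s)) else 0)"

definition RH :: bool where
  "RH \<longleftrightarrow> (\<forall>s. 0 < Re s \<and> Re s < 1 \<and> zeta s = 0 \<longrightarrow> Re s = 1/2)"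

definition c_const :: "real \<Rightarrow> real" where
  "c_const \<sigma> = integral {0..1} (\<lambda>t. 1 / (2 * t powr (-\<sigma>) - 1))"

definition S_const :: "real \<Rightarrow> nat \<Rightarrow> real" where
  "S_const \<sigma> l = real l / (1 - \<sigma>)
     + (\<Sum>m=1..l. (-1) ^ m * real ((l + 1) choose (m + 1)) / (1 + \<sigma> * (real m - 1)))"

end

theory Submission
  imports Defs "HOL-Number_Theory.Prime_Powers" "HOL-Complex_Analysis.Complex_Analysis"
    "HOL-Probability.Probability" "HOL-Real_Asymp.Real_Asymp"
begin

text \<open>
  The proof is a resonance argument. Put \<open>W(it) = (\<Prod>j=1..l. \<zeta>(\<sigma> + ijt))\<close> and convolve it with a Gaussian
  of width \<open>1 / sqrt (2 \<epsilon> log T)\<close>. Shifting the contour to \<open>Re = 1\<close> shows that, for \<open>t\<close> between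
  \<open>T\<^sup>\<beta>\<close> and \<open>T\<close>, the result is a generalised Dirichlet series with nonnegative coefficients whose sum
  is \<open>O(T\<^sup>\<epsilon>)\<close>. This series is tested against \<open>\<bar>R(t)\<bar>\<^sup>2\<close>, where \<open>R(t) = (\<Sum>n. r n / n\<^sup>i\<^sup>t)\<close> and \<open>r\<close> is
  completely multiplicative with \<open>r p = 1 - (p/Y)\<^sup>\<sigma>\<close> for the primes \<open>p \<le> Y\<close>, \<open>Y \<sim> \<kappa> log T log log T\<close>,
  and \<open>r p = 0\<close> for the others. All terms being nonnegative, each frequency \<open>n\<close> contributes at least
  \<open>r n\<close> times the mean of \<open>\<bar>R\<bar>\<^sup>2\<close>; the total is at least the exponential of
  \<open>(\<Sum>p\<le>Y. p\<^sup>-\<^sup>\<sigma> (\<Sum>j=1..l. (r p)^j))\<close>, up to a factor, and \<open>u\<^sup>-\<^sup>\<sigma> (\<Sum>j=1..l. (1 - u\<^sup>\<sigma>)^j)\<close> has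
  integral \<open>S(\<sigma>, l)\<close> over \<open>[0, 1]\<close>. The contribution of \<open>\<bar>t\<bar> \<le> T\<^sup>\<beta>\<close> is negligible because the maximum of
  \<open>\<bar>R\<bar>\<^sup>2\<close> exceeds its mean by the factor \<open>(\<Prod>p\<le>Y. (1 + r p) / (1 - r p))\<close>, which is
  \<open>(\<Prod>p\<le>Y. 2 (p/Y)\<^sup>-\<^sup>\<sigma> - 1)\<close>, and \<open>log (2 u\<^sup>-\<^sup>\<sigma> - 1)\<close> has integral \<open>\<sigma> (1 + c(\<sigma>))\<close>. Both sums over primes
  require the prime number theorem, which is obtained by the Wiener-Ikehara method.
\<close>

section \<open>The zeta function to the right of the imaginary axis\<close>

text \<open>The resonator is an infinite series, so mean-value estimates for short Dirichlet
  polynomials do not limit its share of small t; there |R|^2 is simply replaced by its maximum.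
  About \<kappa> log T primes occur, which makes the ratio of maximum to mean at most T^(\<kappa>
  \<sigma> (1 + c(\<sigma>)) + o(1)), whereas the range up to T^\<beta> has relative length
  T^(\<beta> - 1) up to logarithms. The product is small when \<kappa> \<sigma> (1 + c(\<sigma>)) <
  1 - \<beta>: this is the origin of the bound on \<kappa>. The other obstacle is that the Gaussian
  damps every frequency log n beyond c = sqrt (2 \<epsilon> log T), and the main contribution has to
  survive this. Weighting by n^\<alpha> (Rankin) bounds the damped part by exp (O(Y^(1 - \<sigma> +
  l \<alpha>)) - \<alpha> c), which is harmless once 1 - \<sigma> + l \<alpha> < 1/2. Such an
  \<alpha> > 0 exists because \<sigma> > 1/2. As the bound on \<kappa> is strict, the argument runs
  with a slightly larger value; the surplus absorbs all errors, including the o(1).\<close>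

text \<open>\<open>zeta_reg s\<close> is \<open>(s - 1) \<zeta>(s)\<close>: its terms telescope, up to the sum over \<open>n powr (-s)\<close>,
  and are of second order, so that the series converges for \<open>Re s > 0\<close>. The function \<^const>\<open>zeta\<close>
  takes the junk value 0 at the points of the line \<open>Re s = 1\<close> with \<open>2 powr (1 - s) = 1\<close>, hence
  \<open>zeta_reg\<close> replaces it on \<open>Re s \<ge> 1\<close>.\<close>

definition zeta_reg_term :: "nat \<Rightarrow> complex \<Rightarrow> complex" where
  "zeta_reg_term n s = of_nat (n + 2) powr (1 - s) - of_nat (n + 1) powr (1 - s)
     - (1 - s) * of_nat (n + 1) powr (-s)"

definition zeta_reg :: "complex \<Rightarrow> complex" where
  "zeta_reg s = 1 + (\<Sum>n. zeta_reg_term n s)"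

lemma norm_of_nat_powr: "n > 0 \<Longrightarrow> norm (of_nat n powr s :: complex) = real n powr Re s"
  by (subst norm_powr_real_powr) auto

text \<open>The term is the second-order Taylor remainder of \<open>z powr (1 - s)\<close> at
  \<open>n + 1\<close>, and the modulus of the second derivative decreases along the segment when
  \<open>Re s > -1\<close>. The decay exponent \<open>- Re s - 1\<close> makes the series converge
  for \<open>Re s > 0\<close>.\<close>

lemma norm_zeta_reg_term:
  assumes "Re s > -1"
  shows "norm (zeta_reg_term n s) \<le> norm (s * (1 - s)) * real (n + 1) powr (- Re s - 1)"
proof -
  define S :: "complex set" where "S = closed_segment (of_nat (n + 1)) (of_nat (n + 2))"
  define f :: "nat \<Rightarrow> complex \<Rightarrow> complex" where
    "f = (\<lambda>i z. if i = 0 then z powr (1 - s) else if i = 1 then (1 - s) * z powr (- s)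
            else (1 - s) * (- s) * z powr (- s - 1))"
  define B where "B = norm (s * (1 - s)) * real (n + 1) powr (- Re s - 1)"
  have S: "Re x \<ge> real (n + 1) \<and> Im x = 0" if "x \<in> S" for x
  proof -
    from that obtain u where "0 \<le> u" "u \<le> 1"
      and x: "x = (1 - u) *\<^sub>R of_nat (n + 1) + u *\<^sub>R of_nat (n + 2)"
      unfolding S_def closed_segment_def by blast
    have "Re x = real (n + 1) + u" "Im x = 0" unfolding x by (auto simp: algebra_simps)
    with \<open>0 \<le> u\<close> show ?thesis by simp
  qed
  have "norm (f 0 (of_nat (n + 2)) -
     (\<Sum>i\<le>1. f i (of_nat (n + 1)) * (of_nat (n + 2) - of_nat (n + 1)) ^ i / fact i))
        \<le> B * norm (of_nat (n + 2) - of_nat (n + 1) :: complex) ^ Suc 1 / fact 1"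
  proof (rule field_Taylor[where S = S])
    show "convex S" by (simp add: S_def)
    show "(f i has_field_derivative f (Suc i) x) (at x within S)" if "x \<in> S" and i: "i \<le> 1" for i x
    proof -
      have x: "x \<notin> \<real>\<^sub>\<le>\<^sub>0" using S[OF that(1)] by (auto simp: complex_nonpos_Reals_iff)
      consider "i = 0" | "i = 1" using i by linarith
      thus ?thesis
      proof cases
        case 1
        have "((\<lambda>z. z powr (1 - s)) has_field_derivative (1 - s) * x powr (- s)) (at x within S)"
          using x by (auto intro!: derivative_eq_intros simp: has_field_derivative_at_within)
        thus ?thesis by (simp add: f_def 1)
      next
        case 2
        have "((\<lambda>z. (1 - s) * z powr (- s)) has_field_derivative
                 (1 - s) * ((- s) * x powr (- s - 1))) (at x within S)"
          using x by (intro DERIV_cmult has_field_derivative_powr has_field_derivative_at_within)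
        thus ?thesis by (simp add: f_def 2 mult.assoc)
      qed
    qed
    show "norm (f (Suc 1) x) \<le> B" if "x \<in> S" for x
    proof -
      have "norm (x powr (- s - 1)) = Re x powr (- Re s - 1)"
        using S[OF that] by (subst norm_powr_real_powr) (auto simp: complex_is_Real_iff)
      also have "\<dots> \<le> real (n + 1) powr (- Re s - 1)"
        using S[OF that] assms by (intro powr_mono2') auto
      finally show ?thesis
        by (simp add: f_def B_def norm_mult mult_left_mono mult.commute)
    qed
  qed (auto simp: S_def)
  thus ?thesis by (simp add: f_def B_def zeta_reg_term_def algebra_simps)
qed

lemma summable_Suc_powr: "a > 1 \<Longrightarrow> summable (\<lambda>n. real (n + 1) powr (- a))"
  using summable_real_powr_iff[of "-a"] summable_Suc_iff[of "\<lambda>n. real n powr (-a)"] by simp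

lemma summable_zeta_reg_term:
  assumes "Re s > 0"
  shows "summable (\<lambda>n. norm (zeta_reg_term n s))"
proof (rule summable_comparison_test)
  have "summable (\<lambda>n. real (n + 1) powr (- (Re s + 1)))"
    using assms by (intro summable_Suc_powr) auto
  thus "summable (\<lambda>n. norm (s * (1 - s)) * real (n + 1) powr (- Re s - 1))"
    unfolding minus_add_distrib by (intro summable_mult) simp
  show "\<exists>N. \<forall>n\<ge>N. norm (norm (zeta_reg_term n s)) \<le> norm (s * (1 - s)) * real (n + 1) powr (- Re s - 1)"
    using norm_zeta_reg_term[of s] assms by auto
qed

text \<open>Growth is at most quadratic, uniformly in a half plane. Division by \<open>s - 1\<close>
  turns this into a linear bound for zeta away from the pole, which suffices to discard the
  horizontal sides of the contour.\<close>

lemma norm_zeta_reg_le: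
  assumes "c > 0"
  obtains C where "C \<ge> 0" "\<And>s. Re s \<ge> c \<Longrightarrow> norm (zeta_reg s) \<le> 1 + C * norm (s * (s - 1))"
proof
  define C where "C = (\<Sum>n. real (n + 1) powr (- (c + 1)))"
  have sm: "summable (\<lambda>n. real (n + 1) powr (- (c + 1)))"
    using assms by (intro summable_Suc_powr) auto
  show "C \<ge> 0" unfolding C_def by (intro suminf_nonneg sm) auto
  show "norm (zeta_reg s) \<le> 1 + C * norm (s * (s - 1))" if "Re s \<ge> c" for s
  proof -
    have "norm (\<Sum>n. zeta_reg_term n s) \<le> (\<Sum>n. norm (zeta_reg_term n s))"
      using that assms by (intro summable_norm summable_zeta_reg_term) auto
    also have "\<dots> \<le> (\<Sum>n. norm (s * (s - 1)) * real (n + 1) powr (- (c + 1)))"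
    proof (intro suminf_le summable_mult sm summable_zeta_reg_term)
      fix n
      have "norm (zeta_reg_term n s) \<le> norm (s * (1 - s)) * real (n + 1) powr (- Re s - 1)"
        using that assms by (intro norm_zeta_reg_term) auto
      also have "\<dots> \<le> norm (s * (1 - s)) * real (n + 1) powr (- (c + 1))"
        using that by (intro mult_left_mono powr_mono) auto
      finally show "norm (zeta_reg_term n s) \<le> norm (s * (s - 1)) * real (n + 1) powr (- (c + 1))"
        by (simp add: norm_mult norm_minus_commute)
    qed (use that assms in auto)
    also have "\<dots> = C * norm (s * (s - 1))"
      unfolding C_def by (subst suminf_mult[OF sm]) (simp add: mult.commute)
    finally show ?thesis
      unfolding zeta_reg_def using norm_triangle_ineq[of 1 "\<Sum>n. zeta_reg_term n s"] by simp
  qed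
qed

lemma holomorphic_on_suminf_majorant:
  fixes f :: "nat \<Rightarrow> complex \<Rightarrow> complex"
  assumes "open S" "\<And>n. f n holomorphic_on S"
    and maj: "\<And>K. compact K \<Longrightarrow> K \<subseteq> S \<Longrightarrow>
      \<exists>M. summable M \<and> (\<forall>n. \<forall>z\<in>K. norm (f n z) \<le> M n)"
  shows "(\<lambda>z. \<Sum>n. f n z) holomorphic_on S"
proof (rule holomorphic_uniform_sequence[OF assms(1)])
  show "(\<lambda>z. \<Sum>i<n. f i z) holomorphic_on S" for n
    using assms(2) by (intro holomorphic_intros) auto
  fix x assume "x \<in> S"
  then obtain d where d: "d > 0" "cball x d \<subseteq> S"
    using assms(1) open_contains_cball by blast
  obtain M where M: "summable M" "\<And>n z. z \<in> cball x d \<Longrightarrow> norm (f n z) \<le> M n"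
    using maj[of "cball x d"] d by auto
  have "uniform_limit (cball x d) (\<lambda>n z. \<Sum>i<n. f i z) (\<lambda>z. \<Sum>n. f n z) sequentially"
    by (rule Weierstrass_m_test[OF M(2) M(1)])
  with d show "\<exists>d>0. cball x d \<subseteq> S \<and>
      uniform_limit (cball x d) (\<lambda>n z. \<Sum>i<n. f i z) (\<lambda>z. \<Sum>n. f n z) sequentially" by blast
qed

lemma compact_Re_lower_bound:
  assumes "compact K" "K \<subseteq> {z. Re z > a}"
  obtains c where "c > a" "\<And>z. z \<in> K \<Longrightarrow> Re z \<ge> c"
proof (cases "K = {}")
  case True
  thus ?thesis by (intro that[of "a + 1"]) auto
next
  case False
  obtain z0 where "z0 \<in> K" "\<And>z. z \<in> K \<Longrightarrow> Re z0 \<le> Re z"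
    using continuous_attains_inf[OF assms(1) False continuous_on_Re[OF continuous_on_id]] by auto
  thus ?thesis using assms by (intro that[of "Re z0"]) auto
qed

lemma holomorphic_zeta_reg: "zeta_reg holomorphic_on {s. Re s > 0}"
proof -
  have "(\<lambda>s. \<Sum>n. zeta_reg_term n s) holomorphic_on {s. Re s > 0}"
  proof (rule holomorphic_on_suminf_majorant)
    show "open {s. Re s > 0}" by (rule open_halfspace_Re_gt)
    show "zeta_reg_term n holomorphic_on {s. Re s > 0}" for n
      unfolding zeta_reg_term_def by (intro holomorphic_intros)
    fix K assume K: "compact K" "K \<subseteq> {s. 0 < Re s}"
    obtain c where c: "c > 0" "\<And>z. z \<in> K \<Longrightarrow> Re z \<ge> c"
      using compact_Re_lower_bound[OF K] by blast
    have "compact ((\<lambda>s. s * (1 - s)) ` K)"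
      by (intro compact_continuous_image continuous_intros K)
    then obtain D where D: "\<And>s. s \<in> K \<Longrightarrow> norm (s * (1 - s)) \<le> D"
      by (meson bounded_iff compact_imp_bounded image_eqI)
    show "\<exists>M. summable M \<and> (\<forall>n. \<forall>s\<in>K. norm (zeta_reg_term n s) \<le> M n)"
    proof (intro exI[of _ "\<lambda>n. D * real (n + 1) powr (- (c + 1))"] conjI allI ballI)
      show "summable (\<lambda>n. D * real (n + 1) powr (- (c + 1)))"
        using c by (intro summable_mult summable_Suc_powr) auto
      fix n s assume "s \<in> K"
      have "norm (zeta_reg_term n s) \<le> norm (s * (1 - s)) * real (n + 1) powr (- Re s - 1)"
        using c(1) c(2)[OF \<open>s \<in> K\<close>] by (intro norm_zeta_reg_term) auto
      also have "\<dots> \<le> D * real (n + 1) powr (- (c + 1))"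
        using c(2)[OF \<open>s \<in> K\<close>] D[OF \<open>s \<in> K\<close>]
        by (intro mult_mono powr_mono order.trans[OF norm_ge_zero D[OF \<open>s \<in> K\<close>]]) auto
      finally show "norm (zeta_reg_term n s) \<le> D * real (n + 1) powr (- (c + 1))" .
    qed
  qed
  thus ?thesis unfolding zeta_reg_def[abs_def] by (intro holomorphic_intros)
qed

lemma sum_zeta_reg_term:
  "(\<Sum>n<N. zeta_reg_term n s) =
     of_nat (N + 1) powr (1 - s) - 1 + (s - 1) * (\<Sum>n<N. of_nat (n + 1) powr (-s))"
  by (induction N) (auto simp: zeta_reg_term_def algebra_simps)

lemma tendsto_of_nat_powr_zero:
  assumes "Re s < 0"
  shows "(\<lambda>n. of_nat (n + 1) powr s :: complex) \<longlonglongrightarrow> 0"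
proof (rule tendsto_norm_zero_cancel)
  have "(\<lambda>n. real (n + 1) powr Re s) \<longlonglongrightarrow> 0" using assms by real_asymp
  thus "(\<lambda>n. norm (of_nat (n + 1) powr s :: complex)) \<longlonglongrightarrow> 0"
    by (subst norm_of_nat_powr) auto
qed

lemma summable_dirichlet_powr:
  assumes "Re s > 1"
  shows "summable (\<lambda>n. norm (of_nat (n + 1) powr (-s) :: complex))"
  using summable_Suc_powr[of "Re s"] assms by (subst norm_of_nat_powr) auto

lemma dirichlet_series_zeta_reg:
  assumes "Re s > 1"
  shows "(\<lambda>n. of_nat (n + 1) powr (-s)) sums (zeta_reg s / (s - 1))"
proof -
  have 1: "(\<lambda>N. \<Sum>n<N. zeta_reg_term n s) \<longlonglongrightarrow> (\<Sum>n. zeta_reg_term n s)"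
    using assms by (intro summable_LIMSEQ summable_norm_cancel[OF summable_zeta_reg_term]) auto
  have "(\<lambda>N. of_nat (N + 1) powr (1 - s) - 1 + (s - 1) * (\<Sum>n<N. of_nat (n + 1) powr (-s)))
     \<longlonglongrightarrow> 0 - 1 + (s - 1) * (\<Sum>n. of_nat (n + 1) powr (-s))"
    using assms by (intro tendsto_intros tendsto_of_nat_powr_zero summable_LIMSEQ
       summable_norm_cancel[OF summable_dirichlet_powr]) auto
  from LIMSEQ_unique[OF 1 this[folded sum_zeta_reg_term]]
  have "zeta_reg s = (s - 1) * (\<Sum>n. of_nat (n + 1) powr (-s))"
    by (simp add: zeta_reg_def)
  moreover have "s \<noteq> 1" using assms by auto
  ultimately have "zeta_reg s / (s - 1) = (\<Sum>n. of_nat (n + 1) powr (-s))"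
    by (simp add: field_simps)
  thus ?thesis
    using summable_sums[OF summable_norm_cancel[OF summable_dirichlet_powr[OF assms]]] by metis
qed

section \<open>The alternating series and its relation to \<open>zeta_reg\<close>\<close>

text \<open>Changing the sign at the even denominators subtracts twice their sum, and that sum is
  \<open>2 powr (-s)\<close> times a partial sum of half the length.\<close>

lemma eta_partial_sum:
  "(\<Sum>n<2*N. (-1) ^ n * of_nat (n + 1) powr (-s) :: complex) =
   (\<Sum>n<2*N. of_nat (n + 1) powr (-s)) - 2 powr (1 - s) * (\<Sum>n<N. of_nat (n + 1) powr (-s))"
proof (induction N)
  case (Suc N)
  have "of_nat (2 * N + 2) powr (-s) = (of_real 2 * of_real (real (N + 1)) :: complex) powr (-s)"
    by simp
  also have "\<dots> = 2 powr (-s) * of_nat (N + 1) powr (-s)"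
    by (subst powr_times_real) auto
  finally have "of_nat (2 * N + 2) powr (-s) = (2 powr (-s) * of_nat (N + 1) powr (-s) :: complex)" .
  moreover have "2 powr (1 - s) = 2 * 2 powr (-s :: complex)"
    by (simp add: powr_diff powr_minus field_simps)
  ultimately show ?case using Suc by (simp add: algebra_simps)
qed auto

text \<open>For \<open>Re s \<le> 1\<close> the sums \<open>A\<close> do not converge, but their
  divergent parts \<open>of_nat (N + 1) powr (1 - s)\<close> cancel to first order in the
  combination of \<open>eta_partial_sum\<close>.\<close>

lemma eta_sums:
  assumes "Re s > 0" and "s \<noteq> 1"
  shows "(\<lambda>n. (-1) ^ n * of_nat (n + 1) powr (-s)) sums ((1 - 2 powr (1 - s)) * zeta_reg s / (s - 1))"
proof -
  define A :: "nat \<Rightarrow> complex" where "A = (\<lambda>N. \<Sum>n<N. of_nat (n + 1) powr (-s))"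
  define E :: "nat \<Rightarrow> complex" where "E = (\<lambda>N. \<Sum>n<N. (-1) ^ n * of_nat (n + 1) powr (-s))"
  define H where "H = (\<lambda>N. 1 + (\<Sum>n<N. zeta_reg_term n s))"
  have H: "H \<longlonglongrightarrow> zeta_reg s"
    unfolding H_def zeta_reg_def using assms
    by (intro tendsto_intros summable_LIMSEQ summable_norm_cancel[OF summable_zeta_reg_term]) auto
  have A: "(s - 1) * A N = H N - of_nat (N + 1) powr (1 - s)" for N
    unfolding A_def H_def sum_zeta_reg_term by simp
  have two: "2 powr (1 - s) * of_nat (N + 1) powr (1 - s) = (of_nat (2 * N + 2) powr (1 - s) :: complex)" for N
  proof -
    have "of_nat (2 * N + 2) powr (1 - s) = (of_real 2 * of_real (real (N + 1)) :: complex) powr (1 - s)"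
      by simp
    also have "\<dots> = 2 powr (1 - s) * of_nat (N + 1) powr (1 - s)"
      by (subst powr_times_real) auto
    finally show ?thesis ..
  qed
  have E: "(s - 1) * E (2 * N) = H (2 * N) - 2 powr (1 - s) * H N
     + zeta_reg_term (2 * N) s + (1 - s) * of_nat (2 * N + 1) powr (-s)" for N
  proof -
    have "(s - 1) * E (2 * N) = (s - 1) * A (2 * N) - 2 powr (1 - s) * ((s - 1) * A N)"
      unfolding E_def A_def eta_partial_sum by (simp add: algebra_simps)
    also have "\<dots> = H (2 * N) - 2 powr (1 - s) * H N
        + (2 powr (1 - s) * of_nat (N + 1) powr (1 - s) - of_nat (2 * N + 1) powr (1 - s))"
      unfolding A by (simp add: algebra_simps)
    \<comment> \<open>After the cancellation there remains the increment of
      \<open>z powr (1 - s)\<close> from \<open>2 * N + 1\<close> to \<open>2 * N + 2\<close>, which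
      tends to 0 because its derivative has exponent \<open>- s\<close>.\<close>
    also have "2 powr (1 - s) * of_nat (N + 1) powr (1 - s) - of_nat (2 * N + 1) powr (1 - s) =
        zeta_reg_term (2 * N) s + (1 - s) * of_nat (2 * N + 1) powr (-s)"
      unfolding two zeta_reg_term_def by simp
    finally show ?thesis by (simp add: algebra_simps)
  qed
  have sub: "strict_mono (\<lambda>N::nat. 2 * N)" by (auto simp: strict_mono_def)
  have t0: "(\<lambda>N. zeta_reg_term N s) \<longlonglongrightarrow> 0"
    using assms by (intro summable_LIMSEQ_zero summable_norm_cancel[OF summable_zeta_reg_term]) auto
  have p0: "(\<lambda>n. of_nat (n + 1) powr (-s) :: complex) \<longlonglongrightarrow> 0"
    using assms by (intro tendsto_of_nat_powr_zero) auto
  have "(\<lambda>N. H (2 * N) - 2 powr (1 - s) * H N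
     + zeta_reg_term (2 * N) s + (1 - s) * of_nat (2 * N + 1) powr (-s))
     \<longlonglongrightarrow> zeta_reg s - 2 powr (1 - s) * zeta_reg s + 0 + (1 - s) * 0"
    using LIMSEQ_subseq_LIMSEQ[OF H sub] LIMSEQ_subseq_LIMSEQ[OF t0 sub] LIMSEQ_subseq_LIMSEQ[OF p0 sub]
    by (intro tendsto_intros H) (auto simp: o_def)
  hence "(\<lambda>N. ((s - 1) * E (2 * N)) / (s - 1)) \<longlonglongrightarrow>
     (zeta_reg s - 2 powr (1 - s) * zeta_reg s + 0 + (1 - s) * 0) / (s - 1)"
    unfolding E[symmetric] by (intro tendsto_intros) (use assms in auto)
  hence even: "(\<lambda>N. E (2 * N)) \<longlonglongrightarrow> (1 - 2 powr (1 - s)) * zeta_reg s / (s - 1)"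
    using \<open>s \<noteq> 1\<close> by (subst (asm) nonzero_mult_div_cancel_left) (simp_all add: left_diff_distrib)
  have "(\<lambda>N. E (2 * N) + of_nat (2 * N + 1) powr (-s)) \<longlonglongrightarrow> (1 - 2 powr (1 - s)) * zeta_reg s / (s - 1) + 0"
    using LIMSEQ_subseq_LIMSEQ[OF p0 sub] by (intro tendsto_intros even) (auto simp: o_def)
  hence odd: "(\<lambda>N. E (2 * N + 1)) \<longlonglongrightarrow> (1 - 2 powr (1 - s)) * zeta_reg s / (s - 1)"
    by (simp add: E_def)
  show ?thesis
    unfolding sums_def using limseq_even_odd[OF even odd] by (simp add: E_def)
qed

text \<open>In the open strip \<open>2 powr (1 - s)\<close> has modulus greater than 1, so the
  quotient defining \<open>zeta\<close> never divides by zero there.\<close>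

lemma zeta_eq_zeta_reg:
  assumes "0 < Re s" "Re s < 1"
  shows "zeta s = zeta_reg s / (s - 1)"
proof -
  have "s \<noteq> 1" using assms by auto
  have "eta s = (\<Sum>n. (-1) ^ n * of_nat (n + 1) powr (-s))"
    unfolding eta_def by (simp add: powr_minus divide_inverse)
  also have "\<dots> = (1 - 2 powr (1 - s)) * zeta_reg s / (s - 1)"
    using eta_sums[OF assms(1) \<open>s \<noteq> 1\<close>] by (simp add: sums_iff)
  finally have eta: "eta s = (1 - 2 powr (1 - s)) * zeta_reg s / (s - 1)" .
  have "norm (2 powr (1 - s) :: complex) = 2 powr (1 - Re s)"
    by (subst norm_powr_real_powr) auto
  also have "\<dots> > 1" using assms by simp
  finally have "2 powr (1 - s) \<noteq> (1 :: complex)" by auto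
  thus ?thesis using assms by (simp add: zeta_def eta)
qed

section \<open>The von Mangoldt series and non-vanishing at the edge of convergence\<close>

lemma has_sum_mult_abs:
  fixes f :: "'a \<Rightarrow> 'c :: {real_normed_field, banach}" and g :: "'b \<Rightarrow> 'c"
  assumes f: "(f has_sum F) A" and g: "(g has_sum G) B"
    and abs: "(\<lambda>x. norm (f x)) summable_on A" "(\<lambda>x. norm (g x)) summable_on B"
  shows "((\<lambda>(x, y). f x * g y) has_sum F * G) (A \<times> B)"
proof (rule has_sum_SigmaI)
  show "((\<lambda>y. case (x, y) of (x, y) \<Rightarrow> f x * g y) has_sum f x * G) B" for x
    using has_sum_cmult_right[OF g, of "f x"] by simp
  show "((\<lambda>x. f x * G) has_sum F * G) A"
    using has_sum_cmult_left[OF f, of G] by simp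
  show "(\<lambda>(x, y). f x * g y) summable_on A \<times> B"
  proof (rule Infinite_Sum.abs_summable_summable,
      rule iffD2[OF Infinite_Sum.abs_summable_on_Sigma_iff[of "\<lambda>(x, y). f x * g y" A "\<lambda>_. B"]], intro conjI ballI)
    show "(\<lambda>y. norm (case (x, y) of (x, y) \<Rightarrow> f x * g y)) summable_on B" for x
      using summable_on_cmult_right[OF abs(2), of "norm (f x)"] by (simp add: norm_mult)
    have "(\<Sum>\<^sub>\<infinity>y\<in>B. norm (case (x, y) of (x, y) \<Rightarrow> f x * g y)) = norm (f x) * (\<Sum>\<^sub>\<infinity>y\<in>B. norm (g y))" for x
      by (simp add: norm_mult infsum_cmult_right')
    thus "(\<lambda>x. norm (\<Sum>\<^sub>\<infinity>y\<in>B. norm (case (x, y) of (x, y) \<Rightarrow> f x * g y))) summable_on A"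
      using summable_on_cmult_left[OF abs(1), of "norm (\<Sum>\<^sub>\<infinity>y\<in>B. norm (g y))"] by (simp add: norm_mult abs_mult)
  qed
qed

text \<open>The term \<open>n = 0\<close> vanishes, as \<open>0 powr z = 0\<close>.\<close>

definition dseries :: "(nat \<Rightarrow> real) \<Rightarrow> complex \<Rightarrow> complex" where
  "dseries a s = (\<Sum>n. of_real (a n) * of_nat n powr (-s))"

lemma norm_dterm: "norm (of_real (a n) * of_nat n powr (-s) :: complex) = \<bar>a n\<bar> * real n powr (- Re s)"
  by (cases "n = 0") (auto simp: norm_mult norm_of_nat_powr)

lemma summable_ln_powr:
  assumes "c > 1"
  shows "summable (\<lambda>n. ln (real n) * real n powr (-c))"
proof (rule summable_comparison_test)
  define e where "e = (c - 1) / 2"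
  have e: "e > 0" using assms by (simp add: e_def)
  have "summable (\<lambda>n. real n powr (- (c - e)))"
    using summable_real_powr_iff[of "- (c - e)"] assms by (simp add: e_def field_simps)
  thus "summable (\<lambda>n. (1 / e) * real n powr (- (c - e)))" by (rule summable_mult)
  show "\<exists>N. \<forall>n\<ge>N. norm (ln (real n) * real n powr (-c)) \<le> (1 / e) * real n powr (- (c - e))"
  proof (intro exI[of _ 1] allI impI)
    fix n :: nat assume n: "n \<ge> 1"
    have "ln (real n) \<le> real n powr e / e" using n e by (intro ln_powr_bound) auto
    hence "ln (real n) * real n powr (-c) \<le> (real n powr e / e) * real n powr (-c)"
      by (rule mult_right_mono) auto
    also have "\<dots> = (1 / e) * real n powr (- (c - e))"
      by (simp add: powr_add[symmetric] algebra_simps)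
    finally show "norm (ln (real n) * real n powr (-c)) \<le> (1 / e) * real n powr (- (c - e))"
      using n by simp
  qed
qed

lemma summable_mangoldt_powr:
  assumes "c > 1"
  shows "summable (\<lambda>n. mangoldt n * real n powr (-c))"
proof (rule summable_comparison_test[OF _ summable_ln_powr[OF assms]])
  show "\<exists>N. \<forall>n\<ge>N. norm (mangoldt n * real n powr (-c)) \<le> ln (real n) * real n powr (-c)"
    by (intro exI[of _ 1] allI impI) (auto simp: mangoldt_nonneg intro!: mult_right_mono mangoldt_le)
qed

context
  fixes a :: "nat \<Rightarrow> real"
  assumes nonneg: "\<And>n. a n \<ge> 0"
    and summ: "\<And>c. c > 1 \<Longrightarrow> summable (\<lambda>n. a n * real n powr (-c))"
begin

lemma norm_dterm_le:
  assumes "Re s \<ge> c"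
  shows "norm (of_real (a n) * of_nat n powr (-s) :: complex) \<le> a n * real n powr (-c)"
  unfolding norm_dterm using assms nonneg[of n]
  by (cases "n = 0") (auto intro!: mult_left_mono powr_mono)

lemma summable_dterm: "Re s > 1 \<Longrightarrow> summable (\<lambda>n. norm (of_real (a n) * of_nat n powr (-s) :: complex))"
  unfolding norm_dterm using summ[of "Re s"] nonneg by simp

lemma holomorphic_dseries: "dseries a holomorphic_on {s. Re s > 1}"
  unfolding dseries_def[abs_def]
proof (rule holomorphic_on_suminf_majorant)
  show "open {s. Re s > 1}" by (rule open_halfspace_Re_gt)
  show "(\<lambda>z. of_real (a n) * of_nat n powr (- z)) holomorphic_on {s. Re s > 1}" for n
    by (cases "n = 0") (auto intro!: holomorphic_intros)
  fix K assume K: "compact K" "K \<subseteq> {s. 1 < Re s}"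
  obtain c where c: "c > 1" "\<And>z. z \<in> K \<Longrightarrow> Re z \<ge> c"
    using compact_Re_lower_bound[OF K] by blast
  show "\<exists>M. summable M \<and> (\<forall>n. \<forall>z\<in>K. cmod (of_real (a n) * of_nat n powr (- z)) \<le> M n)"
    using summ[OF c(1)] norm_dterm_le[OF c(2)] by blast
qed

lemma has_sum_dseries:
  assumes "Re s > 1"
  shows "((\<lambda>n. of_real (a n) * of_nat n powr (-s)) has_sum dseries a s) UNIV"
  unfolding dseries_def
  by (intro norm_summable_imp_has_sum summable_dterm assms summable_sums summable_norm_cancel)

end

lemma zeta_series:
  assumes "Re s > 1"
  shows "dseries (\<lambda>_. 1) s = zeta_reg s / (s - 1)"
proof -
  have "(\<lambda>n. of_nat n powr (-s)) sums (zeta_reg s / (s - 1))"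
    using dirichlet_series_zeta_reg[OF assms] sums_Suc_iff[of "\<lambda>n. of_nat n powr (-s)"] by simp
  thus ?thesis by (simp add: dseries_def sums_iff)
qed

lemma summable_one_powr: "c > 1 \<Longrightarrow> summable (\<lambda>n. 1 * real n powr (-c))"
  using summable_real_powr_iff[of "-c"] by simp

text \<open>Dirichlet convolution: the pairs \<open>(d, e)\<close> are grouped by
  \<open>n = d * e\<close>, and the von Mangoldt function summed over the divisors of
  \<open>n\<close> is \<open>ln n\<close>.\<close>

lemma dseries_mangoldt_mult:
  assumes "Re s > 1"
  shows "dseries mangoldt s * dseries (\<lambda>_. 1) s = dseries (\<lambda>n. ln (real n)) s"
proof -
  let ?f = "\<lambda>n. of_real (mangoldt n) * of_nat n powr (-s) :: complex"
  let ?g = "\<lambda>n. of_real 1 * of_nat n powr (-s) :: complex"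
  have ln0: "ln (real n) \<ge> 0" for n by (cases "n = 0") auto
  have f: "(?f has_sum dseries mangoldt s) UNIV"
    by (rule has_sum_dseries[OF mangoldt_nonneg summable_mangoldt_powr assms])
  have g: "(?g has_sum dseries (\<lambda>_. 1) s) UNIV"
    by (rule has_sum_dseries[OF _ summable_one_powr assms]) auto
  have nf: "(\<lambda>n. norm (?f n)) summable_on UNIV"
    using summable_dterm[OF mangoldt_nonneg summable_mangoldt_powr assms]
    by (intro norm_summable_imp_summable_on) simp
  have ng: "(\<lambda>n. norm (?g n)) summable_on UNIV"
    using summable_dterm[where a = "\<lambda>_. 1", OF _ summable_one_powr assms]
    by (intro norm_summable_imp_summable_on) simp
  have "((\<lambda>(d, e). ?f d * ?g e) has_sum (dseries mangoldt s * dseries (\<lambda>_. 1) s)) (UNIV \<times> UNIV)"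
    by (rule has_sum_mult_abs[OF f g nf ng])
  \<comment> \<open>Zero indices contribute nothing since \<open>0 powr z = 0\<close>; without them
    the regrouping by divisors is a bijection.\<close>
  also have "?this \<longleftrightarrow> ((\<lambda>(d, e). ?f d * ?g e) has_sum (dseries mangoldt s * dseries (\<lambda>_. 1) s)) ({1..} \<times> {1..})"
    by (rule has_sum_cong_neutral) (auto simp: not_le Suc_le_eq)
  also have "\<dots> \<longleftrightarrow> ((\<lambda>(n, d). of_real (mangoldt d) * of_nat n powr (-s)) has_sum
       (dseries mangoldt s * dseries (\<lambda>_. 1) s)) (SIGMA n:{1..}. {d. d dvd n})"
  proof (rule has_sum_reindex_bij_witness[where i = "\<lambda>(n, d). (d, n div d)" and j = "\<lambda>(d, e). (d * e, d)"], goal_cases)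
    case (4 b)
    thus ?case by (auto simp: Suc_le_eq div_greater_zero_iff dvd_imp_le intro: Nat.gr0I)
  next
    case (5 a)
    then obtain p q where pq: "a = (p, q)" "p \<ge> 1" "q \<ge> 1" by auto
    have "of_nat (p * q) powr (-s) = (of_real (real p) * of_real (real q) :: complex) powr (-s)" by simp
    also have "\<dots> = of_nat p powr (-s) * of_nat q powr (-s)"
      by (subst powr_times_real) auto
    finally show ?case using pq by simp
  qed auto
  finally have "((\<lambda>n. of_real (ln (real n)) * of_nat n powr (-s)) has_sum (dseries mangoldt s * dseries (\<lambda>_. 1) s)) {1..}"
  proof (rule has_sum_SigmaD)
    fix n :: nat assume n: "n \<in> {1..}"
    have "((\<lambda>d. of_real (mangoldt d) * of_nat n powr (-s)) has_sum
       (\<Sum>d | d dvd n. of_real (mangoldt d) * of_nat n powr (-s) :: complex)) {d. d dvd n}"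
      using n by (intro has_sum_finite) auto
    also have "(\<Sum>d | d dvd n. of_real (mangoldt d) * of_nat n powr (-s)) =
       of_real (ln (real n)) * of_nat n powr (-s)"
      using mangoldt_sum[of n, where ?'a = real] n
      by (simp add: sum_distrib_right[symmetric] of_real_sum[symmetric] del: of_real_sum of_real_mangoldt)
    finally show "((\<lambda>d. case (n, d) of (n, d) \<Rightarrow> of_real (mangoldt d) * of_nat n powr (-s)) has_sum
       of_real (ln (real n)) * of_nat n powr (-s)) {d. d dvd n}" by simp
  qed
  also have "?this \<longleftrightarrow> ((\<lambda>n. of_real (ln (real n)) * of_nat n powr (-s)) has_sum
        (dseries mangoldt s * dseries (\<lambda>_. 1) s)) UNIV"
    by (rule has_sum_cong_neutral) (auto simp: not_le Suc_le_eq)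
  finally have "((\<lambda>n. of_real (ln (real n)) * of_nat n powr (-s)) has_sum
        (dseries mangoldt s * dseries (\<lambda>_. 1) s)) UNIV" .
  thus ?thesis by (rule has_sum_unique[OF _ has_sum_dseries[OF ln0 summable_ln_powr assms]])
qed

lemma deriv_zeta_series:
  assumes "Re s > 1"
  shows "(dseries (\<lambda>_. 1) has_field_derivative - dseries (\<lambda>n. ln (real n)) s) (at s)"
proof -
  define c where "c = (1 + Re s) / 2"
  have c: "c > 1" "c < Re s" using assms by (auto simp: c_def)
  define S where "S = {z. Re z > c}"
  have ln0: "ln (real n) \<ge> 0" for n by (cases "n = 0") auto
  have "((\<lambda>s. \<Sum>n. of_real 1 * of_nat n powr (-s)) has_field_derivative
      (\<Sum>n. - (of_real (ln (real n)) * of_nat n powr (-s)))) (at s)"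
  proof (rule has_field_derivative_series'(2))
    show "convex S" unfolding S_def by (rule convex_halfspace_Re_gt)
    show "((\<lambda>s. of_real 1 * of_nat n powr (-s)) has_field_derivative
       - (of_real (ln (real n)) * of_nat n powr (-x))) (at x within S)" for n and x :: complex
    proof (cases "n = 0")
      case False
      have "((\<lambda>s. of_nat n powr (-s)) has_field_derivative
       - (of_real (ln (real n)) * of_nat n powr (-x) :: complex)) (at x within S)"
        unfolding powr_def using False by (auto intro!: derivative_eq_intros simp: Ln_of_nat)
      thus ?thesis by simp
    qed auto
    show "uniformly_convergent_on S (\<lambda>n x. \<Sum>i<n. - (of_real (ln (real i)) * of_nat i powr (-x) :: complex))"
    proof (rule Weierstrass_m_test'[OF _ summable_ln_powr[OF c(1)]])
      fix n x assume "x \<in> S"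
      hence "Re x \<ge> c" by (simp add: S_def)
      from norm_dterm_le[OF ln0 summable_ln_powr this]
      show "norm (- (of_real (ln (real n)) * of_nat n powr (-x) :: complex)) \<le> ln (real n) * real n powr (-c)"
        by simp
    qed
    have "open S" unfolding S_def by (rule open_halfspace_Re_gt)
    moreover show "s \<in> S" using c by (simp add: S_def)
    ultimately show "s \<in> interior S" by (simp add: interior_open)
    show "summable (\<lambda>n. of_real 1 * of_nat n powr (-s) :: complex)"
      by (rule summable_norm_cancel[OF summable_dterm[where a = "\<lambda>_. 1", OF _ summable_one_powr assms]]) auto
  qed
  also have "(\<Sum>n. - (of_real (ln (real n)) * of_nat n powr (-s))) = - dseries (\<lambda>n. ln (real n)) s"
    unfolding dseries_def
    by (intro suminf_minus summable_norm_cancel[OF summable_dterm[OF ln0 summable_ln_powr assms]])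
  finally show ?thesis unfolding dseries_def[abs_def] .
qed

text \<open>If \<open>P\<close> is a primitive of \<open>- \<zeta>'/\<zeta>\<close>, then \<open>\<zeta> exp P\<close> is constant.\<close>

lemma zeta_series_nonzero:
  assumes "Re s > 1"
  shows "dseries (\<lambda>_. 1) s \<noteq> 0"
proof -
  define S where "S = {s. Re s > 1}"
  have S: "open S" "convex S" by (auto simp: S_def open_halfspace_Re_gt convex_halfspace_Re_gt)
  have "dseries mangoldt holomorphic_on S"
    unfolding S_def by (rule holomorphic_dseries[OF mangoldt_nonneg summable_mangoldt_powr])
  then obtain P where P: "\<And>x. x \<in> S \<Longrightarrow> (P has_field_derivative dseries mangoldt x) (at x within S)"
    using holomorphic_convex_primitive'[OF S(2,1)] by blast
  have "\<exists>c. \<forall>x\<in>S. dseries (\<lambda>_. 1) x * exp (P x) = c"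
  proof (rule has_field_derivative_zero_constant[OF S(2)])
    fix x assume x: "x \<in> S"
    have "(P has_field_derivative dseries mangoldt x) (at x)"
      using P[OF x] S x at_within_open by metis
    moreover have "(dseries (\<lambda>_. 1) has_field_derivative - dseries (\<lambda>n. ln (real n)) x) (at x)"
      using x by (intro deriv_zeta_series) (simp add: S_def)
    ultimately have "((\<lambda>x. dseries (\<lambda>_. 1) x * exp (P x)) has_field_derivative
       (- dseries (\<lambda>n. ln (real n)) x) * exp (P x) + exp (P x) * dseries mangoldt x * dseries (\<lambda>_. 1) x) (at x)"
      by (auto intro!: derivative_eq_intros)
    also have "(- dseries (\<lambda>n. ln (real n)) x) * exp (P x) + exp (P x) * dseries mangoldt x * dseries (\<lambda>_. 1) x = 0"
      using dseries_mangoldt_mult[of x] x by (simp add: S_def algebra_simps)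
    finally show "((\<lambda>x. dseries (\<lambda>_. 1) x * exp (P x)) has_field_derivative 0) (at x within S)"
      by (rule has_field_derivative_at_within)
  qed
  then obtain c where c: "\<And>x. x \<in> S \<Longrightarrow> dseries (\<lambda>_. 1) x * exp (P x) = c" by blast
  have "dseries (\<lambda>_. 1) 2 \<noteq> 0"
  proof -
    have "summable (\<lambda>n. real n powr (-2))" using summable_one_powr[of 2] by simp
    hence "(\<Sum>n. real n powr (-2)) > 0"
      by (rule suminf_pos2[of _ 1]) auto
    moreover have "dseries (\<lambda>_. 1) 2 = of_real (\<Sum>n. real n powr (-2))"
    proof -
      have "of_nat n powr (-2) = (of_real (real n powr (-2)) :: complex)" for n
        using powr_of_real[of "real n" "-2"] by simp
      thus ?thesis using suminf_of_real[where ?'a = complex, OF \<open>summable (\<lambda>n. real n powr (-2))\<close>]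
        by (simp add: dseries_def)
    qed
    ultimately show ?thesis by (metis of_real_eq_0_iff less_irrefl)
  qed
  hence "c \<noteq> 0" using c[of 2] by (auto simp: S_def)
  thus ?thesis using c[of s] assms by (auto simp: S_def)
qed

lemma zeta_reg_nonzero_gt_1: "Re s > 1 \<Longrightarrow> zeta_reg s \<noteq> 0"
  using zeta_series_nonzero[of s] zeta_series[of s] by auto

text \<open>This is \<open>- \<zeta>' / \<zeta>\<close> for
  \<open>\<zeta> = zeta_reg / (s - 1)\<close>. The pole is split off so that the remaining quotient
  can be followed up to the line \<open>Re s = 1\<close>.\<close>

lemma dseries_mangoldt_eq:
  assumes "Re s > 1"
  shows "dseries mangoldt s = 1 / (s - 1) - deriv zeta_reg s / zeta_reg s"
proof -
  have s1: "s \<noteq> 1" using assms by auto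
  have "(zeta_reg has_field_derivative deriv zeta_reg s) (at s)"
    using holomorphic_derivI[OF holomorphic_zeta_reg open_halfspace_Re_gt] assms by auto
  hence "((\<lambda>s. zeta_reg s / (s - 1)) has_field_derivative
       (deriv zeta_reg s * (s - 1) - zeta_reg s) / (s - 1) ^ 2) (at s)"
    using s1 by (auto intro!: derivative_eq_intros simp: power2_eq_square)
  moreover have "((\<lambda>s. zeta_reg s / (s - 1)) has_field_derivative - dseries (\<lambda>n. ln (real n)) s) (at s)"
    using deriv_zeta_series[OF assms]
    by (rule has_field_derivative_transform_within_open[of _ _ _ "{s. Re s > 1}"])
       (use assms in \<open>auto simp: open_halfspace_Re_gt zeta_series\<close>)
  ultimately have "(deriv zeta_reg s * (s - 1) - zeta_reg s) / (s - 1) ^ 2 = - dseries (\<lambda>n. ln (real n)) s"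
    by (rule DERIV_unique)
  also have "\<dots> = - (dseries mangoldt s * (zeta_reg s / (s - 1)))"
    using dseries_mangoldt_mult[OF assms] zeta_series[OF assms] by simp
  finally have "dseries mangoldt s * zeta_reg s = zeta_reg s / (s - 1) - deriv zeta_reg s"
    using s1 by (simp add: divide_simps power2_eq_square) (simp add: algebra_simps)?
  thus ?thesis using zeta_reg_nonzero_gt_1[OF assms] by (simp add: field_simps)
qed

section \<open>Non-vanishing on the line Re s = 1\<close>

text \<open>Writing \<open>f w = g w * (w - z) ^ m\<close> with \<open>g z \<noteq> 0\<close>, the
  logarithmic derivative is \<open>m / (w - z)\<close> plus a function regular at \<open>z\<close>;
  thus \<open>m\<close> is the order of the zero.\<close>

lemma log_deriv_tendsto_order:
  fixes f :: "complex \<Rightarrow> complex"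
  assumes "f holomorphic_on S" "open S" "connected S" "z \<in> S" "\<exists>w\<in>S. f w \<noteq> 0"
  obtains m :: nat where "((\<lambda>s. (s - z) * (deriv f s / f s)) \<longlongrightarrow> of_nat m) (at z)" "f z = 0 \<Longrightarrow> m > 0"
proof -
  define n where "n = zorder f z"
  define g where "g = zor_poly f z"
  have *: "(if f z = 0 then n > 0 else n = 0) \<and> (\<exists>r. r > 0 \<and> cball z r \<subseteq> S \<and> g holomorphic_on cball z r
    \<and> (\<forall>w\<in>cball z r. f w = g w * (w - z) ^ nat n \<and> g w \<noteq> 0))"
    unfolding n_def g_def by (rule zorder_exist_zero[OF assms])
  then obtain r where r: "r > 0" "cball z r \<subseteq> S" "g holomorphic_on cball z r"
    "\<And>w. w \<in> cball z r \<Longrightarrow> f w = g w * (w - z) ^ nat n" "\<And>w. w \<in> cball z r \<Longrightarrow> g w \<noteq> 0" by blast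
  have g: "g holomorphic_on ball z r" using r(3) ball_subset_cball holomorphic_on_subset by blast
  have eq: "(s - z) * (deriv f s / f s) = of_nat (nat n) + (s - z) * deriv g s / g s"
    if s: "s \<in> ball z r - {z}" for s
  proof -
    have "(g has_field_derivative deriv g s) (at s)"
      using holomorphic_derivI[OF g open_ball] s by auto
    hence "((\<lambda>w. g w * (w - z) ^ nat n) has_field_derivative
       deriv g s * (s - z) ^ nat n + of_nat (nat n) * (s - z) ^ (nat n - 1) * g s) (at s)"
      by (auto intro!: derivative_eq_intros)
    hence "(f has_field_derivative
       deriv g s * (s - z) ^ nat n + of_nat (nat n) * (s - z) ^ (nat n - 1) * g s) (at s)"
      by (rule has_field_derivative_transform_within_open[of _ _ _ "ball z r"]) (use s r(4) in auto)
    hence d: "deriv f s = deriv g s * (s - z) ^ nat n + of_nat (nat n) * (s - z) ^ (nat n - 1) * g s"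
      by (rule DERIV_imp_deriv)
    have f: "f s = g s * (s - z) ^ nat n" and gs: "g s \<noteq> 0" using s r by auto
    show ?thesis
    proof (cases "nat n")
      case 0
      thus ?thesis using d f by simp
    next
      case (Suc k)
      have "s - z \<noteq> 0" using s by auto
      thus ?thesis using gs unfolding d f Suc by (simp add: field_simps)
    qed
  qed
  have "((\<lambda>s. of_nat (nat n) + (s - z) * deriv g s / g s) \<longlongrightarrow>
      of_nat (nat n) + (z - z) * deriv g z / g z) (at z)"
  proof (intro tendsto_intros)
    have "deriv g holomorphic_on ball z r" using g by (intro holomorphic_deriv) auto
    thus "(deriv g \<longlongrightarrow> deriv g z) (at z)"
      using r(1) by (metis centre_in_ball continuous_on_eq_continuous_at holomorphic_on_imp_continuous_on isCont_def open_ball)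
    show "(g \<longlongrightarrow> g z) (at z)"
      using g r(1) by (metis centre_in_ball continuous_on_eq_continuous_at holomorphic_on_imp_continuous_on isCont_def open_ball)
    show "g z \<noteq> 0" using r by auto
  qed
  moreover have "\<forall>\<^sub>F s in at z. of_nat (nat n) + (s - z) * deriv g s / g s = (s - z) * (deriv f s / f s)"
    using eventually_at_ball'[OF r(1), of z UNIV]
    by eventually_elim (use eq in auto)
  ultimately have "((\<lambda>s. (s - z) * (deriv f s / f s)) \<longlongrightarrow> of_nat (nat n)) (at z)"
    by (simp add: filterlim_cong)
  moreover have "f z = 0 \<Longrightarrow> nat n > 0" using * by auto
  ultimately show ?thesis by (rule that)
qed

lemma three_four_one: "3 + 4 * cos t + cos (2 * t) \<ge> (0 :: real)"
proof -
  have "3 + 4 * cos t + cos (2 * t) = 2 * (1 + cos t)\<^sup>2"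
    unfolding cos_double_cos by (simp add: power2_eq_square algebra_simps)
  thus ?thesis by simp
qed

lemma Re_of_nat_powr:
  assumes "n > 0"
  shows "Re (of_nat n powr (- Complex x t)) = real n powr (- x) * cos (t * ln (real n))"
proof -
  have "of_nat n powr (- Complex x t) = exp (Complex (- x * ln (real n)) (- (t * ln (real n))))"
    using assms by (simp add: powr_def Ln_of_nat) (simp add: complex_eq_iff Complex_eq algebra_simps)
  thus ?thesis using assms by (simp add: Re_exp powr_def)
qed

text \<open>The coefficients are nonnegative, so the trigonometric inequality applies term by term
  with the angle \<open>t * ln n\<close>.\<close>

lemma mangoldt_341:
  assumes "x > 1"
  shows "3 * Re (dseries mangoldt (Complex x 0)) + 4 * Re (dseries mangoldt (Complex x t))
     + Re (dseries mangoldt (Complex x (2 * t))) \<ge> 0"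
proof -
  have s: "(\<lambda>n. mangoldt n * (real n powr (-x) * cos (u * ln (real n)))) sums Re (dseries mangoldt (Complex x u))" for u
  proof -
    have "(\<lambda>n. of_real (mangoldt n) * of_nat n powr (- Complex x u)) sums dseries mangoldt (Complex x u)"
      by (intro has_sum_imp_sums has_sum_dseries[OF mangoldt_nonneg summable_mangoldt_powr]) (use assms in auto)
    hence "(\<lambda>n. Re (of_real (mangoldt n) * of_nat n powr (- Complex x u))) sums Re (dseries mangoldt (Complex x u))"
      by (rule sums_Re)
    also have "(\<lambda>n. Re (of_real (mangoldt n) * of_nat n powr (- Complex x u))) =
        (\<lambda>n. mangoldt n * (real n powr (-x) * cos (u * ln (real n))))"
    proof
      fix n show "Re (of_real (mangoldt n) * of_nat n powr (- Complex x u)) =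
        mangoldt n * (real n powr (-x) * cos (u * ln (real n)))"
        by (cases "n = 0") (simp_all add: Re_of_nat_powr)
    qed
    finally show ?thesis .
  qed
  have S: "(\<lambda>n. 3 * (mangoldt n * (real n powr (-x) * cos (0 * ln (real n))))
       + 4 * (mangoldt n * (real n powr (-x) * cos (t * ln (real n))))
       + mangoldt n * (real n powr (-x) * cos (2 * t * ln (real n)))) sums
    (3 * Re (dseries mangoldt (Complex x 0)) + 4 * Re (dseries mangoldt (Complex x t))
     + Re (dseries mangoldt (Complex x (2 * t))))"
    by (intro sums_add sums_mult s)
  have P: "0 \<le> 3 * (mangoldt n * (real n powr (-x) * cos (0 * ln (real n))))
       + 4 * (mangoldt n * (real n powr (-x) * cos (t * ln (real n))))
       + mangoldt n * (real n powr (-x) * cos (2 * t * ln (real n)))" for n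
  proof -
    have "3 * (mangoldt n * (real n powr (-x) * cos (0 * ln (real n))))
       + 4 * (mangoldt n * (real n powr (-x) * cos (t * ln (real n))))
       + mangoldt n * (real n powr (-x) * cos (2 * t * ln (real n))) =
      mangoldt n * real n powr (-x) * (3 + 4 * cos (t * ln (real n)) + cos (2 * (t * ln (real n))))"
      by (simp add: algebra_simps)
    thus ?thesis using three_four_one[of "t * ln (real n)"] by (simp add: mangoldt_nonneg)
  qed
  show ?thesis by (rule sums_le[OF P sums_zero S])
qed

lemma zeta_reg_1: "zeta_reg 1 = 1"
proof -
  have "zeta_reg_term n 1 = 0" for n
  proof -
    have "of_nat (n + 1) \<noteq> (0 :: complex)" "of_nat (n + 2) \<noteq> (0 :: complex)"
      by (simp_all only: of_nat_eq_0_iff)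
    thus ?thesis by (simp add: zeta_reg_term_def del: of_nat_add)
  qed
  thus ?thesis by (simp add: zeta_reg_def)
qed

text \<open>Minus the logarithmic derivative has residue pole order minus zero order; the pole is
  met only at \<open>t = 0\<close>. The limit is taken horizontally from the region of absolute
  convergence, where positivity is available.\<close>

lemma mangoldt_tendsto_order:
  obtains m :: nat where
    "((\<lambda>x. (x - 1) * Re (dseries mangoldt (Complex x t))) \<longlongrightarrow> (if t = 0 then 1 else 0) - real m) (at_right 1)"
    "zeta_reg (Complex 1 t) = 0 \<Longrightarrow> m > 0"
proof -
  let ?S = "{s::complex. Re s > 0}"
  have "\<exists>w\<in>?S. zeta_reg w \<noteq> 0" using zeta_reg_1 by (intro bexI[of _ 1]) auto
  then obtain m :: nat where m:
    "((\<lambda>s. (s - Complex 1 t) * (deriv zeta_reg s / zeta_reg s)) \<longlongrightarrow> of_nat m) (at (Complex 1 t))"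
    "zeta_reg (Complex 1 t) = 0 \<Longrightarrow> m > 0"
    using log_deriv_tendsto_order[OF holomorphic_zeta_reg open_halfspace_Re_gt
        convex_connected[OF convex_halfspace_Re_gt], of "Complex 1 t"] by auto
  have l: "filterlim (\<lambda>x. Complex x t) (at (Complex 1 t)) (at_right 1)"
  proof (rule filterlim_atI)
    have "((\<lambda>x. of_real x + of_real t * \<i>) \<longlongrightarrow> of_real 1 + of_real t * \<i>) (at_right 1)"
      by (intro tendsto_intros)
    thus "((\<lambda>x. Complex x t) \<longlongrightarrow> Complex 1 t) (at_right 1)" by (simp add: Complex_eq mult.commute)
    show "\<forall>\<^sub>F x in at_right 1. Complex x t \<noteq> Complex 1 t"
      using eventually_at_right_less[of 1] by eventually_elim auto
  qed
  have 1: "((\<lambda>x. Re ((Complex x t - Complex 1 t) * (deriv zeta_reg (Complex x t) / zeta_reg (Complex x t)))) \<longlongrightarrow>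
       Re (of_nat m)) (at_right 1)"
    by (intro tendsto_Re filterlim_compose[OF m(1) l])
  have 2: "((\<lambda>x. Re (of_real (x - 1) / (Complex x t - 1))) \<longlongrightarrow> (if t = 0 then 1 else 0)) (at_right 1)"
  proof (cases "t = 0")
    case True
    have "\<forall>\<^sub>F x in at_right 1. Re (of_real (x - 1) / (Complex x t - 1)) = 1"
      using eventually_at_right_less[of 1]
    proof eventually_elim
      case (elim x)
      have "Complex x t - 1 = of_real (x - 1)" using True by (simp add: complex_eq_iff)
      moreover have "complex_of_real (x - 1) \<noteq> 0" using elim by (simp only: of_real_eq_0_iff)
      ultimately show ?case by simp
    qed
    hence "((\<lambda>x. Re (of_real (x - 1) / (Complex x t - 1))) \<longlongrightarrow> 1) (at_right 1)"
      by (rule tendsto_eventually)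
    thus ?thesis using True by simp
  next
    case False
    have "((\<lambda>x. Re (of_real (x - 1) / ((of_real x + \<i> * of_real t) - 1))) \<longlongrightarrow>
       Re (of_real (1 - 1) / ((of_real 1 + \<i> * of_real t) - 1))) (at_right 1)"
      using False by (intro tendsto_intros) (auto simp: complex_eq_iff)
    thus ?thesis using False by (simp add: Complex_eq)
  qed
  have "((\<lambda>x. Re (of_real (x - 1) / (Complex x t - 1)) -
       Re ((Complex x t - Complex 1 t) * (deriv zeta_reg (Complex x t) / zeta_reg (Complex x t)))) \<longlongrightarrow>
         (if t = 0 then 1 else 0) - Re (of_nat m)) (at_right 1)"
    by (intro tendsto_diff 1 2)
  moreover have "\<forall>\<^sub>F x in at_right 1. Re (of_real (x - 1) / (Complex x t - 1)) -
       Re ((Complex x t - Complex 1 t) * (deriv zeta_reg (Complex x t) / zeta_reg (Complex x t))) =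
       (x - 1) * Re (dseries mangoldt (Complex x t))"
    using eventually_at_right_less[of 1]
  proof eventually_elim
    case (elim x)
    have "Complex x t - Complex 1 t = of_real (x - 1)" by (simp add: complex_eq_iff)
    moreover have "(x - 1) * Re (dseries mangoldt (Complex x t)) =
        Re (of_real (x - 1) * dseries mangoldt (Complex x t))" by (simp del: of_real_diff)
    moreover have "dseries mangoldt (Complex x t) =
        1 / (Complex x t - 1) - deriv zeta_reg (Complex x t) / zeta_reg (Complex x t)"
      using elim by (intro dseries_mangoldt_eq) simp
    ultimately show ?case by (simp add: right_diff_distrib del: of_real_diff)
  qed
  ultimately have "((\<lambda>x. (x - 1) * Re (dseries mangoldt (Complex x t))) \<longlongrightarrow> (if t = 0 then 1 else 0) - Re (of_nat m)) (at_right 1)"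
    by (rule Lim_transform_eventually)
  with m(2) show ?thesis by (intro that[of m]) auto
qed

lemma zeta_reg_nonzero:
  assumes "Re s \<ge> 1"
  shows "zeta_reg s \<noteq> 0"
proof (cases "Re s > 1 \<or> Im s = 0")
  case True
  thus ?thesis using zeta_reg_nonzero_gt_1[of s] zeta_reg_1 assms
    by (metis complex_eqI Im_complex_of_real Re_complex_of_real less_eq_real_def of_real_1 one_neq_zero)
next
  case False
  define t where "t = Im s"
  have t: "t \<noteq> 0" and s: "s = Complex 1 t" using False assms by (auto simp: t_def complex_eq_iff)
  show ?thesis
  proof
    assume "zeta_reg s = 0"
    obtain m0 :: nat where m0: "((\<lambda>x. (x - 1) * Re (dseries mangoldt (Complex x 0))) \<longlongrightarrow> 1 - real m0) (at_right 1)"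
      using mangoldt_tendsto_order[of 0] by auto
    obtain m1 :: nat where m1: "((\<lambda>x. (x - 1) * Re (dseries mangoldt (Complex x t))) \<longlongrightarrow> - real m1) (at_right 1)" "m1 > 0"
      using mangoldt_tendsto_order[of t] t s \<open>zeta_reg s = 0\<close> by auto
    obtain m2 :: nat where m2: "((\<lambda>x. (x - 1) * Re (dseries mangoldt (Complex x (2*t)))) \<longlongrightarrow> - real m2) (at_right 1)"
      using mangoldt_tendsto_order[of "2*t"] t by auto
    \<comment> \<open>The limit of the inequality \<open>mangoldt_341\<close> times
      \<open>x - 1\<close>. With \<open>m1 \<ge> 1\<close> the left side is at most
      \<open>3 - 4\<close>, whatever \<open>m0\<close> and \<open>m2\<close> are.\<close>
    have "3 * (1 - real m0) + 4 * (- real m1) + (- real m2) \<ge> 0"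
    proof (rule tendsto_lowerbound)
      show "((\<lambda>x. 3 * ((x - 1) * Re (dseries mangoldt (Complex x 0))) + 4 * ((x - 1) * Re (dseries mangoldt (Complex x t)))
         + ((x - 1) * Re (dseries mangoldt (Complex x (2*t))))) \<longlongrightarrow> 3 * (1 - real m0) + 4 * (- real m1) + (- real m2)) (at_right 1)"
        by (intro tendsto_intros m0 m1 m2)
      show "\<forall>\<^sub>F x in at_right 1. 0 \<le> 3 * ((x - 1) * Re (dseries mangoldt (Complex x 0))) + 4 * ((x - 1) * Re (dseries mangoldt (Complex x t)))
         + ((x - 1) * Re (dseries mangoldt (Complex x (2*t))))"
        using eventually_at_right_less[of 1]
      proof eventually_elim
        case (elim x)
        have "0 \<le> (x - 1) * (3 * Re (dseries mangoldt (Complex x 0)) + 4 * Re (dseries mangoldt (Complex x t))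
           + Re (dseries mangoldt (Complex x (2 * t))))"
          using mangoldt_341[of x t] elim by simp
        thus ?case by (simp add: algebra_simps)
      qed
    qed auto
    with m1(2) show False by auto
  qed
qed

section \<open>The Fejer kernel\<close>

lemma half_line_FTC_nonneg:
  fixes f F :: "real \<Rightarrow> real"
  assumes "\<And>x. x > c \<Longrightarrow> (F has_real_derivative f x) (at x)" "\<And>x. x > c \<Longrightarrow> isCont f x"
    "\<And>x. x > c \<Longrightarrow> f x \<ge> 0" "(F \<longlongrightarrow> A) (at_right c)" "(F \<longlongrightarrow> B) at_top"
  shows "integrable lborel (\<lambda>t. indicator {c<..} t *\<^sub>R f t)"
    "(LINT t|lborel. indicator {c<..} t *\<^sub>R f t) = B - A"
proof -
  have *: "set_integrable lborel (einterval (ereal c) \<infinity>) f" "(LBINT x=ereal c..\<infinity>. f x) = B - A"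
    by (rule interval_integral_FTC_nonneg[of "ereal c" \<infinity> F f A B];
        use assms in \<open>auto simp: ereal_tendsto_simps\<close>)+
  show "integrable lborel (\<lambda>t. indicator {c<..} t *\<^sub>R f t)"
    using *(1) by (simp add: set_integrable_def einterval_eq)
  show "(LINT t|lborel. indicator {c<..} t *\<^sub>R f t) = B - A"
    using *(2) by (simp add: interval_lebesgue_integral_def set_lebesgue_integral_def einterval_eq)
qed

lemma half_line_FTC_integrable:
  fixes f F :: "real \<Rightarrow> complex"
  assumes "\<And>x. x > c \<Longrightarrow> (F has_vector_derivative f x) (at x)" "\<And>x. x > c \<Longrightarrow> isCont f x"
    "integrable lborel (\<lambda>t. indicator {c<..} t *\<^sub>R f t)" "(F \<longlongrightarrow> A) (at_right c)" "(F \<longlongrightarrow> B) at_top"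
  shows "(LINT t|lborel. indicator {c<..} t *\<^sub>R f t) = B - A"
proof -
  have *: "(LBINT x=ereal c..\<infinity>. f x) = B - A"
    by (rule interval_integral_FTC_integrable[of "ereal c" \<infinity> F f A B];
        use assms in \<open>auto simp: ereal_tendsto_simps set_integrable_def einterval_eq\<close>)+
  show "(LINT t|lborel. indicator {c<..} t *\<^sub>R f t) = B - A"
    using * by (simp add: interval_lebesgue_integral_def set_lebesgue_integral_def einterval_eq)
qed

lemma exp_half_line_real:
  fixes x c :: real
  assumes "x > 0"
  shows "integrable lborel (\<lambda>t. indicator {c<..} t *\<^sub>R exp (- x * t))"
    "(LINT t|lborel. indicator {c<..} t *\<^sub>R exp (- x * t)) = exp (- x * c) / x"
proof -
  have l: "((\<lambda>t. - exp (- x * t) / x) \<longlongrightarrow> 0) at_top" using assms by real_asymp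
  have r: "((\<lambda>t. - exp (- x * t) / x) \<longlongrightarrow> - exp (- x * c) / x) (at_right c)"
    by (intro tendsto_intros) (use assms in auto)
  have d: "((\<lambda>t. - exp (- x * t) / x) has_real_derivative exp (- x * t)) (at t)" for t
    using assms by (auto intro!: derivative_eq_intros)
  note * = half_line_FTC_nonneg[where c = c, OF d _ _ r l]
  show "integrable lborel (\<lambda>t. indicator {c<..} t *\<^sub>R exp (- x * t))" by (rule *(1)) auto
  show "(LINT t|lborel. indicator {c<..} t *\<^sub>R exp (- x * t)) = exp (- x * c) / x"
    by (subst *(2)) auto
qed

lemma exp_half_line_complex:
  fixes w :: complex and c :: real
  assumes "Re w > 0"
  shows "integrable lborel (\<lambda>t. indicator {c<..} t *\<^sub>R exp (- w * of_real t))"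
    "(LINT t|lborel. indicator {c<..} t *\<^sub>R exp (- w * of_real t)) = exp (- w * of_real c) / w"
proof -
  have w: "w \<noteq> 0" using assms by auto
  show i: "integrable lborel (\<lambda>t. indicator {c<..} t *\<^sub>R exp (- w * of_real t))"
    by (rule Bochner_Integration.integrable_bound[OF exp_half_line_real(1)[OF assms, of c]])
       (auto simp: indicator_def norm_exp_eq_Re)
  have l: "((\<lambda>t. - exp (- w * of_real t) / w) \<longlongrightarrow> 0) at_top"
  proof (rule tendsto_norm_zero_cancel)
    have "((\<lambda>t. exp (- Re w * t) / norm w) \<longlongrightarrow> 0) at_top" using assms w by real_asymp
    thus "((\<lambda>t. norm (- exp (- w * of_real t) / w)) \<longlongrightarrow> 0) at_top"
      by (simp add: norm_divide norm_exp_eq_Re)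
  qed
  have r: "((\<lambda>t. - exp (- w * of_real t) / w) \<longlongrightarrow> - exp (- w * of_real c) / w) (at_right c)"
    by (intro tendsto_intros) (use w in auto)
  have "(LINT t|lborel. indicator {c<..} t *\<^sub>R exp (- w * of_real t)) = 0 - (- exp (- w * of_real c) / w)"
  proof (rule half_line_FTC_integrable[OF _ _ i r l])
    fix x :: real
    have "((\<lambda>t. - exp (- w * t) / w) has_field_derivative exp (- w * of_real x)) (at (of_real x))"
      using w by (auto intro!: derivative_eq_intros)
    from has_vector_derivative_real_field[OF this]
    show "((\<lambda>t. - exp (- w * of_real t) / w) has_vector_derivative exp (- w * of_real x)) (at x)" .
    show "isCont (\<lambda>t. exp (- w * of_real t)) x" by (intro continuous_intros)
  qed
  thus "(LINT t|lborel. indicator {c<..} t *\<^sub>R exp (- w * of_real t)) = exp (- w * of_real c) / w" by simp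
qed

text \<open>A majorant with an explicit integral for the tail of the Fejer kernel, which is at most
  \<open>4 / v\<^sup>2\<close>.\<close>

definition tail_square :: "real \<Rightarrow> real \<Rightarrow> real" where
  "tail_square h v = (if \<bar>v\<bar> > h then 1 / v\<^sup>2 else 0)"

lemma tail_square_integral:
  assumes "h > 0"
  shows "integrable lborel (tail_square h)" "(LINT v|lborel. tail_square h v) = 2 / h"
proof -
  have l: "((\<lambda>t::real. - 1 / t) \<longlongrightarrow> 0) at_top" by real_asymp
  have r: "((\<lambda>t::real. - 1 / t) \<longlongrightarrow> - 1 / h) (at_right h)"
    by (intro tendsto_intros) (use assms in auto)
  have d: "((\<lambda>t. - 1 / t) has_real_derivative 1 / t\<^sup>2) (at t)" if "t > h" for t
    using assms that by (auto intro!: derivative_eq_intros simp: power2_eq_square)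
  note * = half_line_FTC_nonneg[where c = h, OF d _ _ r l]
  have i1: "integrable lborel (\<lambda>t. indicator {h<..} t *\<^sub>R (1 / t\<^sup>2))"
    by (rule *(1)) (use assms in \<open>auto intro!: continuous_intros\<close>)
  have e1: "(LINT t|lborel. indicator {h<..} t *\<^sub>R (1 / t\<^sup>2)) = 1 / h"
    by (subst *(2)) (use assms in \<open>auto intro!: continuous_intros\<close>)
  have i2: "integrable lborel (\<lambda>t. indicator {h<..} (0 + (-1) * t) *\<^sub>R (1 / (0 + (-1) * t)\<^sup>2))"
    by (rule lborel_integrable_real_affine[OF i1]) auto
  have e2: "(LINT t|lborel. indicator {h<..} (0 + (-1) * t) *\<^sub>R (1 / (0 + (-1) * t)\<^sup>2)) = 1 / h"
    using lborel_integral_real_affine[of "-1" "\<lambda>t. indicator {h<..} t *\<^sub>R (1 / t\<^sup>2)" 0] e1 by simp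
  have eq: "tail_square h = (\<lambda>t. indicator {h<..} t *\<^sub>R (1 / t\<^sup>2) +
     indicator {h<..} (0 + (-1) * t) *\<^sub>R (1 / (0 + (-1) * t)\<^sup>2))"
    using assms by (auto simp: tail_square_def indicator_def fun_eq_iff)
  show "integrable lborel (tail_square h)" unfolding eq by (intro Bochner_Integration.integrable_add i1 i2)
  show "(LINT v|lborel. tail_square h v) = 2 / h"
    unfolding eq Bochner_Integration.integral_add[OF i1 i2] e1 e2 by simp
qed

section \<open>The kernel, its Fourier transform and its mass\<close>

text \<open>Away from 0 this is \<open>(2 * sin (L * v / 2) / v)\<^sup>2\<close>; the value at 0 is
  the limit.\<close>

definition fejer :: "real \<Rightarrow> real \<Rightarrow> real" where
  "fejer L v = (if v = 0 then L\<^sup>2 else 2 * (1 - cos (L * v)) / v\<^sup>2)"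

lemma fejer_measurable [measurable]: "fejer L \<in> borel_measurable borel"
  unfolding fejer_def[abs_def] by measurable

lemma fejer_nonneg: "fejer L v \<ge> 0"
  by (simp add: fejer_def)

lemma fejer_le_tail:
  assumes "\<bar>v\<bar> > h" "h > 0"
  shows "fejer L v \<le> 4 * tail_square h v"
proof -
  have "2 * (1 - cos (L * v)) / v\<^sup>2 \<le> 4 / v\<^sup>2"
  proof (rule divide_right_mono)
    show "2 * (1 - cos (L * v)) \<le> 4" using cos_ge_minus_one[of "L * v"] by argo
  qed auto
  thus ?thesis using assms by (auto simp: fejer_def tail_square_def)
qed

text \<open>The Fourier transform of the Fejer kernel up to normalisation. Its compact support
  confines the Tauberian argument to a bounded segment of the boundary line.\<close>

definition tri :: "real \<Rightarrow> real \<Rightarrow> real" where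
  "tri L u = max 0 (L - \<bar>u\<bar>)"

lemma tri_nonneg: "tri L u \<ge> 0"
  by (simp add: tri_def)

lemma tri_continuous [continuous_intros]: "continuous_on A (tri L)"
  unfolding tri_def[abs_def] by (intro continuous_intros)

lemma tri_measurable [measurable]: "tri L \<in> borel_measurable borel"
  by (intro borel_measurable_continuous_onI tri_continuous)

lemma tri_fourier_piece:
  fixes v :: real and L :: real
  assumes "L > 0" and v: "v \<noteq> 0"
  shows "((\<lambda>u. of_real (L - u) * cis (u * v)) has_integral
      (cis (L * v) - 1) / (\<i> * v)^2 - L / (\<i> * v)) {0..L}"
    and "((\<lambda>u. of_real (L + u) * cis (u * v)) has_integral
      (cis (- (L * v)) - 1) / (\<i> * v)^2 + L / (\<i> * v)) {-L..0}"
proof -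
  have nz: "\<i> * of_real v \<noteq> 0" using v by simp
  have ci: "cis (u * v) = exp (\<i> * of_real v * of_real u)" for u
    by (simp add: cis_conv_exp algebra_simps)
  have "((\<lambda>u. of_real (L - u) * cis (u * v)) has_integral
      ((of_real L - of_real L) * exp (\<i> * v * of_real L) / (\<i> * v) + exp (\<i> * v * of_real L) / (\<i> * v)^2)
      - ((of_real L - of_real 0) * exp (\<i> * v * of_real 0) / (\<i> * v) + exp (\<i> * v * of_real 0) / (\<i> * v)^2)) {0..L}"
  proof (rule fundamental_theorem_of_calculus)
    fix x assume "x \<in> {0..L}"
    have "((\<lambda>u. (of_real L - u) * exp (\<i> * v * u) / (\<i> * v) + exp (\<i> * v * u) / (\<i> * v)^2)
       has_field_derivative of_real (L - x) * cis (x * v)) (at (of_real x))"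
      unfolding ci using nz v
      by (auto intro!: derivative_eq_intros simp: divide_simps power2_eq_square) (simp add: algebra_simps)?
    from has_vector_derivative_real_field[OF this]
    show "((\<lambda>u. (of_real L - of_real u) * exp (\<i> * v * of_real u) / (\<i> * v) + exp (\<i> * v * of_real u) / (\<i> * v)^2)
       has_vector_derivative of_real (L - x) * cis (x * v)) (at x within {0..L})"
      by (rule has_vector_derivative_at_within)
  qed (use assms in auto)
  thus "((\<lambda>u. of_real (L - u) * cis (u * v)) has_integral
      (cis (L * v) - 1) / (\<i> * v)^2 - L / (\<i> * v)) {0..L}"
    by (rule has_integral_eq_rhs) (simp add: ci diff_divide_distrib)
  have "((\<lambda>u. of_real (L + u) * cis (u * v)) has_integral
      ((of_real L + of_real 0) * exp (\<i> * v * of_real 0) / (\<i> * v) - exp (\<i> * v * of_real 0) / (\<i> * v)^2)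
      - ((of_real L + of_real (-L)) * exp (\<i> * v * of_real (-L)) / (\<i> * v) - exp (\<i> * v * of_real (-L)) / (\<i> * v)^2)) {-L..0}"
  proof (rule fundamental_theorem_of_calculus)
    fix x assume "x \<in> {-L..0}"
    have "((\<lambda>u. (of_real L + u) * exp (\<i> * v * u) / (\<i> * v) - exp (\<i> * v * u) / (\<i> * v)^2)
       has_field_derivative of_real (L + x) * cis (x * v)) (at (of_real x))"
      unfolding ci using nz v
      by (auto intro!: derivative_eq_intros simp: divide_simps power2_eq_square) (simp add: algebra_simps)?
    from has_vector_derivative_real_field[OF this]
    show "((\<lambda>u. (of_real L + of_real u) * exp (\<i> * v * of_real u) / (\<i> * v) - exp (\<i> * v * of_real u) / (\<i> * v)^2)
       has_vector_derivative of_real (L + x) * cis (x * v)) (at x within {-L..0})"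
      by (rule has_vector_derivative_at_within)
  qed (use assms in auto)
  thus "((\<lambda>u. of_real (L + u) * cis (u * v)) has_integral
      (cis (- (L * v)) - 1) / (\<i> * v)^2 + L / (\<i> * v)) {-L..0}"
    by (rule has_integral_eq_rhs) (simp add: cis_conv_exp diff_divide_distrib mult_ac)
qed

lemma tri_fourier:
  assumes "L > 0"
  shows "integrable lborel (\<lambda>u. of_real (tri L u) * cis (u * v))"
    "(LINT u|lborel. of_real (tri L u) * cis (u * v)) = of_real (fejer L v)"
proof -
  let ?f = "\<lambda>u. of_real (tri L u) * cis (u * v)"
  have cont: "continuous_on {-L..L} ?f"
    by (intro continuous_intros continuous_on_cis)
  have si: "set_integrable lborel {-L..L} ?f"
    by (rule borel_integrable_atLeastAtMost') (rule cont)
  have eq: "(\<lambda>u. indicator {-L..L} u *\<^sub>R ?f u) = ?f"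
    by (auto simp: indicator_def tri_def fun_eq_iff)
  show i: "integrable lborel ?f" using si by (simp add: set_integrable_def eq)
  have "(?f has_integral of_real (fejer L v)) {-L..L}"
  proof (cases "v = 0")
    case False
    have 1: "(?f has_integral ((cis (- (L * v)) - 1) / (\<i> * v)^2 + L / (\<i> * v))) {-L..0}"
      by (rule has_integral_eq[OF _ tri_fourier_piece(2)[OF assms False]]) (auto simp: tri_def)
    have 2: "(?f has_integral ((cis (L * v) - 1) / (\<i> * v)^2 - L / (\<i> * v))) {0..L}"
      by (rule has_integral_eq[OF _ tri_fourier_piece(1)[OF assms False]]) (auto simp: tri_def)
    have "(?f has_integral (((cis (- (L * v)) - 1) / (\<i> * v)^2 + L / (\<i> * v)) +
       ((cis (L * v) - 1) / (\<i> * v)^2 - L / (\<i> * v)))) {-L..L}"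
      by (rule has_integral_combine[OF _ _ 1 2]) (use assms in auto)
    moreover have "((cis (- (L * v)) - 1) / (\<i> * v)^2 + L / (\<i> * v)) +
       ((cis (L * v) - 1) / (\<i> * v)^2 - L / (\<i> * v)) = of_real (fejer L v)"
    proof -
      have "cis (- (L * v)) + cis (L * v) = of_real (2 * cos (L * v))"
        by (simp add: complex_eq_iff)
      moreover have "((cis (- (L * v)) - 1) / (\<i> * v)^2 + L / (\<i> * v)) +
         ((cis (L * v) - 1) / (\<i> * v)^2 - L / (\<i> * v)) = ((cis (- (L * v)) + cis (L * v)) - 2) / (\<i> * v)^2"
        by (simp add: add_divide_distrib diff_divide_distrib)
      ultimately show ?thesis using False by (simp add: fejer_def power_mult_distrib diff_divide_distrib)
    qed
    ultimately show ?thesis by simp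
  next
    case True
    have 1: "((\<lambda>u. complex_of_real (L + u)) has_integral
        of_real (L * 0 + 0\<^sup>2 / 2) - of_real (L * (-L) + (-L)\<^sup>2 / 2)) {-L..0}"
    proof (rule fundamental_theorem_of_calculus)
      fix x :: real
      have "((\<lambda>u. L * u + u\<^sup>2 / 2) has_real_derivative L + x) (at x within {-L..0})"
        by (auto intro!: derivative_eq_intros)
      thus "((\<lambda>u. complex_of_real (L * u + u\<^sup>2 / 2)) has_vector_derivative of_real (L + x)) (at x within {-L..0})"
        by (intro has_vector_derivative_of_real) (simp add: has_real_derivative_iff_has_vector_derivative)
    qed (use assms in auto)
    have 2: "((\<lambda>u. complex_of_real (L - u)) has_integral
        of_real (L * L - L\<^sup>2 / 2) - of_real (L * 0 - 0\<^sup>2 / 2)) {0..L}"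
    proof (rule fundamental_theorem_of_calculus)
      fix x :: real
      have "((\<lambda>u. L * u - u\<^sup>2 / 2) has_real_derivative L - x) (at x within {0..L})"
        by (auto intro!: derivative_eq_intros)
      thus "((\<lambda>u. complex_of_real (L * u - u\<^sup>2 / 2)) has_vector_derivative of_real (L - x)) (at x within {0..L})"
        by (intro has_vector_derivative_of_real) (simp add: has_real_derivative_iff_has_vector_derivative)
    qed (use assms in auto)
    have "(?f has_integral ((of_real (L * 0 + 0\<^sup>2 / 2) - of_real (L * (-L) + (-L)\<^sup>2 / 2)) +
        (of_real (L * L - L\<^sup>2 / 2) - of_real (L * 0 - 0\<^sup>2 / 2)))) {-L..L}"
      by (rule has_integral_combine[OF _ _ has_integral_eq[OF _ 1] has_integral_eq[OF _ 2]])
         (use assms True in \<open>auto simp: tri_def\<close>)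
    moreover have "(of_real (L * 0 + 0\<^sup>2 / 2) - of_real (L * (-L) + (-L)\<^sup>2 / 2)) +
        (of_real (L * L - L\<^sup>2 / 2) - of_real (L * 0 - 0\<^sup>2 / 2)) = complex_of_real (fejer L v)"
      unfolding of_real_diff[symmetric] of_real_add[symmetric] of_real_eq_iff
      using True by (simp add: fejer_def power2_eq_square)
    ultimately show ?thesis by simp
  qed
  hence "integral {-L..L} ?f = of_real (fejer L v)" by (rule integral_unique)
  moreover have "(LINT u|lborel. ?f u) = integral {-L..L} ?f"
    using set_borel_integral_eq_integral(2)[OF si] by (simp add: set_lebesgue_integral_def eq)
  ultimately show "(LINT u|lborel. ?f u) = of_real (fejer L v)" by simp
qed

lemma tri_integrable: "L > 0 \<Longrightarrow> integrable lborel (tri L)"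
  using tri_fourier(1)[of L 0] by (simp add: complex_of_real_integrable_eq)

text \<open>A Fourier transform is bounded by the L1 norm, and for the nonnegative triangle that
  norm is the transform at 0.\<close>

lemma fejer_le: 
  assumes "L > 0"
  shows "fejer L v \<le> L\<^sup>2"
proof -
  have "norm (LINT u|lborel. of_real (tri L u) * cis (u * v)) \<le> (LINT u|lborel. norm (of_real (tri L u) * cis (u * v)))"
    by (rule integral_norm_bound)
  also have "\<dots> = (LINT u|lborel. tri L u)"
    by (simp add: norm_mult tri_def)
  also have "complex_of_real \<dots> = of_real (fejer L 0)"
    using tri_fourier(2)[OF assms, of 0] by simp
  hence "(LINT u|lborel. tri L u) = L\<^sup>2"
    by (simp add: fejer_def) (metis of_real_eq_iff of_real_power)
  finally show ?thesis
    unfolding tri_fourier(2)[OF assms] using fejer_nonneg[of L v] by simp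
qed

lemma fejer_integrable:
  assumes "L > 0"
  shows "integrable lborel (fejer L)"
proof (rule Bochner_Integration.integrable_bound)
  show "integrable lborel (\<lambda>v. L\<^sup>2 * indicator {-1..1} v + 4 * tail_square 1 v)"
    by (intro Bochner_Integration.integrable_add integrable_mult_right tail_square_integral)
       (auto intro!: integrable_real_indicator)
  show "AE v in lborel. norm (fejer L v) \<le> norm (L\<^sup>2 * indicator {-1..1} v + 4 * tail_square 1 v)"
  proof (intro AE_I2)
    fix v :: real
    have "fejer L v \<le> L\<^sup>2 * indicator {-1..1} v + 4 * tail_square 1 v"
      using fejer_le[OF assms, of v] fejer_le_tail[of 1 v L]
      by (cases "\<bar>v\<bar> > 1") (auto simp: indicator_def tail_square_def)
    thus "norm (fejer L v) \<le> norm (L\<^sup>2 * indicator {-1..1} v + 4 * tail_square 1 v)"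
      using fejer_nonneg[of L v] by simp
  qed
qed auto

text \<open>Its value for \<open>L > 0\<close> is \<open>2 * pi * L\<close>, but positivity and
  linearity in \<open>L\<close> are enough, so it is kept as a symbol.\<close>

definition fejer_mass :: "real \<Rightarrow> real" where
  "fejer_mass L = (LINT v|lborel. fejer L v)"

lemma fejer_mass_scale: "L > 0 \<Longrightarrow> fejer_mass L = L * fejer_mass 1"
proof -
  assume L: "L > 0"
  have "fejer L v = L\<^sup>2 * fejer 1 (0 + L * v)" for v
    using L by (auto simp: fejer_def power_mult_distrib)
  hence "fejer_mass L = L\<^sup>2 * (LINT v|lborel. fejer 1 (0 + L * v))"
    by (simp add: fejer_mass_def)
  also have "(LINT v|lborel. fejer 1 (0 + L * v)) = fejer_mass 1 / L"
    using lborel_integral_real_affine[of L "fejer 1" 0] L by (simp add: fejer_mass_def field_simps)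
  finally show ?thesis using L by (simp add: power2_eq_square)
qed

lemma fejer_mass_pos:
  assumes "L > 0"
  shows "fejer_mass L > 0"
proof -
  have "1 - cos (x) \<ge> 0" for x :: real by simp
  have "fejer_mass L \<noteq> 0"
  proof
    assume "fejer_mass L = 0"
    hence "AE v in lborel. fejer L v = 0"
      unfolding fejer_mass_def using fejer_integrable[OF assms] fejer_nonneg
      by (subst (asm) integral_nonneg_eq_0_iff_AE) auto
    moreover have "fejer L v \<noteq> 0" if v: "v \<in> {0<..<1 / L}" for v
    proof -
      have "0 < L * v" "L * v < 1" using v assms by (auto simp: field_simps)
      hence "cos (L * v) < cos 0" using pi_gt3 by (intro cos_monotone_0_pi) auto
      thus ?thesis using v by (simp add: fejer_def)
    qed
    ultimately have "AE v in lborel. v \<notin> {0<..<1 / L}" by (auto elim!: eventually_mono)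
    hence "emeasure lborel {0<..<1 / L} = 0"
      by (subst (asm) AE_iff_measurable[of "{0<..<1 / L}"]) auto
    thus False using assms by simp
  qed
  moreover have "fejer_mass L \<ge> 0"
    unfolding fejer_mass_def using fejer_nonneg by (intro Bochner_Integration.integral_nonneg) auto
  ultimately show ?thesis by linarith
qed

lemma fejer_central_mass:
  assumes "L > 0" "h > 0"
  shows "(LINT v|lborel. indicator {-h..h} v * fejer L v) \<ge> fejer_mass L - 8 / h"
    "(LINT v|lborel. indicator {-h..h} v * fejer L v) \<le> fejer_mass L"
proof -
  have i: "integrable lborel (\<lambda>v. indicator {-h..h} v * fejer L v)"
    using integrable_mult_indicator[OF _ fejer_integrable[OF assms(1)], of "{-h..h}"] by simp
  have "fejer_mass L \<le> (LINT v|lborel. indicator {-h..h} v * fejer L v + 4 * tail_square h v)"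
    unfolding fejer_mass_def
  proof (rule integral_mono)
    show "fejer L v \<le> indicator {-h..h} v * fejer L v + 4 * tail_square h v" for v
      using fejer_le_tail[of h v L] assms by (cases "\<bar>v\<bar> > h") (auto simp: indicator_def tail_square_def)
  qed (intro fejer_integrable Bochner_Integration.integrable_add i integrable_mult_right
        tail_square_integral assms)+
  also have "\<dots> = (LINT v|lborel. indicator {-h..h} v * fejer L v) + 8 / h"
    using i tail_square_integral[OF assms(2)] by simp
  finally show "(LINT v|lborel. indicator {-h..h} v * fejer L v) \<ge> fejer_mass L - 8 / h" by simp
  show "(LINT v|lborel. indicator {-h..h} v * fejer L v) \<le> fejer_mass L"
    unfolding fejer_mass_def
    by (rule integral_mono[OF i fejer_integrable[OF assms(1)]]) (auto simp: indicator_def fejer_nonneg)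
qed

text \<open>Write the kernel as the transform of \<open>tri\<close> and exchange the integrals:
  smoothing by the kernel sees the Fourier transform of \<open>G\<close> only on
  \<open>[-L, L]\<close>.\<close>

lemma fejer_convolution:
  fixes G :: "real \<Rightarrow> complex"
  assumes G: "integrable lborel G" and L: "L > 0"
  shows "(LINT t|lborel. G t * of_real (fejer L (x - t))) =
    (LINT u|lborel. of_real (tri L u) * cis (u * x) * (LINT t|lborel. G t * cis (- (u * t))))"
proof -
  have [measurable]: "G \<in> borel_measurable borel" using G by auto
  let ?f = "\<lambda>t u. G t * (of_real (tri L u) * cis (u * (x - t)))"
  have ciscont: "continuous_on UNIV (\<lambda>p::real\<times>real. cis (snd p * (x - fst p)))"
    by (intro continuous_intros continuous_on_cis)
  have [measurable]: "(\<lambda>(t, u). cis (u * (x - t))) \<in> borel_measurable (lborel \<Otimes>\<^sub>M lborel)"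
    using borel_measurable_continuous_onI[OF ciscont] by (simp add: lborel_prod case_prod_unfold)
  have int: "integrable (lborel \<Otimes>\<^sub>M lborel) (case_prod ?f)"
  proof (rule lborel_pair.Fubini_integrable)
    have "(\<lambda>(t, u). G t * of_real (tri L u) * (case (t, u) of (t, u) \<Rightarrow> cis (u * (x - t)))) \<in> borel_measurable (lborel \<Otimes>\<^sub>M lborel)"
      by measurable
    thus "case_prod ?f \<in> borel_measurable (lborel \<Otimes>\<^sub>M lborel)" by (simp add: mult.assoc case_prod_unfold)
    have "(\<lambda>t. LINT u|lborel. norm (case (t, u) of (t, u) \<Rightarrow> ?f t u)) = (\<lambda>t. norm (G t) * (LINT u|lborel. tri L u))"
      by (simp add: norm_mult tri_def)
    thus "integrable lborel (\<lambda>t. LINT u|lborel. norm (case (t, u) of (t, u) \<Rightarrow> ?f t u))"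
      using G by simp
    show "AE t in lborel. integrable lborel (\<lambda>u. case (t, u) of (t, u) \<Rightarrow> ?f t u)"
      using tri_fourier(1)[OF L] by (intro AE_I2) (simp add: integrable_mult_right)
  qed
  have "(LINT t|lborel. G t * of_real (fejer L (x - t))) = (LINT t|lborel. (LINT u|lborel. ?f t u))"
    using tri_fourier[OF L] by simp
  also have "\<dots> = (LINT u|lborel. (LINT t|lborel. ?f t u))"
    using lborel_pair.Fubini_integral[OF int] by simp
  also have "\<dots> = (LINT u|lborel. of_real (tri L u) * cis (u * x) * (LINT t|lborel. G t * cis (- (u * t))))"
  proof (rule Bochner_Integration.integral_cong[OF refl])
    fix u :: real
    have "?f t u = of_real (tri L u) * cis (u * x) * (G t * cis (- (u * t)))" for t
      by (simp add: cis_mult right_diff_distrib mult_ac flip: cis_mult) (simp add: cis_mult)?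
    hence "(LINT t|lborel. ?f t u) = (LINT t|lborel. of_real (tri L u) * cis (u * x) * (G t * cis (- (u * t))))"
      by (rule Bochner_Integration.integral_cong[OF refl])
    also have "\<dots> = of_real (tri L u) * cis (u * x) * (LINT t|lborel. G t * cis (- (u * t)))"
      by (rule integral_mult_right_zero)
    finally show "(LINT t|lborel. ?f t u) = of_real (tri L u) * cis (u * x) * (LINT t|lborel. G t * cis (- (u * t)))" .
  qed
  finally show ?thesis .
qed

text \<open>Translation by half a period \<open>pi / x\<close> reverses the sign of
  \<open>cis (u * x)\<close>. Averaging the integral with its translate leaves differences of
  \<open>p\<close> at distance \<open>pi / x\<close>, which tend to 0 by continuity and dominated
  convergence.\<close>

lemma riemann_lebesgue_compact_support:
  fixes p :: "real \<Rightarrow> complex"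
  assumes cont: "continuous_on UNIV p" and supp: "\<And>u. \<bar>u\<bar> > L \<Longrightarrow> p u = 0" and L: "L > 0"
  shows "((\<lambda>x. LINT u|lborel. p u * cis (u * x)) \<longlongrightarrow> 0) at_top"
proof -
  have [measurable]: "p \<in> borel_measurable borel" using cont by (rule borel_measurable_continuous_onI)
  have "compact (p ` {-L..L})"
    by (intro compact_continuous_image continuous_on_subset[OF cont]) auto
  then obtain M where M: "\<And>u. u \<in> {-L..L} \<Longrightarrow> norm (p u) \<le> M"
    by (meson bounded_iff compact_imp_bounded image_eqI)
  have M0: "M \<ge> 0" using order.trans[OF norm_ge_zero M[of 0]] L by simp
  have Mall: "norm (p u) \<le> M" for u using M[of u] supp[of u] M0 by (cases "\<bar>u\<bar> > L") (auto simp: abs_le_iff not_less minus_le_iff)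
  have cism: "(\<lambda>u. cis (u * x)) \<in> borel_measurable borel" for x
    by (intro borel_measurable_continuous_onI continuous_on_cis continuous_intros)
  note [measurable] = cism
  have ip: "integrable lborel (\<lambda>u. p u * cis (u * x))" for x
  proof (rule Bochner_Integration.integrable_bound)
    show "integrable lborel (\<lambda>u. M * indicator {-L..L} u)"
      using L by (intro integrable_mult_right integrable_real_indicator) auto
    show "AE u in lborel. norm (p u * cis (u * x)) \<le> norm (M * indicator {-L..L} u)"
      using Mall supp M0 by (intro AE_I2) (auto simp: norm_mult indicator_def)
  qed auto
  have shift: "(LINT u|lborel. p u * cis (u * x)) = - (LINT u|lborel. p (pi / x + 1 * u) * cis (u * x))" if "x > 0" for x
  proof -
    have "(LINT u|lborel. p u * cis (u * x)) = (LINT u|lborel. p (pi / x + 1 * u) * cis ((pi / x + 1 * u) * x))"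
      using lborel_integral_real_affine[of 1 "\<lambda>u. p u * cis (u * x)" "pi / x"] by simp
    also have "(\<lambda>u. p (pi / x + 1 * u) * cis ((pi / x + 1 * u) * x)) = (\<lambda>u. - (p (pi / x + 1 * u) * cis (u * x)))"
    proof
      fix u
      have "(pi / x + 1 * u) * x = pi + u * x" using that by (simp add: field_simps)
      thus "p (pi / x + 1 * u) * cis ((pi / x + 1 * u) * x) = - (p (pi / x + 1 * u) * cis (u * x))"
        by (simp flip: cis_mult)
    qed
    finally show ?thesis by simp
  qed
  have lim: "((\<lambda>x. LINT u|lborel. norm (p u - p (pi / x + 1 * u))) \<longlongrightarrow> (LINT u|lborel. norm (p u - p u))) at_top"
  proof (rule integral_dominated_convergence_at_top[where w = "\<lambda>u. 2 * M * indicator {- L - 1..L + 1} u"])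
    show "AE u in lborel. ((\<lambda>x. norm (p u - p (pi / x + 1 * u))) \<longlongrightarrow> norm (p u - p u)) at_top"
    proof (intro AE_I2 tendsto_intros)
      fix u
      have "((\<lambda>x. pi / x + 1 * u) \<longlongrightarrow> u) at_top" by real_asymp
      moreover have "isCont p u" using cont by (simp add: continuous_on_eq_continuous_at)
      ultimately show "((\<lambda>x. p (pi / x + 1 * u)) \<longlongrightarrow> p u) at_top"
        by (rule isCont_tendsto_compose[rotated])
    qed
    show "\<forall>\<^sub>F x in at_top. AE u in lborel. norm (norm (p u - p (pi / x + 1 * u))) \<le> 2 * M * indicator {- L - 1..L + 1} u"
      using eventually_ge_at_top[of pi]
    proof eventually_elim
      case (elim x)
      show ?case
      proof (intro AE_I2)
        fix u
        have x: "0 \<le> pi / x" "pi / x \<le> 1" using elim less_le_trans[OF pi_gt_zero elim] by (auto simp: field_simps)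
        show "norm (norm (p u - p (pi / x + 1 * u))) \<le> 2 * M * indicator {- L - 1..L + 1} u"
        proof (cases "u \<in> {- L - 1..L + 1}")
          case True
          thus ?thesis using norm_triangle_ineq4[of "p u" "p (pi / x + 1 * u)"] Mall[of u] Mall[of "pi / x + 1 * u"]
            by (simp add: indicator_def)
        next
          case False
          hence "\<bar>u\<bar> > L" "\<bar>pi / x + 1 * u\<bar> > L" using x by auto
          thus ?thesis using supp False by simp
        qed
      qed
    qed
  qed (use L in \<open>auto intro!: integrable_mult_right integrable_real_indicator\<close>)
  show ?thesis
  proof (rule Lim_null_comparison[where g = "\<lambda>x. (LINT u|lborel. norm (p u - p (pi / x + 1 * u))) / 2"])
    show "((\<lambda>x. (LINT u|lborel. norm (p u - p (pi / x + 1 * u))) / 2) \<longlongrightarrow> 0) at_top"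
      using tendsto_divide[OF lim tendsto_const[of 2]] by simp
    show "\<forall>\<^sub>F x in at_top. norm (LINT u|lborel. p u * cis (u * x)) \<le> (LINT u|lborel. norm (p u - p (pi / x + 1 * u))) / 2"
      using eventually_gt_at_top[of 0]
    proof eventually_elim
      case (elim x)
      have ip': "integrable lborel (\<lambda>u. p (pi / x + 1 * u) * cis (u * x))"
      proof -
        have "integrable lborel (\<lambda>u. p (pi / x + 1 * u) * cis ((pi / x + 1 * u) * 0))"
          using lborel_integrable_real_affine[OF ip[of 0], of 1 "pi / x"] by simp
        thus ?thesis
          by (rule Bochner_Integration.integrable_bound) (auto simp: norm_mult)
      qed
      have "2 * (LINT u|lborel. p u * cis (u * x)) =
         (LINT u|lborel. p u * cis (u * x)) - (LINT u|lborel. p (pi / x + 1 * u) * cis (u * x))"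
        using shift[OF elim] by simp
      also have "\<dots> = (LINT u|lborel. p u * cis (u * x) - p (pi / x + 1 * u) * cis (u * x))"
        by (rule Bochner_Integration.integral_diff[OF ip ip', symmetric])
      also have "norm \<dots> \<le> (LINT u|lborel. norm (p u * cis (u * x) - p (pi / x + 1 * u) * cis (u * x)))"
        by (rule integral_norm_bound)
      also have "\<dots> = (LINT u|lborel. norm (p u - p (pi / x + 1 * u)))"
      proof (rule Bochner_Integration.integral_cong[OF refl])
        fix u
        have "p u * cis (u * x) - p (pi / x + 1 * u) * cis (u * x) = (p u - p (pi / x + 1 * u)) * cis (u * x)"
          by (rule left_diff_distrib[symmetric])
        thus "norm (p u * cis (u * x) - p (pi / x + 1 * u) * cis (u * x)) = norm (p u - p (pi / x + 1 * u))"
          by (simp only: norm_mult norm_cis mult_1_right)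
      qed
      finally have "2 * norm (LINT u|lborel. p u * cis (u * x)) \<le> (LINT u|lborel. norm (p u - p (pi / x + 1 * u)))"
        by (simp only: norm_mult norm_numeral)
      thus ?case by linarith
    qed
  qed
qed

section \<open>A Wiener-Ikehara theorem\<close>

text \<open>The function \<open>h\<close> extends the Laplace transform of \<open>psi t / exp t - 1\<close> continuously to the
  closed right half plane.\<close>

locale tauberian =
  fixes a :: "nat \<Rightarrow> real" and h :: "complex \<Rightarrow> complex"
  assumes nonneg: "\<And>n. a n \<ge> 0"
    and summ: "\<And>c. c > 1 \<Longrightarrow> summable (\<lambda>n. a n * real n powr (-c))"
    and h_cont: "continuous_on {z. Re z \<ge> 0} h"
    and h_eq: "\<And>z. Re z > 0 \<Longrightarrow>
      (\<lambda>n. of_real (a n) * of_nat n powr (- (1 + z))) sums ((1 + z) * (h z + 1 / z))"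
begin

text \<open>The summatory function in the logarithmic variable. The strict inequality matches the
  open half-lines of \<open>exp_half_line_complex\<close>.\<close>

definition psi :: "real \<Rightarrow> real" where
  "psi t = (\<Sum>n | n \<ge> 1 \<and> ln (real n) < t. a n)"

lemma finite_psi: "finite {n. n \<ge> 1 \<and> ln (real n) < t}"
proof (rule finite_subset)
  show "{n. n \<ge> 1 \<and> ln (real n) < t} \<subseteq> {..nat \<lceil>exp t\<rceil>}"
  proof
    fix n assume "n \<in> {n. n \<ge> 1 \<and> ln (real n) < t}"
    hence "real n < exp t" by (metis One_nat_def Suc_le_eq exp_less_cancel_iff exp_ln mem_Collect_eq of_nat_0_less_iff)
    thus "n \<in> {..nat \<lceil>exp t\<rceil>}" by (simp add: nat_le_iff) linarith
  qed
qed auto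

lemma psi_nonneg: "psi t \<ge> 0"
  unfolding psi_def by (intro sum_nonneg nonneg)

lemma psi_mono: "s \<le> t \<Longrightarrow> psi s \<le> psi t"
  unfolding psi_def by (intro sum_mono2 finite_psi nonneg) auto

lemma psi_nonpos: "t \<le> 0 \<Longrightarrow> psi t = 0"
proof -
  assume "t \<le> 0"
  have "{n. n \<ge> 1 \<and> ln (real n) < t} = {}"
  proof -
    have "\<not> ln (real n) < t" if "n \<ge> 1" for n
    proof -
      have "ln (real n) \<ge> 0" using that by (intro ln_ge_zero) simp
      thus ?thesis using \<open>t \<le> 0\<close> by linarith
    qed
    thus ?thesis by auto
  qed
  thus ?thesis by (simp only: psi_def) simp
qed

lemma psi_measurable [measurable]: "psi \<in> borel_measurable borel"
  by (intro borel_measurable_mono monoI psi_mono)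

text \<open>Each \<open>a n\<close> is a jump at \<open>ln n\<close> whose Laplace transform is
  \<open>n powr (- (1 + z)) / (1 + z)\<close>; absolute convergence allows summation and integration
  to be exchanged.\<close>

lemma psi_laplace:
  assumes z: "Re z > 0"
  shows "integrable lborel (\<lambda>t. of_real (psi t) * exp (- (1 + z) * of_real t))"
    "(LINT t|lborel. of_real (psi t) * exp (- (1 + z) * of_real t)) = h z + 1 / z"
proof -
  define g where "g = (\<lambda>n t. if n = 0 then 0 else
     of_real (a n) * (indicator {ln (real n)<..} t *\<^sub>R exp (- (1 + z) * complex_of_real t)))"
  have w: "Re (1 + z) > 0" using z by simp
  have w0: "1 + z \<noteq> 0" using w by fastforce
  have ig: "integrable lborel (g n)" for n
  proof (cases "n = 0")
    case False
    show ?thesis unfolding g_def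
      by (simp only: False if_False) (intro integrable_mult_right exp_half_line_complex(1)[OF w])
  qed (simp add: g_def)
  have fin: "finite {n. g n t \<noteq> 0}" for t
    by (rule finite_subset[OF _ finite_psi[of t]]) (auto simp: g_def indicator_def split: if_splits)
  have powr_eq: "exp (- w * of_real (ln (real n))) = of_nat n powr (- w)" if "n > 0" for n and w :: complex
    using that by (simp add: powr_def Ln_of_nat)
  have eg: "integral\<^sup>L lborel (g n) = of_real (a n) * of_nat n powr (- (1 + z)) / (1 + z)" for n
  proof (cases "n = 0")
    case False
    hence "n > 0" by simp
    show ?thesis unfolding g_def
      by (simp only: False if_False integral_mult_right_zero exp_half_line_complex(2)[OF w] powr_eq[OF \<open>n > 0\<close>])
         simp
  qed (simp add: g_def)
  have en: "(LINT t|lborel. norm (g n t)) = a n * real n powr (- (1 + Re z)) / (1 + Re z)" for n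
  proof (cases "n = 0")
    case False
    have "(\<lambda>t. norm (g n t)) = (\<lambda>t. a n * (indicator {ln (real n)<..} t *\<^sub>R exp (- (1 + Re z) * t)))"
      using False by (auto simp: g_def fun_eq_iff norm_mult norm_exp_eq_Re nonneg indicator_def algebra_simps)
    thus ?thesis using exp_half_line_real(2)[of "1 + Re z" "ln (real n)"] w False
      by (simp add: powr_def)
  qed (simp add: g_def)
  have AE: "AE t in lborel. summable (\<lambda>n. norm (g n t))"
  proof (intro AE_I2)
    fix t show "summable (\<lambda>n. norm (g n t))"
      by (rule summable_finite[OF fin[of t]]) auto
  qed
  have sm: "summable (\<lambda>n. LINT t|lborel. norm (g n t))"
    unfolding en using z by (intro summable_divide summ) auto
  have eq: "(\<Sum>n. g n t) = of_real (psi t) * exp (- (1 + z) * of_real t)" for t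
  proof -
    have "(\<Sum>n. g n t) = (\<Sum>n | n \<ge> 1 \<and> ln (real n) < t. g n t)"
      by (rule suminf_finite[OF finite_psi]) (auto simp: g_def indicator_def)
    also have "\<dots> = (\<Sum>n | n \<ge> 1 \<and> ln (real n) < t. of_real (a n) * exp (- (1 + z) * of_real t))"
      by (intro sum.cong) (auto simp: g_def indicator_def)
    finally show ?thesis by (simp add: psi_def sum_distrib_right)
  qed
  show "integrable lborel (\<lambda>t. of_real (psi t) * exp (- (1 + z) * of_real t))"
    using integrable_suminf[OF ig AE sm] by (simp add: eq)
  have "(\<lambda>n. integral\<^sup>L lborel (g n)) sums (LINT t|lborel. of_real (psi t) * exp (- (1 + z) * of_real t))"
    using sums_integral[OF ig AE sm] by (simp add: eq)
  moreover have "(\<lambda>n. integral\<^sup>L lborel (g n)) sums ((1 + z) * (h z + 1 / z) / (1 + z))"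
    unfolding eg by (intro sums_divide h_eq z)
  ultimately show "(LINT t|lborel. of_real (psi t) * exp (- (1 + z) * of_real t)) = h z + 1 / z"
    using sums_unique2 w0 by fastforce
qed

definition f :: "real \<Rightarrow> real" where "f t = psi t * exp (- t)"

lemma f_nonneg: "f t \<ge> 0" by (simp add: f_def psi_nonneg)

lemma f_nonpos: "t \<le> 0 \<Longrightarrow> f t = 0" by (simp add: f_def psi_nonpos)

lemma f_measurable [measurable]: "f \<in> borel_measurable borel"
  unfolding f_def[abs_def] by measurable

text \<open>The Tauberian condition: \<open>f\<close> cannot fall faster than
  \<open>exp (- t)\<close>. One value therefore bounds \<open>f\<close> from below to its right and
  from above to its left.\<close>

lemma f_quasi_mono: "s \<le> t \<Longrightarrow> f s \<le> exp (t - s) * f t"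
proof -
  assume "s \<le> t"
  hence "psi s * exp (- s) \<le> psi t * exp (- s)" by (intro mult_right_mono psi_mono) auto
  also have "\<dots> = exp (t - s) * f t" by (simp add: f_def mult_ac flip: exp_add)
  finally show ?thesis by (simp add: f_def)
qed

lemma f_exp_integrable:
  assumes "d > 0"
  shows "integrable lborel (\<lambda>t. f t * exp (- d * t))"
proof -
  have "integrable lborel (\<lambda>t. norm (of_real (psi t) * exp (- (1 + complex_of_real d) * of_real t)))"
    by (intro integrable_norm psi_laplace) (use assms in auto)
  also have "(\<lambda>t. norm (of_real (psi t) * exp (- (1 + complex_of_real d) * of_real t))) = (\<lambda>t. f t * exp (- d * t))"
    by (auto simp: f_def norm_mult norm_exp_eq_Re psi_nonneg fun_eq_iff algebra_simps simp flip: exp_add)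
  finally show ?thesis .
qed

text \<open>Subtracting the unit step removes the pole \<open>1 / z\<close> from the transform. Only
  \<open>h\<close> remains, and the right side keeps its meaning at \<open>d = 0\<close>.\<close>

lemma smoothed_identity:
  assumes d: "d > 0" and L: "L > 0"
  shows "complex_of_real ((LINT t|lborel. f t * exp (- d * t) * fejer L (x - t)) -
      (LINT t|lborel. indicator {0<..} t * exp (- d * t) * fejer L (x - t))) =
    (LINT u|lborel. of_real (tri L u) * cis (u * x) * h (Complex d u))"
proof -
  have if1: "integrable lborel (\<lambda>t. f t * exp (- d * t))" by (rule f_exp_integrable[OF d])
  have if2: "integrable lborel (\<lambda>t. indicator {0<..} t * exp (- d * t))"
    using exp_half_line_real(1)[OF d, of 0] by simp
  have i1: "integrable lborel (\<lambda>t. f t * exp (- d * t) * fejer L (x - t))"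
    by (rule Bochner_Integration.integrable_bound[OF integrable_mult_left[OF if1, of "L\<^sup>2"]])
       (auto simp: abs_mult f_nonneg fejer_nonneg intro!: mult_left_mono fejer_le[OF L])
  have i2: "integrable lborel (\<lambda>t. indicator {0<..} t * exp (- d * t) * fejer L (x - t))"
    by (rule Bochner_Integration.integrable_bound[OF integrable_mult_left[OF if2, of "L\<^sup>2"]])
       (auto simp: abs_mult fejer_nonneg intro!: mult_left_mono fejer_le[OF L])
  define G where "G = (\<lambda>t. complex_of_real (f t * exp (- d * t) - indicator {0<..} t * exp (- d * t)))"
  have iG: "integrable lborel G" unfolding G_def by (intro integrable_of_real Bochner_Integration.integrable_diff if1 if2)
  have lap: "(LINT t|lborel. G t * cis (- (u * t))) = h (Complex d u)" for u
  proof -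
    let ?z = "Complex d u"
    have z: "Re ?z > 0" using d by simp
    have e1: "of_real (f t * exp (- d * t)) * cis (- (u * t)) = of_real (psi t) * exp (- (1 + ?z) * of_real t)" for t
    proof -
      have "- (1 + ?z) * of_real t = of_real (- t) + (of_real (- d * t) + \<i> * of_real (- (u * t)))"
        by (simp add: complex_eq_iff algebra_simps)
      show ?thesis unfolding \<open>- (1 + ?z) * of_real t = _\<close> exp_add exp_of_real
        by (simp add: f_def cis_conv_exp)
    qed
    have e2: "of_real (indicator {0<..} t * exp (- d * t)) * cis (- (u * t)) =
        indicator {0<..} t *\<^sub>R exp (- ?z * of_real t)" for t
    proof -
      have "- ?z * of_real t = of_real (- d * t) + \<i> * of_real (- (u * t))"
        by (simp add: complex_eq_iff algebra_simps)
      show ?thesis unfolding \<open>- ?z * of_real t = _\<close> exp_add exp_of_real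
        by (simp add: cis_conv_exp indicator_def)
    qed
    have "(LINT t|lborel. G t * cis (- (u * t))) =
       (LINT t|lborel. of_real (psi t) * exp (- (1 + ?z) * of_real t) - indicator {0<..} t *\<^sub>R exp (- ?z * of_real t))"
      unfolding G_def of_real_diff left_diff_distrib e1 e2 ..
    also have "\<dots> = (h ?z + 1 / ?z) - exp (- ?z * of_real 0) / ?z"
      by (simp only: Bochner_Integration.integral_diff[OF psi_laplace(1)[OF z] exp_half_line_complex(1)[OF z]]
         psi_laplace(2)[OF z] exp_half_line_complex(2)[OF z])
    finally show ?thesis by simp
  qed
  have "complex_of_real ((LINT t|lborel. f t * exp (- d * t) * fejer L (x - t)) -
      (LINT t|lborel. indicator {0<..} t * exp (- d * t) * fejer L (x - t))) =
     complex_of_real (LINT t|lborel. (f t * exp (- d * t) * fejer L (x - t)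
       - indicator {0<..} t * exp (- d * t) * fejer L (x - t)))"
    by (simp only: Bochner_Integration.integral_diff[OF i1 i2])
  also have "\<dots> = (LINT t|lborel. G t * of_real (fejer L (x - t)))"
    unfolding G_def by (subst integral_complex_of_real[symmetric]) (simp add: left_diff_distrib)
  also have "\<dots> = (LINT u|lborel. of_real (tri L u) * cis (u * x) * h (Complex d u))"
    unfolding fejer_convolution[OF iG L] lap ..
  finally show ?thesis .
qed

definition R :: "real \<Rightarrow> real \<Rightarrow> complex" where
  "R L x = (LINT u|lborel. of_real (tri L u) * cis (u * x) * h (Complex 0 u))"

lemma h_vertical_cont: "d \<ge> 0 \<Longrightarrow> continuous_on A (\<lambda>u. h (Complex d u))"
proof -
  assume d: "d \<ge> 0"
  have "continuous_on A (h \<circ> (\<lambda>u. Complex d u))"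
  proof (rule continuous_on_compose)
    show "continuous_on A (\<lambda>u. Complex d u)" by (simp add: Complex_eq) (intro continuous_intros)
    show "continuous_on ((\<lambda>u. Complex d u) ` A) h"
      by (rule continuous_on_subset[OF h_cont]) (use d in auto)
  qed
  thus ?thesis by (simp add: o_def)
qed

lemma h_bound:
  obtains M where "M \<ge> 0" "\<And>d u. 0 \<le> d \<Longrightarrow> d \<le> 1 \<Longrightarrow> \<bar>u\<bar> \<le> L \<Longrightarrow> norm (h (Complex d u)) \<le> M"
proof -
  have "compact (h ` cbox (Complex 0 (-L)) (Complex 1 L))"
    by (intro compact_continuous_image continuous_on_subset[OF h_cont] compact_cbox)
       (auto simp: in_cbox_complex_iff)
  then obtain M where M: "\<And>z. z \<in> cbox (Complex 0 (-L)) (Complex 1 L) \<Longrightarrow> norm (h z) \<le> M"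
    by (meson bounded_iff compact_imp_bounded image_eqI)
  show ?thesis
    by (rule that[of "max M 0"]) (use M in \<open>auto simp: in_cbox_complex_iff abs_le_iff le_max_iff_disj minus_le_iff\<close>)
qed

lemma R_tendsto_0:
  assumes L: "L > 0"
  shows "(R L \<longlongrightarrow> 0) at_top"
proof -
  have "((\<lambda>x. LINT u|lborel. (of_real (tri L u) * h (Complex 0 u)) * cis (u * x)) \<longlongrightarrow> 0) at_top"
    by (rule riemann_lebesgue_compact_support[OF _ _ L])
       (auto intro!: continuous_intros h_vertical_cont simp: tri_def)
  thus ?thesis by (simp add: R_def[abs_def] mult_ac)
qed

lemma shifted_mass_tendsto:
  assumes L: "L > 0"
  shows "((\<lambda>x. LINT t|lborel. indicator {0<..} t * fejer L (x - t)) \<longlongrightarrow> fejer_mass L) at_top"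
proof -
  have eq: "(LINT t|lborel. indicator {0<..} t * fejer L (x - t)) = (LINT v|lborel. indicator {..<x} v * fejer L v)" for x
    using lborel_integral_real_affine[of "-1" "\<lambda>v. indicator {..<x} v * fejer L v" x]
    by (simp add: indicator_def)
  show ?thesis unfolding eq fejer_mass_def
  proof (rule integral_dominated_convergence_at_top[where w = "fejer L"])
    show "AE v in lborel. ((\<lambda>x. indicator {..<x} v * fejer L v) \<longlongrightarrow> fejer L v) at_top"
    proof (intro AE_I2 tendsto_eventually)
      fix v show "\<forall>\<^sub>F x in at_top. indicator {..<x} v * fejer L v = fejer L v"
        using eventually_gt_at_top[of v] by eventually_elim auto
    qed
    show "\<forall>\<^sub>F x in at_top. AE v in lborel. norm (indicator {..<x} v * fejer L v) \<le> fejer L v"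
      by (intro always_eventually allI AE_I2) (auto simp: indicator_def fejer_nonneg)
  qed (use fejer_integrable[OF L] in auto)
qed

text \<open>Passage to \<open>d = 0\<close>. Integrability of \<open>f t * fejer L (x - t)\<close>
  is not known beforehand, so the left side uses monotone convergence (\<open>f\<close> is
  nonnegative and vanishes for \<open>t \<le> 0\<close>); its finiteness comes from the other two
  terms, which converge by domination.\<close>

lemma limit_identity:
  assumes L: "L > 0"
  shows "integrable lborel (\<lambda>t. f t * fejer L (x - t))"
    "(LINT t|lborel. f t * fejer L (x - t)) =
       (LINT t|lborel. indicator {0<..} t * fejer L (x - t)) + Re (R L x)"
proof -
  define d where "d = (\<lambda>i::nat. 1 / real (Suc i))"
  have d: "d i > 0" "d i \<le> 1" for i by (auto simp: d_def)
  have d0: "d \<longlonglongrightarrow> 0" unfolding d_def by real_asymp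
  define J where "J = (\<lambda>i. LINT t|lborel. f t * exp (- d i * t) * fejer L (x - t))"
  define I where "I = (\<lambda>i. LINT t|lborel. indicator {0<..} t * exp (- d i * t) * fejer L (x - t))"
  define Q where "Q = (\<lambda>i. LINT u|lborel. of_real (tri L u) * cis (u * x) * h (Complex (d i) u))"
  have Fi: "integrable lborel (\<lambda>t. fejer L (x - t))"
    using lborel_integrable_real_affine[OF fejer_integrable[OF L], of "-1" x] by simp
  have I: "I \<longlonglongrightarrow> (LINT t|lborel. indicator {0<..} t * fejer L (x - t))"
    unfolding I_def
  proof (rule integral_dominated_convergence[where w = "\<lambda>t. fejer L (x - t)"])
    show "AE t in lborel. (\<lambda>i. indicator {0<..} t * exp (- d i * t) * fejer L (x - t)) \<longlonglongrightarrow> indicator {0<..} t * fejer L (x - t)"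
    proof (intro AE_I2)
      fix t
      have "(\<lambda>i. indicator {0<..} t * exp (- d i * t) * fejer L (x - t)) \<longlonglongrightarrow>
         indicator {0<..} t * exp (- 0 * t) * fejer L (x - t)"
        by (intro tendsto_intros d0)
      thus "(\<lambda>i. indicator {0<..} t * exp (- d i * t) * fejer L (x - t)) \<longlonglongrightarrow> indicator {0<..} t * fejer L (x - t)" by simp
    qed
    show "AE t in lborel. norm (indicator {0<..} t * exp (- d i * t) * fejer L (x - t)) \<le> fejer L (x - t)" for i
      using d[of i] fejer_nonneg by (intro AE_I2) (auto simp: indicator_def intro!: mult_left_le_one_le)
  qed (use Fi in auto)
  obtain M where M: "M \<ge> 0" "\<And>d u. 0 \<le> d \<Longrightarrow> d \<le> 1 \<Longrightarrow> \<bar>u\<bar> \<le> L \<Longrightarrow> norm (h (Complex d u)) \<le> M"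
    using h_bound[of L] by blast
  have meas: "(\<lambda>u. of_real (tri L u) * cis (u * x) * h (Complex d u)) \<in> borel_measurable lborel" if "d \<ge> 0" for d
  proof -
    have "(\<lambda>u. of_real (tri L u) * cis (u * x) * h (Complex d u)) \<in> borel_measurable borel"
      by (intro borel_measurable_continuous_onI continuous_intros continuous_on_cis h_vertical_cont that)
    thus ?thesis by simp
  qed
  have Q: "Q \<longlonglongrightarrow> R L x"
    unfolding Q_def R_def
  proof (rule integral_dominated_convergence[where w = "\<lambda>u. tri L u * M"])
    show "(\<lambda>u. of_real (tri L u) * cis (u * x) * h (Complex 0 u)) \<in> borel_measurable lborel"
      by (rule meas) simp
    show "(\<lambda>u. of_real (tri L u) * cis (u * x) * h (Complex (d i) u)) \<in> borel_measurable lborel" for i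
      using d[of i] by (intro meas) simp
    show "integrable lborel (\<lambda>u. tri L u * M)" using tri_integrable[OF L] by simp
    show "AE u in lborel. (\<lambda>i. of_real (tri L u) * cis (u * x) * h (Complex (d i) u)) \<longlonglongrightarrow>
        of_real (tri L u) * cis (u * x) * h (Complex 0 u)"
    proof (intro AE_I2 tendsto_mult tendsto_const)
      fix u
      have "(\<lambda>i. of_real (d i) + \<i> * of_real u) \<longlonglongrightarrow> of_real 0 + \<i> * of_real u"
        by (intro tendsto_intros d0)
      hence "(\<lambda>i. Complex (d i) u) \<longlonglongrightarrow> Complex 0 u" by (simp add: Complex_eq)
      thus "(\<lambda>i. h (Complex (d i) u)) \<longlonglongrightarrow> h (Complex 0 u)"
        by (rule continuous_on_tendsto_compose[OF h_cont]) (use d in \<open>auto simp: less_imp_le\<close>)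
    qed
    show "AE u in lborel. norm (of_real (tri L u) * cis (u * x) * h (Complex (d i) u)) \<le> tri L u * M" for i
    proof (intro AE_I2)
      fix u
      show "norm (of_real (tri L u) * cis (u * x) * h (Complex (d i) u)) \<le> tri L u * M"
      proof (cases "\<bar>u\<bar> \<le> L")
        case True
        have "tri L u * norm (h (Complex (d i) u)) \<le> tri L u * M"
          using M(2)[of "d i" u] d[of i] True by (intro mult_left_mono tri_nonneg) auto
        thus ?thesis by (simp add: norm_mult tri_nonneg)
      qed (simp add: tri_def)
    qed
  qed
  have JI: "J i = I i + Re (Q i)" for i
  proof -
    have "complex_of_real (J i - I i) = Q i"
      unfolding J_def I_def Q_def by (rule smoothed_identity[OF d(1) L])
    hence "Re (complex_of_real (J i - I i)) = Re (Q i)" by (simp only:)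
    thus ?thesis by simp
  qed
  have J: "J \<longlonglongrightarrow> (LINT t|lborel. indicator {0<..} t * fejer L (x - t)) + Re (R L x)"
    unfolding JI by (intro tendsto_intros I Q)
  have iJ: "integrable lborel (\<lambda>t. f t * exp (- d i * t) * fejer L (x - t))" for i
    by (rule Bochner_Integration.integrable_bound[OF integrable_mult_left[OF f_exp_integrable[OF d(1)[of i]], of "L\<^sup>2"]])
       (auto simp: abs_mult f_nonneg fejer_nonneg intro!: mult_left_mono fejer_le[OF L])
  have mono: "AE t in lborel. mono (\<lambda>i. f t * exp (- d i * t) * fejer L (x - t))"
  proof (intro AE_I2 monoI mult_right_mono fejer_nonneg)
    fix t and i j :: nat assume "i \<le> j"
    show "f t * exp (- d i * t) \<le> f t * exp (- d j * t)"
    proof (cases "t \<le> 0")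
      case False
      have "d j \<le> d i" using \<open>i \<le> j\<close> by (auto simp: d_def frac_le)
      thus ?thesis using False by (intro mult_left_mono f_nonneg) auto
    qed (simp add: f_nonpos)
  qed
  have lim: "AE t in lborel. (\<lambda>i. f t * exp (- d i * t) * fejer L (x - t)) \<longlonglongrightarrow> f t * fejer L (x - t)"
  proof (intro AE_I2)
    fix t
    have "(\<lambda>i. f t * exp (- d i * t) * fejer L (x - t)) \<longlonglongrightarrow> f t * exp (- 0 * t) * fejer L (x - t)"
      by (intro tendsto_intros d0)
    thus "(\<lambda>i. f t * exp (- d i * t) * fejer L (x - t)) \<longlonglongrightarrow> f t * fejer L (x - t)" by simp
  qed
  note * = iJ mono lim J[unfolded J_def]
  show "integrable lborel (\<lambda>t. f t * fejer L (x - t))"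
    by (rule integrable_monotone_convergence[OF *]) measurable
  show "(LINT t|lborel. f t * fejer L (x - t)) =
       (LINT t|lborel. indicator {0<..} t * fejer L (x - t)) + Re (R L x)"
    by (rule integral_monotone_convergence[OF *]) measurable
qed

section \<open>From the smoothed limit to the pointwise limit\<close>

definition J :: "real \<Rightarrow> real \<Rightarrow> real" where
  "J L x = (LINT t|lborel. f t * fejer L (x - t))"

lemma J_tendsto:
  assumes "L > 0"
  shows "(J L \<longlongrightarrow> fejer_mass L) at_top"
proof -
  have "((\<lambda>x. (LINT t|lborel. indicator {0<..} t * fejer L (x - t)) + Re (R L x)) \<longlongrightarrow> fejer_mass L + Re 0) at_top"
    by (intro tendsto_intros shifted_mass_tendsto R_tendsto_0 assms)
  thus ?thesis unfolding J_def[abs_def] limit_identity(2)[OF assms] by simp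
qed

definition central_mass :: "real \<Rightarrow> real \<Rightarrow> real" where
  "central_mass L e = (LINT v|lborel. indicator {-e..e} v * fejer L v)"

lemma central_mass_shift: "(LINT t|lborel. indicator {y-e..y+e} t * fejer L (y - t)) = central_mass L e"
proof -
  have "indicator {-e..e} (y + -1 * t) = (indicator {y-e..y+e} t :: real)" for t
    by (auto simp: indicator_def)
  thus ?thesis using lborel_integral_real_affine[of "-1" "\<lambda>v. indicator {-e..e} v * fejer L v" y]
    by (simp add: central_mass_def)
qed

lemma integrable_window: 
  assumes "L > 0"
  shows "integrable lborel (\<lambda>t. indicator {y-e..y+e} t * fejer L (y - t))"
proof -
  have "integrable lborel (\<lambda>t. fejer L (y - t))"
    using lborel_integrable_real_affine[OF fejer_integrable[OF assms], of "-1" y] by simp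
  from integrable_mult_indicator[OF _ this, of "{y-e..y+e}"] show ?thesis by simp
qed

text \<open>Centring the window at \<open>x + e\<close> places it entirely to the right of
  \<open>x\<close>, where \<open>f\<close> is at least \<open>exp (- 2 * e) * f x\<close>.\<close>

lemma f_upper:
  assumes "L > 0" "e > 0"
  shows "f x * exp (- 2 * e) * central_mass L e \<le> J L (x + e)"
proof -
  have "f x * exp (- 2 * e) * central_mass L e =
     (LINT t|lborel. f x * exp (- 2 * e) * (indicator {x + e - e..x + e + e} t * fejer L (x + e - t)))"
    by (simp only: central_mass_shift[of "x + e" e L, symmetric]) simp
  also have "\<dots> \<le> J L (x + e)"
    unfolding J_def
  proof (rule integral_mono)
    show "integrable lborel (\<lambda>t. f x * exp (- 2 * e) * (indicator {x + e - e..x + e + e} t * fejer L (x + e - t)))"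
      by (intro integrable_mult_right integrable_window assms)
    show "integrable lborel (\<lambda>t. f t * fejer L (x + e - t))" by (rule limit_identity(1)[OF assms(1)])
    fix t
    show "f x * exp (- 2 * e) * (indicator {x + e - e..x + e + e} t * fejer L (x + e - t)) \<le> f t * fejer L (x + e - t)"
    proof (cases "t \<in> {x + e - e..x + e + e}")
      case True
      have "f x * exp (- 2 * e) \<le> exp (t - x) * f t * exp (- 2 * e)"
        using True by (intro mult_right_mono f_quasi_mono) auto
      also have "\<dots> = exp (t - x - 2 * e) * f t"
      proof -
        have "exp (t - x - 2 * e) = exp (t - x) * exp (- 2 * e)" by (simp flip: exp_add)
        thus ?thesis by simp
      qed
      also have "\<dots> \<le> 1 * f t" using True by (intro mult_right_mono f_nonneg) auto
      finally show ?thesis using True by (simp add: mult_right_mono fejer_nonneg)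
    qed (simp add: f_nonneg fejer_nonneg)
  qed
  finally show ?thesis .
qed

text \<open>The window lies to the left of \<open>x\<close>, where \<open>f\<close> is at most
  \<open>exp (2 * e) * f x\<close>. Outside it only a global bound is available, hence the need for
  \<open>f_bounded\<close> before the lower estimate.\<close>

lemma f_lower:
  assumes "L > 0" "e > 0" and B: "\<And>t. f t \<le> B"
  shows "J L (x - e) \<le> f x * exp (2 * e) * central_mass L e + B * (fejer_mass L - central_mass L e)"
proof -
  let ?y = "x - e"
  let ?w = "\<lambda>t. indicator {?y - e..?y + e} t * fejer L (?y - t)"
  have Fi: "integrable lborel (\<lambda>t. fejer L (?y - t))"
    using lborel_integrable_real_affine[OF fejer_integrable[OF assms(1)], of "-1" ?y] by simp
  have Fm: "(LINT t|lborel. fejer L (?y - t)) = fejer_mass L"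
    using lborel_integral_real_affine[of "-1" "fejer L" ?y] by (simp add: fejer_mass_def)
  have B0: "B \<ge> 0" using B[of 0] f_nonneg[of 0] by linarith
  have "J L ?y \<le> (LINT t|lborel. f x * exp (2 * e) * ?w t + B * (fejer L (?y - t) - ?w t))"
    unfolding J_def
  proof (rule integral_mono)
    show "integrable lborel (\<lambda>t. f t * fejer L (?y - t))" by (rule limit_identity(1)[OF assms(1)])
    show "integrable lborel (\<lambda>t. f x * exp (2 * e) * ?w t + B * (fejer L (?y - t) - ?w t))"
      by (intro Bochner_Integration.integrable_add integrable_mult_right Bochner_Integration.integrable_diff
           integrable_window Fi assms)
    fix t
    show "f t * fejer L (?y - t) \<le> f x * exp (2 * e) * ?w t + B * (fejer L (?y - t) - ?w t)"
    proof (cases "t \<in> {?y - e..?y + e}")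
      case True
      have "f t \<le> exp (x - t) * f x" using True by (intro f_quasi_mono) auto
      also have "\<dots> \<le> exp (2 * e) * f x" using True by (intro mult_right_mono f_nonneg) auto
      finally have "f t * fejer L (?y - t) \<le> exp (2 * e) * f x * fejer L (?y - t)"
        by (rule mult_right_mono) (rule fejer_nonneg)
      thus ?thesis using True by (simp add: mult_ac)
    next
      case False
      thus ?thesis using B[of t] by (simp add: mult_right_mono fejer_nonneg)
    qed
  qed
  also have "\<dots> = f x * exp (2 * e) * (LINT t|lborel. ?w t) + B * ((LINT t|lborel. fejer L (?y - t)) - (LINT t|lborel. ?w t))"
    using integrable_window[OF assms(1), of ?y e] Fi by simp
  finally show ?thesis by (simp only: Fm central_mass_shift)
qed

lemma f_bounded:
  obtains B where "B \<ge> 0" "\<And>t. f t \<le> B"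
proof -
  \<comment> \<open>This \<open>L\<close> gives the kernel mass 16, and the mass outside
    \<open>[-1, 1]\<close> is at most 8, so at least half of the mass is central.\<close>
  define L where "L = 16 / fejer_mass 1"
  have L: "L > 0" using fejer_mass_pos[of 1] by (simp add: L_def)
  have m: "fejer_mass L = 16" using fejer_mass_scale[OF L] fejer_mass_pos[of 1] by (simp add: L_def)
  have c: "central_mass L 1 \<ge> 8" using fejer_central_mass(1)[OF L, of 1] m by (simp add: central_mass_def)
  have "\<forall>\<^sub>F x in at_top. J L x < 17"
    using order_tendstoD(2)[OF J_tendsto[OF L], of 17] m by simp
  then obtain x0 where x0: "\<And>x. x \<ge> x0 \<Longrightarrow> J L x < 17"
    by (auto simp: eventually_at_top_linorder)
  define x1 where "x1 = max x0 0"
  have b1: "f x \<le> 3 * exp 2" if "x \<ge> x1" for x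
  proof -
    have "f x * exp (- 2) * 8 \<le> f x * exp (- 2 * 1) * central_mass L 1"
      using c f_nonneg[of x] by (intro mult_mono) auto
    also have "\<dots> \<le> J L (x + 1)" by (rule f_upper[OF L]) auto
    also have "\<dots> < 17" using that by (intro x0) (auto simp: x1_def)
    finally have "f x * exp (- 2) \<le> 3" by simp
    hence "f x * exp (- 2) * exp 2 \<le> 3 * exp 2" by (rule mult_right_mono) auto
    moreover have "exp (- 2) * exp 2 = (1 :: real)" by (simp flip: exp_add)
    ultimately show ?thesis by (simp add: mult.assoc)
  qed
  define B where "B = exp x1 * (3 * exp 2)"
  have "f x \<le> B" for x
  proof -
    consider "x \<le> 0" | "x \<ge> x1" | "0 < x" "x < x1" by linarith
    thus ?thesis
    proof cases
      case 1 thus ?thesis by (simp add: f_nonpos B_def)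
    next
      case 2
      have "1 * (3 * exp 2) \<le> exp x1 * (3 * exp (2 :: real))"
        by (intro mult_right_mono) (auto simp: x1_def)
      with b1[OF 2] show ?thesis unfolding B_def by linarith
    next
      case 3
      have "f x \<le> exp (x1 - x) * f x1" using 3 by (intro f_quasi_mono) auto
      also have "\<dots> \<le> B" unfolding B_def
        using 3 b1[of x1] by (intro mult_mono) (auto simp: f_nonneg)
      finally show ?thesis .
    qed
  qed
  thus ?thesis by (intro that[of B]) (auto simp: B_def)
qed

lemma f_tendsto_1: "(f \<longlongrightarrow> 1) at_top"
proof -
  define m where "m = fejer_mass 1"
  have m: "m > 0" using fejer_mass_pos[of 1] by (simp add: m_def)
  obtain B where B: "B \<ge> 0" "\<And>t. f t \<le> B" by (rule f_bounded) blast
  \<comment> \<open>Kernel parameter \<open>k\<^sup>2\<close> and window \<open>1 / k\<close>: the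
    window shrinks, so the distortion \<open>exp (2 / k)\<close> tends to 1, while the tail mass
    \<open>8 * k\<close> is negligible against the total \<open>k\<^sup>2 * m\<close>.\<close>
  have mass: "fejer_mass (k\<^sup>2) = k\<^sup>2 * m" "central_mass (k\<^sup>2) (1 / k) \<ge> k\<^sup>2 * m - 8 * k" "central_mass (k\<^sup>2) (1 / k) \<le> k\<^sup>2 * m"
    if "k > 0" for k :: real
    using fejer_mass_scale[of "k\<^sup>2"] fejer_central_mass[of "k\<^sup>2" "1 / k"] that
    by (auto simp: m_def central_mass_def)
  show ?thesis
  proof (rule order_tendstoI)
    fix a :: real assume a: "a > 1"
    have "((\<lambda>k. a * (1 - 8 / (k * m)) - exp (2 / k)) \<longlongrightarrow> a * (1 - 0) - exp 0) at_top"
      using m by (intro tendsto_intros) real_asymp+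
    hence "\<forall>\<^sub>F k in at_top. a * (1 - 8 / (k * m)) - exp (2 / k) > 0"
      by (rule order_tendstoD) (use a in auto)
    hence "\<forall>\<^sub>F k in at_top. a * (1 - 8 / (k * m)) - exp (2 / k) > 0 \<and> k > 0"
      by (intro eventually_conj eventually_gt_at_top)
    then obtain k :: real where k: "a * (1 - 8 / (k * m)) - exp (2 / k) > 0" "k > 0"
      by (metis (no_types, lifting) eventually_at_top_linorder order_refl)
    have "exp (2 / k) * (k\<^sup>2 * m) < a * (1 - 8 / (k * m)) * (k\<^sup>2 * m)"
      using k m by (intro mult_strict_right_mono) auto
    also have "\<dots> = a * (k\<^sup>2 * m - 8 * k)" using k m by (simp add: field_simps power2_eq_square)
    finally have lt: "exp (2 / k) * (k\<^sup>2 * m) < a * (k\<^sup>2 * m - 8 * k)" .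
    have "((\<lambda>x. J (k\<^sup>2) (x + 1 / k)) \<longlongrightarrow> k\<^sup>2 * m) at_top"
      using J_tendsto[of "k\<^sup>2"] mass(1)[OF k(2)] k(2)
      by (intro filterlim_compose[OF _ filterlim_tendsto_add_at_top[OF tendsto_const filterlim_ident],
            of "J (k\<^sup>2)" _ "1 / k", unfolded add.commute[of "1 / k"]]) auto
    from order_tendstoD(2)[OF tendsto_mult[OF tendsto_const[of "exp (2 / k)"] this] lt]
    show "\<forall>\<^sub>F x in at_top. f x < a"
    proof eventually_elim
      case (elim x)
      show ?case
      proof (rule ccontr)
        assume "\<not> f x < a"
        hence "a * exp (- 2 * (1 / k)) * central_mass (k\<^sup>2) (1 / k) \<le> f x * exp (- 2 * (1 / k)) * central_mass (k\<^sup>2) (1 / k)"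
          by (intro mult_right_mono) (auto simp: central_mass_def fejer_nonneg intro!: Bochner_Integration.integral_nonneg)
        also have "\<dots> \<le> J (k\<^sup>2) (x + 1 / k)" using k by (intro f_upper) auto
        finally have "exp (2 / k) * (a * exp (- 2 * (1 / k)) * central_mass (k\<^sup>2) (1 / k)) \<le> exp (2 / k) * J (k\<^sup>2) (x + 1 / k)"
          by (intro mult_left_mono) auto
        moreover have "exp (2 / k) * (a * exp (- 2 * (1 / k)) * central_mass (k\<^sup>2) (1 / k)) = a * central_mass (k\<^sup>2) (1 / k)"
          by (simp add: exp_minus field_simps)
        moreover have "a * (k\<^sup>2 * m - 8 * k) \<le> a * central_mass (k\<^sup>2) (1 / k)"
          using mass(2)[OF k(2)] a by (intro mult_left_mono) auto
        ultimately show False using elim by linarith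
      qed
    qed
  next
    fix a' :: real assume a': "a' < 1"
    define a where "a = max a' (1 / 2)"
    have a: "a > 0" "a < 1" "a' \<le> a" using a' by (auto simp: a_def)
    have "((\<lambda>k. 1 - 8 * B / (k * m) - exp (2 / k) * a) \<longlongrightarrow> 1 - 0 - exp 0 * a) at_top"
      using m by (intro tendsto_intros) real_asymp+
    hence "\<forall>\<^sub>F k in at_top. 1 - 8 * B / (k * m) - exp (2 / k) * a > 0"
      by (rule order_tendstoD) (use a in auto)
    hence "\<forall>\<^sub>F k in at_top. 1 - 8 * B / (k * m) - exp (2 / k) * a > 0 \<and> k > 0"
      by (intro eventually_conj eventually_gt_at_top)
    then obtain k :: real where k: "1 - 8 * B / (k * m) - exp (2 / k) * a > 0" "k > 0"
      by (metis (no_types, lifting) eventually_at_top_linorder order_refl)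
    have "exp (2 / k) * a * (k\<^sup>2 * m) < (1 - 8 * B / (k * m)) * (k\<^sup>2 * m)"
      using k m by (intro mult_strict_right_mono) auto
    also have "\<dots> = k\<^sup>2 * m - 8 * B * k" using k m by (simp add: field_simps power2_eq_square)
    finally have lt: "exp (2 / k) * a * (k\<^sup>2 * m) + 8 * B * k < k\<^sup>2 * m" by simp
    have "((\<lambda>x. J (k\<^sup>2) (x - 1 / k)) \<longlongrightarrow> k\<^sup>2 * m) at_top"
      using J_tendsto[of "k\<^sup>2"] mass(1)[OF k(2)] k(2)
      by (intro filterlim_compose[OF _ filterlim_tendsto_add_at_top[OF tendsto_const filterlim_ident],
            of "J (k\<^sup>2)" _ "- (1 / k)", unfolded add.commute[of "- (1 / k)"] add_uminus_conv_diff]) auto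
    from order_tendstoD(1)[OF this lt]
    show "\<forall>\<^sub>F x in at_top. a' < f x"
    proof eventually_elim
      case (elim x)
      show ?case
      proof (rule ccontr)
        assume "\<not> a' < f x"
        hence fa: "f x \<le> a" using a by linarith
        have "J (k\<^sup>2) (x - 1 / k) \<le> f x * exp (2 * (1 / k)) * central_mass (k\<^sup>2) (1 / k)
             + B * (fejer_mass (k\<^sup>2) - central_mass (k\<^sup>2) (1 / k))"
          using k B by (intro f_lower) auto
        also have "\<dots> \<le> a * exp (2 * (1 / k)) * (k\<^sup>2 * m) + B * (8 * k)"
        proof (intro add_mono mult_mono)
          show "fejer_mass (k\<^sup>2) - central_mass (k\<^sup>2) (1 / k) \<le> 8 * k" using mass[OF k(2)] by linarith
          show "fejer_mass (k\<^sup>2) - central_mass (k\<^sup>2) (1 / k) \<ge> 0" using mass[OF k(2)] by linarith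
          show "0 \<le> central_mass (k\<^sup>2) (1 / k)"
            by (auto simp: central_mass_def fejer_nonneg intro!: Bochner_Integration.integral_nonneg)
        qed (use fa mass[OF k(2)] B a f_nonneg in auto)
        finally show False using elim by (simp add: mult_ac)
      qed
    qed
  qed
qed

theorem wiener_ikehara: "(\<lambda>n. (\<Sum>m\<in>{1..<n}. a m) / real n) \<longlonglongrightarrow> 1"
proof -
  have "filterlim (\<lambda>n. ln (real n)) at_top sequentially" by real_asymp
  hence "(\<lambda>n. f (ln (real n))) \<longlonglongrightarrow> 1" by (rule filterlim_compose[OF f_tendsto_1])
  moreover have "\<forall>\<^sub>F n in sequentially. f (ln (real n)) = (\<Sum>m\<in>{1..<n}. a m) / real n"
    using eventually_gt_at_top[of 0]
  proof eventually_elim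
    case (elim n)
    have "{m. m \<ge> 1 \<and> ln (real m) < ln (real n)} = {1..<n}" using elim by auto
    hence "psi (ln (real n)) = (\<Sum>m\<in>{1..<n}. a m)" by (simp only: psi_def)
    thus ?case using elim by (simp add: f_def exp_minus divide_inverse)
  qed
  ultimately show ?thesis by (rule Lim_transform_eventually)
qed

end

section \<open>The prime number theorem\<close>

lemma sum_mangoldt_asymp: "(\<lambda>n. (\<Sum>m\<in>{1..<n}. mangoldt m) / real n) \<longlonglongrightarrow> 1"
proof -
  \<comment> \<open>The \<open>- 1\<close> compensates \<open>(1 + z) / z = 1 / z + 1\<close>, as
    the locale wants the pole in the form \<open>(1 + z) * (h z + 1 / z)\<close>.\<close>
  define h where "h = (\<lambda>z. (- deriv zeta_reg (1 + z) / zeta_reg (1 + z) - 1) / (1 + z))"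
  interpret tauberian mangoldt h
  proof
    show "mangoldt n \<ge> (0::real)" for n by (rule mangoldt_nonneg)
    show "summable (\<lambda>n. mangoldt n * real n powr (-c))" if "c > 1" for c
      by (rule summable_mangoldt_powr[OF that])
    have "continuous_on {z. Re z > 0} zeta_reg"
      by (intro holomorphic_on_imp_continuous_on holomorphic_zeta_reg)
    hence c1: "continuous_on {z. Re z \<ge> 0} (\<lambda>z. zeta_reg (1 + z))"
      by (rule continuous_on_compose2) (auto intro!: continuous_intros)
    have "continuous_on {z. Re z > 0} (deriv zeta_reg)"
      by (intro holomorphic_on_imp_continuous_on holomorphic_deriv holomorphic_zeta_reg open_halfspace_Re_gt)
    hence c2: "continuous_on {z. Re z \<ge> 0} (\<lambda>z. deriv zeta_reg (1 + z))"
      by (rule continuous_on_compose2) (auto intro!: continuous_intros)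
    have "1 + z \<noteq> 0" if "Re z \<ge> 0" for z
    proof -
      have "Re (1 + z) > 0" using that by simp
      thus ?thesis by fastforce
    qed
    thus "continuous_on {z. Re z \<ge> 0} h"
      unfolding h_def using zeta_reg_nonzero by (intro continuous_intros c1 c2) auto
    show "(\<lambda>n. of_real (mangoldt n) * of_nat n powr (- (1 + z))) sums ((1 + z) * (h z + 1 / z))"
      if z: "Re z > 0" for z
    proof -
      have nz: "1 + z \<noteq> 0" "z \<noteq> 0" using z by (auto simp: complex_eq_iff)
      have "(1 + z) * (h z + 1 / z) = (1 + z) * h z + (1 + z) / z" using nz by (simp add: algebra_simps)
      also have "(1 + z) * h z = - deriv zeta_reg (1 + z) / zeta_reg (1 + z) - 1"
        unfolding h_def by (simp only: times_divide_eq_right nonzero_mult_div_cancel_left[OF nz(1)])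
      also have "(1 + z) / z = 1 / z + 1" using nz by (simp add: field_simps)
      finally have "(1 + z) * (h z + 1 / z) = dseries mangoldt (1 + z)"
        using z by (simp add: dseries_mangoldt_eq)
      thus ?thesis
        using has_sum_imp_sums[OF has_sum_dseries[OF mangoldt_nonneg summable_mangoldt_powr, of "1 + z"]] z
        by simp
    qed
  qed
  show ?thesis by (rule wiener_ikehara)
qed

section \<open>From prime powers to primes\<close>

definition chebyshev_theta :: "nat \<Rightarrow> real" where
  "chebyshev_theta n = (\<Sum>p | prime p \<and> p \<le> n. ln (real p))"

text \<open>A proper power \<open>p ^ k \<le> n\<close> has \<open>p \<le> sqrt n\<close> and, as
  \<open>p \<ge> 2\<close>, also \<open>k \<le> log 2 n\<close>. Counting pairs is crude but far
  below \<open>n\<close>.\<close>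

lemma proper_primepow_card:
  "card {m. m \<le> n \<and> primepow m \<and> \<not> prime m} \<le> (nat \<lfloor>sqrt (real n)\<rfloor> + 1) * (nat \<lfloor>log 2 (real n)\<rfloor> + 1)"
proof -
  have "{m. m \<le> n \<and> primepow m \<and> \<not> prime m} \<subseteq>
      (\<lambda>(p, k). p ^ k) ` ({..nat \<lfloor>sqrt (real n)\<rfloor>} \<times> {..nat \<lfloor>log 2 (real n)\<rfloor>})"
  proof
    fix m assume m: "m \<in> {m. m \<le> n \<and> primepow m \<and> \<not> prime m}"
    then obtain p k where pk: "prime p" "k > 0" "m = p ^ k" by (auto simp: primepow_def)
    with m have "k \<noteq> 1" by auto
    hence k2: "k \<ge> 2" using pk by linarith
    have p2: "p \<ge> 2" using pk prime_ge_2_nat by blast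
    have "p ^ 2 \<le> p ^ k" using k2 p2 by (intro power_increasing) auto
    hence "real p ^ 2 \<le> real n" using m pk by (metis (mono_tags, lifting) mem_Collect_eq of_nat_le_iff of_nat_power order.trans)
    hence "real p \<le> sqrt (real n)" by (simp add: real_le_rsqrt)
    hence 1: "p \<le> nat \<lfloor>sqrt (real n)\<rfloor>" by (simp add: le_nat_floor)
    have "2 ^ k \<le> p ^ k" using p2 by (intro power_mono) auto
    moreover have "p ^ k \<le> n" using m pk by auto
    ultimately have "2 ^ k \<le> n" by linarith
    hence "2 ^ k \<le> real n" by (metis of_nat_le_iff of_nat_numeral of_nat_power)
    hence "2 powr real k \<le> real n" by (simp add: powr_realpow)
    moreover have "real n > 0" using \<open>2 ^ k \<le> n\<close> by (metis less_le_trans of_nat_0_less_iff zero_less_numeral zero_less_power)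
    ultimately have "real k \<le> log 2 (real n)" by (simp add: le_log_iff)
    hence 2: "k \<le> nat \<lfloor>log 2 (real n)\<rfloor>" by (simp add: le_nat_floor)
    show "m \<in> (\<lambda>(p, k). p ^ k) ` ({..nat \<lfloor>sqrt (real n)\<rfloor>} \<times> {..nat \<lfloor>log 2 (real n)\<rfloor>})"
      using 1 2 pk by (intro image_eqI[of _ _ "(p, k)"]) auto
  qed
  hence "card {m. m \<le> n \<and> primepow m \<and> \<not> prime m} \<le>
     card ((\<lambda>(p, k). p ^ k) ` ({..nat \<lfloor>sqrt (real n)\<rfloor>} \<times> {..nat \<lfloor>log 2 (real n)\<rfloor>}))"
    by (intro card_mono) auto
  also have "\<dots> \<le> card ({..nat \<lfloor>sqrt (real n)\<rfloor>} \<times> {..nat \<lfloor>log 2 (real n)\<rfloor>})"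
    by (intro card_image_le) auto
  finally show ?thesis by simp
qed

lemma chebyshev_theta_diff:
  assumes "n \<ge> 1"
  shows "chebyshev_theta n \<le> (\<Sum>m\<in>{1..<Suc n}. mangoldt m)"
    "(\<Sum>m\<in>{1..<Suc n}. mangoldt m) - chebyshev_theta n \<le> (sqrt (real n) + 1) * (log 2 (real n) + 1) * ln (real n)"
proof -
  let ?P = "{p. prime p \<and> p \<le> n}" and ?Q = "{m. m \<le> n \<and> primepow m \<and> \<not> prime m}"
  have fP: "finite ?P" by (rule finite_subset[of _ "{..n}"]) auto
  have fQ: "finite ?Q" by (rule finite_subset[of _ "{..n}"]) auto
  have "(\<Sum>m\<in>{1..<Suc n}. mangoldt m) = (\<Sum>m\<in>?P \<union> ?Q. mangoldt m :: real)"
    by (rule sum.mono_neutral_right)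
       (auto simp: mangoldt_def Suc_le_eq prime_gt_0_nat primepow_gt_0_nat)
  also have "\<dots> = (\<Sum>m\<in>?P. mangoldt m) + (\<Sum>m\<in>?Q. mangoldt m)"
    using fP fQ by (intro sum.union_disjoint) auto
  also have "(\<Sum>m\<in>?P. mangoldt m) = chebyshev_theta n"
    unfolding chebyshev_theta_def by (intro sum.cong) auto
  finally have eq: "(\<Sum>m\<in>{1..<Suc n}. mangoldt m) = chebyshev_theta n + (\<Sum>m\<in>?Q. mangoldt m)" .
  have "(\<Sum>m\<in>?Q. mangoldt m :: real) \<ge> 0" by (intro sum_nonneg mangoldt_nonneg)
  thus "chebyshev_theta n \<le> (\<Sum>m\<in>{1..<Suc n}. mangoldt m)" using eq by linarith
  have "(\<Sum>m\<in>?Q. mangoldt m :: real) \<le> of_nat (card ?Q) * ln (real n)"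
  proof (rule sum_bounded_above)
    fix m assume m: "m \<in> ?Q"
    hence "m > 0" by (auto intro: primepow_gt_0_nat)
    have "mangoldt m \<le> ln (real m)" using \<open>m > 0\<close> by (rule mangoldt_le)
    also have "\<dots> \<le> ln (real n)" using m \<open>m > 0\<close> by simp
    finally show "mangoldt m \<le> ln (real n)" .
  qed
  also have "\<dots> \<le> (sqrt (real n) + 1) * (log 2 (real n) + 1) * ln (real n)"
  proof (intro mult_right_mono)
    have l: "log 2 (real n) \<ge> 0" using assms by simp
    have "real (card ?Q) \<le> real ((nat \<lfloor>sqrt (real n)\<rfloor> + 1) * (nat \<lfloor>log 2 (real n)\<rfloor> + 1))"
      using proper_primepow_card by (subst of_nat_le_iff)
    also have "\<dots> = (of_int \<lfloor>sqrt (real n)\<rfloor> + 1) * (of_int \<lfloor>log 2 (real n)\<rfloor> + 1)"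
      using l by (simp add: of_nat_nat algebra_simps)
    also have "\<dots> \<le> (sqrt (real n) + 1) * (log 2 (real n) + 1)"
      using l by (intro mult_mono) auto
    finally show "real (card ?Q) \<le> (sqrt (real n) + 1) * (log 2 (real n) + 1)" .
  qed (use assms in auto)
  finally show "(\<Sum>m\<in>{1..<Suc n}. mangoldt m) - chebyshev_theta n \<le> (sqrt (real n) + 1) * (log 2 (real n) + 1) * ln (real n)"
    using eq by linarith
qed

theorem chebyshev_theta_asymp: "(\<lambda>n. chebyshev_theta n / real n) \<longlonglongrightarrow> 1"
proof -
  define S where "S = (\<lambda>n. (\<Sum>m\<in>{1..<n}. mangoldt m :: real))"
  have "(\<lambda>n. S (Suc n) / real (Suc n)) \<longlonglongrightarrow> 1"
    using LIMSEQ_Suc[OF sum_mangoldt_asymp] by (simp only: S_def)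
  moreover have "(\<lambda>n. real (Suc n) / real n) \<longlonglongrightarrow> 1" by real_asymp
  ultimately have "(\<lambda>n. S (Suc n) / real (Suc n) * (real (Suc n) / real n)) \<longlonglongrightarrow> 1 * 1"
    by (rule tendsto_mult)
  hence up: "(\<lambda>n. S (Suc n) / real n) \<longlonglongrightarrow> 1" by simp
  have "(\<lambda>n. (sqrt (real n) + 1) * (log 2 (real n) + 1) * ln (real n) / real n) \<longlonglongrightarrow> 0"
    by real_asymp
  from tendsto_diff[OF up this]
  have lo: "(\<lambda>n. S (Suc n) / real n - (sqrt (real n) + 1) * (log 2 (real n) + 1) * ln (real n) / real n) \<longlonglongrightarrow> 1"
    by simp
  show ?thesis
  proof (rule tendsto_sandwich[OF _ _ lo up])
    show "\<forall>\<^sub>F n in sequentially. chebyshev_theta n / real n \<le> S (Suc n) / real n"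
      using eventually_ge_at_top[of 1]
    proof eventually_elim
      case (elim n)
      show ?case using chebyshev_theta_diff(1)[OF elim] by (intro divide_right_mono) (auto simp: S_def)
    qed
    show "\<forall>\<^sub>F n in sequentially. S (Suc n) / real n - (sqrt (real n) + 1) * (log 2 (real n) + 1) * ln (real n) / real n
        \<le> chebyshev_theta n / real n"
      using eventually_ge_at_top[of 1]
    proof eventually_elim
      case (elim n)
      show ?case unfolding diff_divide_distrib[symmetric]
        using chebyshev_theta_diff(2)[OF elim] by (intro divide_right_mono) (auto simp: S_def)
    qed
  qed
qed

lemma chebyshev_theta_nonneg: "chebyshev_theta n \<ge> 0"
  unfolding chebyshev_theta_def by (intro sum_nonneg) (auto dest: prime_gt_0_nat)

text \<open>The additive constant makes the bound valid for every \<open>n\<close>: partial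
  summation uses it at all lengths up to \<open>Y\<close>, not only at large ones.\<close>

lemma chebyshev_theta_upper:
  assumes "e > 0"
  obtains C where "C \<ge> 0" "\<And>n. chebyshev_theta n \<le> (1 + e) * real n + C"
proof -
  have "\<forall>\<^sub>F n in sequentially. chebyshev_theta n / real n < 1 + e"
    using chebyshev_theta_asymp assms by (intro order_tendstoD(2)) auto
  then obtain N where N: "\<And>n. n \<ge> N \<Longrightarrow> chebyshev_theta n / real n < 1 + e"
    by (auto simp: eventually_at_top_linorder)
  define C where "C = (\<Sum>n\<le>N. chebyshev_theta n)"
  show ?thesis
  proof (rule that[of C])
    show "C \<ge> 0" unfolding C_def by (intro sum_nonneg chebyshev_theta_nonneg)
    fix n
    show "chebyshev_theta n \<le> (1 + e) * real n + C"
    proof (cases "n \<le> N")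
      case True
      have "chebyshev_theta n \<le> C"
        unfolding C_def using True by (intro member_le_sum) (auto simp: chebyshev_theta_nonneg)
      thus ?thesis using assms by (smt (verit) mult_nonneg_nonneg of_nat_0_le_iff)
    next
      case False
      hence "chebyshev_theta n / real n < 1 + e" "n > 0" using N[of n] by auto
      thus ?thesis using \<open>C \<ge> 0\<close> by (simp add: divide_less_eq)
    qed
  qed
qed

lemma chebyshev_theta_lower:
  assumes "e > 0"
  obtains C where "C \<ge> 0" "\<And>n. chebyshev_theta n \<ge> (1 - e) * real n - C"
proof -
  have "\<forall>\<^sub>F n in sequentially. chebyshev_theta n / real n > 1 - e"
    using chebyshev_theta_asymp assms by (intro order_tendstoD(1)) auto
  then obtain N where N: "\<And>n. n \<ge> N \<Longrightarrow> chebyshev_theta n / real n > 1 - e"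
    by (auto simp: eventually_at_top_linorder)
  show ?thesis
  proof (rule that[of "real N"])
    fix n
    show "chebyshev_theta n \<ge> (1 - e) * real n - real N"
    proof (cases "n \<le> N")
      case True
      have "(1 - e) * real n \<le> 1 * real n" using assms by (intro mult_right_mono) auto
      thus ?thesis using True chebyshev_theta_nonneg[of n] by linarith
    next
      case False
      hence "chebyshev_theta n / real n > 1 - e" "n > 0" using N[of n] by auto
      thus ?thesis by (simp add: less_divide_eq)
    qed
  qed simp
qed

section \<open>Sums over primes\<close>

text \<open>Partial summation as an inequality: against nonnegative decreasing weights, an error
  \<open>d\<close> in the partial sums is multiplied by at most \<open>w 1\<close>, the total
  variation plus the final weight.\<close>

lemma abel_comparison_upper:
  fixes a w :: "nat \<Rightarrow> real"
  assumes A: "\<And>m. m \<in> {1..Y} \<Longrightarrow> (\<Sum>n=1..m. a n) \<le> c * real m + d"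
    and mono: "\<And>n. n \<in> {1..<Y} \<Longrightarrow> w (Suc n) \<le> w n"
    and w: "w Y \<ge> 0" and Y: "Y \<ge> 1"
  shows "(\<Sum>n=1..Y. a n * w n) \<le> c * (\<Sum>n=1..Y. w n) + d * w 1"
proof -
  define b where "b = (\<lambda>n. a n - c)"
  have B: "(\<Sum>n=1..m. b n) \<le> d" if "m \<in> {1..Y}" for m
    using A[OF that] by (simp add: b_def sum_subtractf mult.commute)
  \<comment> \<open>The induction keeps the boundary term of partial summation explicit; each step
    then needs only that the slack in \<open>B\<close> times the decrement of \<open>w\<close> is
    nonnegative.\<close>
  have "(\<Sum>n=1..m. b n * w n) \<le> d * (w 1 - w m) + (\<Sum>n=1..m. b n) * w m" if "1 \<le> m" "m \<le> Y" for m
    using that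
  proof (induction m rule: dec_induct)
    case (step m)
    have "(d - (\<Sum>n=1..m. b n)) * (w m - w (Suc m)) \<ge> 0"
      using B[of m] mono[of m] step by (intro mult_nonneg_nonneg) auto
    moreover have "(\<Sum>n=1..m. b n * w n) \<le> d * (w 1 - w m) + (\<Sum>n=1..m. b n) * w m"
      using step by auto
    ultimately show ?case by (simp add: algebra_simps)
  qed auto
  from this[of Y] Y have "(\<Sum>n=1..Y. b n * w n) \<le> d * (w 1 - w Y) + (\<Sum>n=1..Y. b n) * w Y" by simp
  also have "(\<Sum>n=1..Y. b n) * w Y \<le> d * w Y"
    using B[of Y] Y w by (intro mult_right_mono) auto
  finally have "(\<Sum>n=1..Y. b n * w n) \<le> d * w 1" by (simp add: algebra_simps)
  moreover have "(\<Sum>n=1..Y. b n * w n) = (\<Sum>n=1..Y. a n * w n) - c * (\<Sum>n=1..Y. w n)"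
    by (simp add: b_def left_diff_distrib sum_subtractf sum_distrib_left)
  ultimately show ?thesis by linarith
qed

lemma abel_comparison_lower:
  fixes a w :: "nat \<Rightarrow> real"
  assumes A: "\<And>m. m \<in> {1..Y} \<Longrightarrow> (\<Sum>n=1..m. a n) \<ge> c * real m - d"
    and mono: "\<And>n. n \<in> {1..<Y} \<Longrightarrow> w (Suc n) \<le> w n"
    and w: "w Y \<ge> 0" and Y: "Y \<ge> 1"
  shows "(\<Sum>n=1..Y. a n * w n) \<ge> c * (\<Sum>n=1..Y. w n) - d * w 1"
proof -
  have "(\<Sum>n=1..Y. (- a n) * w n) \<le> (- c) * (\<Sum>n=1..Y. w n) + d * w 1"
  proof (rule abel_comparison_upper[OF _ mono w Y])
    show "(\<Sum>n=1..m. - a n) \<le> - c * real m + d" if "m \<in> {1..Y}" for m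
      using A[OF that] by (simp add: sum_negf)
  qed
  thus ?thesis by (simp add: sum_negf)
qed

text \<open>Each \<open>g (n / Y)\<close> is at most the mean of \<open>g\<close> over the cell
  ending there. A primitive and the mean value theorem replace the integral, since \<open>g\<close>
  may be unbounded near 0.\<close>

lemma antimono_sum_le_antiderivative:
  fixes g G :: "real \<Rightarrow> real"
  assumes cont: "continuous_on {0..1} G"
    and deriv: "\<And>x. 0 < x \<Longrightarrow> x < 1 \<Longrightarrow> (G has_real_derivative g x) (at x)"
    and mono: "\<And>x y. 0 < x \<Longrightarrow> x \<le> y \<Longrightarrow> y \<le> 1 \<Longrightarrow> g y \<le> g x"
    and Y: "Y \<ge> 1"
  shows "(\<Sum>n=1..Y. g (real n / real Y)) \<le> real Y * (G 1 - G 0)"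
proof -
  have Y0: "real Y > 0" using Y by simp
  have step: "g (real (Suc n) / real Y) \<le> real Y * (G (real (Suc n) / real Y) - G (real n / real Y))" if "n < Y" for n
  proof -
    let ?x = "real n / real Y" and ?y = "real (Suc n) / real Y"
    have xy: "?x < ?y" "0 \<le> ?x" "?y \<le> 1" using that Y0 by (auto simp: divide_strict_right_mono)
    obtain z where z: "?x < z" "z < ?y" "G ?y - G ?x = (?y - ?x) * g z"
    proof -
      have "\<exists>l z. ?x < z \<and> z < ?y \<and> DERIV G z :> l \<and> G ?y - G ?x = (?y - ?x) * l"
      proof (rule MVT[OF xy(1)])
        show "continuous_on {?x..?y} G" by (rule continuous_on_subset[OF cont]) (use xy in auto)
        show "G differentiable (at z)" if "?x < z" "z < ?y" for z
          using deriv[of z] that xy by (auto simp: real_differentiable_def)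
      qed
      then obtain l z where "?x < z" "z < ?y" "DERIV G z :> l" "G ?y - G ?x = (?y - ?x) * l" by blast
      moreover from this have "DERIV G z :> g z" using xy by (intro deriv) linarith+
      ultimately show ?thesis using that DERIV_unique by metis
    qed
    have "g ?y \<le> g z" using z(1,2) xy by (intro mono) linarith+
    also have "g z = real Y * (G ?y - G ?x)"
      unfolding z(3) using Y0 by (simp add: field_simps)
    finally show ?thesis .
  qed
  have "(\<Sum>n=1..Y. g (real n / real Y)) = (\<Sum>n<Y. g (real (Suc n) / real Y))"
    by (rule sum.reindex_bij_witness[of _ Suc "\<lambda>n. n - 1"]) auto
  also have "\<dots> \<le> (\<Sum>n<Y. real Y * (G (real (Suc n) / real Y) - G (real n / real Y)))"
    by (intro sum_mono step) auto
  also have "\<dots> = real Y * (G (real Y / real Y) - G (real 0 / real Y))"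
    unfolding sum_distrib_left[symmetric] by (subst sum_lessThan_telescope) simp
  finally show ?thesis using Y0 by simp
qed

text \<open>Here \<open>g (n / Y)\<close> dominates the mean over the cell to its right, so the
  first cell is lost and the primitive starts at \<open>1 / Y\<close>.\<close>

lemma antimono_sum_ge_antiderivative:
  fixes g G :: "real \<Rightarrow> real"
  assumes cont: "continuous_on {0..1} G"
    and deriv: "\<And>x. 0 < x \<Longrightarrow> x < 1 \<Longrightarrow> (G has_real_derivative g x) (at x)"
    and mono: "\<And>x y. 0 < x \<Longrightarrow> x \<le> y \<Longrightarrow> y \<le> 1 \<Longrightarrow> g y \<le> g x"
    and nonneg: "g 1 \<ge> 0" and Y: "Y \<ge> 1"
  shows "(\<Sum>n=1..Y. g (real n / real Y)) \<ge> real Y * (G 1 - G (1 / real Y))"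
proof -
  have Y0: "real Y > 0" using Y by simp
  have step: "g (real n / real Y) \<ge> real Y * (G (real (Suc n) / real Y) - G (real n / real Y))" if "1 \<le> n" "n < Y" for n
  proof -
    let ?x = "real n / real Y" and ?y = "real (Suc n) / real Y"
    have xy: "?x < ?y" "0 < ?x" "?y \<le> 1" using that Y0 by (auto simp: divide_strict_right_mono)
    obtain z where z: "?x < z" "z < ?y" "G ?y - G ?x = (?y - ?x) * g z"
    proof -
      have "\<exists>l z. ?x < z \<and> z < ?y \<and> DERIV G z :> l \<and> G ?y - G ?x = (?y - ?x) * l"
      proof (rule MVT[OF xy(1)])
        show "continuous_on {?x..?y} G" by (rule continuous_on_subset[OF cont]) (use xy in auto)
        show "G differentiable (at z)" if "?x < z" "z < ?y" for z
          using deriv[of z] that xy by (auto simp: real_differentiable_def)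
      qed
      then obtain l z where "?x < z" "z < ?y" "DERIV G z :> l" "G ?y - G ?x = (?y - ?x) * l" by blast
      moreover from this have "DERIV G z :> g z" using xy by (intro deriv) linarith+
      ultimately show ?thesis using that DERIV_unique by metis
    qed
    have "g z \<le> g ?x" using z xy by (intro mono) auto
    moreover have "g z = real Y * (G ?y - G ?x)"
      unfolding z(3) using Y0 by (simp add: field_simps)
    ultimately show ?thesis by simp
  qed
  have "real Y * (G 1 - G (1 / real Y)) = real Y * (\<Sum>n=1..<Y. G (real (Suc n) / real Y) - G (real n / real Y))"
    using Y Y0 by (subst sum_Suc_diff') auto
  also have "\<dots> \<le> (\<Sum>n=1..<Y. g (real n / real Y))"
    unfolding sum_distrib_left by (intro sum_mono step) auto
  also have "\<dots> \<le> (\<Sum>n=1..<Y. g (real n / real Y)) + g (real Y / real Y)"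
    using nonneg Y0 by simp
  also have "\<dots> = (\<Sum>n=1..Y. g (real n / real Y))"
    using Y by (simp add: sum.last_plus atLeastLessThanSuc_atLeastAtMost[symmetric])
  finally show ?thesis .
qed

text \<open>After adding 1 and multiplying by \<open>x\<close>, both sides become
  \<open>1 - (1 - x) ^ (l + 1)\<close>. The expansion is the source of the binomial coefficients in
  \<open>S_const\<close>.\<close>

lemma geometric_binomial:
  fixes x :: real
  assumes "x \<noteq> 0"
  shows "(\<Sum>j=1..l. (1 - x) ^ j) = real l + (\<Sum>m=1..l. (-1) ^ m * real ((l + 1) choose (m + 1)) * x ^ m)"
proof -
  have "(1 - x) ^ (l + 1) = (\<Sum>k\<le>l + 1. real ((l + 1) choose k) * (- x) ^ k)"
    using binomial_ring[of "- x" 1 "l + 1"] by simp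
  also have "\<dots> = 1 + (\<Sum>k\<le>l. real ((l + 1) choose (k + 1)) * (- x) ^ (k + 1))"
    by (subst Suc_eq_plus1[symmetric], subst sum.atMost_Suc_shift) simp
  also have "(\<Sum>k\<le>l. real ((l + 1) choose (k + 1)) * (- x) ^ (k + 1)) =
      - x * (\<Sum>m\<le>l. (-1) ^ m * real ((l + 1) choose (m + 1)) * x ^ m)"
    unfolding sum_distrib_left by (intro sum.cong refl) (simp add: power_minus[of x] mult_ac)
  finally have 1: "1 - (1 - x) ^ (l + 1) = x * (\<Sum>m\<le>l. (-1) ^ m * real ((l + 1) choose (m + 1)) * x ^ m)"
    by simp
  have "x * (\<Sum>j\<le>l. (1 - x) ^ j) = 1 - (1 - x) ^ (l + 1)"
    using one_diff_power_eq'[of "1 - x" "l + 1"] sum_gp_basic[of "1 - x" l] by simp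
  with 1 assms have "(\<Sum>j\<le>l. (1 - x) ^ j) = (\<Sum>m\<le>l. (-1) ^ m * real ((l + 1) choose (m + 1)) * x ^ m)"
    by simp
  moreover have "{..l} = insert 0 {1..l}" by auto
  ultimately show ?thesis by simp
qed

lemma finite_primes_le: "finite {p::nat. prime p \<and> p \<le> n}"
  by (rule finite_subset[of _ "{..n}"]) auto

lemma sum_over_primes:
  fixes f :: "nat \<Rightarrow> real"
  shows "(\<Sum>p | prime p \<and> p \<le> n. f p) = (\<Sum>k=1..n. (if prime k then f k else 0))"
proof -
  have "(\<Sum>k=1..n. (if prime k then f k else 0)) = (\<Sum>k\<in>{1..n} \<inter> {k. prime k}. f k)"
    by (simp add: sum.inter_restrict)
  also have "{1..n} \<inter> {k. prime k} = {p. prime p \<and> p \<le> n}"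
    by (auto simp: Suc_le_eq prime_gt_0_nat)
  finally show ?thesis ..
qed

text \<open>Primes up to \<open>Y powr (1 - \<eta>)\<close> are counted trivially; every larger one
  has weight at least \<open>(1 - \<eta>) * ln Y\<close> in \<open>chebyshev_theta m\<close>. Using
  \<open>ln Y\<close> instead of \<open>ln m\<close> leaves a bound linear in \<open>m\<close>, as
  \<open>abel_comparison_upper\<close> requires.\<close>

lemma prime_count_le:
  fixes \<eta> :: real
  assumes \<eta>: "0 < \<eta>" "\<eta> < 1" and Y: "Y \<ge> 2" and "m \<le> Y"
  shows "real (card {p. prime p \<and> p \<le> m}) \<le> real Y powr (1 - \<eta>) + chebyshev_theta m / ((1 - \<eta>) * ln (real Y))"
proof -
  let ?A = "{p. prime p \<and> p \<le> m}" and ?B = "{p. prime p \<and> p \<le> m \<and> real p \<le> real Y powr (1 - \<eta>)}"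
  let ?D = "{p. prime p \<and> p \<le> m \<and> real p > real Y powr (1 - \<eta>)}"
  have fin: "finite ?A" by (rule finite_primes_le)
  have fB: "finite ?B" "finite ?D" by (auto intro: finite_subset[OF _ fin])
  have lY: "ln (real Y) > 0" using Y by simp
  have "card ?B \<le> card {1..nat \<lfloor>real Y powr (1 - \<eta>)\<rfloor>}"
    by (intro card_mono) (auto simp: le_nat_floor Suc_le_eq prime_gt_0_nat)
  hence "real (card ?B) \<le> real (nat \<lfloor>real Y powr (1 - \<eta>)\<rfloor>)"
    by (subst of_nat_le_iff) simp
  also have "\<dots> \<le> real Y powr (1 - \<eta>)" by (intro of_nat_floor) simp
  finally have "real (card ?B) \<le> real Y powr (1 - \<eta>)" .
  moreover have "real (card ?D) \<le> chebyshev_theta m / ((1 - \<eta>) * ln (real Y))"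
  proof -
    have "real (card ?D) * ((1 - \<eta>) * ln (real Y)) = (\<Sum>p\<in>?D. (1 - \<eta>) * ln (real Y))" by simp
    also have "\<dots> \<le> (\<Sum>p\<in>?D. ln (real p))"
    proof (rule sum_mono)
      fix p assume "p \<in> ?D"
      hence "ln (real Y powr (1 - \<eta>)) \<le> ln (real p)" using Y
        by (subst ln_le_cancel_iff) (auto simp: prime_gt_0_nat)
      thus "(1 - \<eta>) * ln (real Y) \<le> ln (real p)" using Y by (simp add: ln_powr)
    qed
    also have "\<dots> \<le> chebyshev_theta m"
      unfolding chebyshev_theta_def by (rule sum_mono2[OF fin]) (auto dest: prime_gt_0_nat)
    finally show ?thesis using \<eta> lY by (simp add: pos_le_divide_eq)
  qed
  moreover have "?A = ?B \<union> ?D" by auto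
  hence "card ?A = card ?B + card ?D" using fB by (simp only:) (rule card_Un_disjoint, auto)
  ultimately show ?thesis by simp
qed

section \<open>The cost and gain densities over the primes\<close>

text \<open>Equal to \<open>ln ((1 + r) / (1 - r))\<close> for
  \<open>r = 1 - u powr \<sigma>\<close>: what the prime \<open>p = u * Y\<close> contributes to the
  logarithm of the ratio of \<open>(suminf r)\<^sup>2\<close> to the sum of squares.\<close>

definition height_density :: "real \<Rightarrow> real \<Rightarrow> real" where
  "height_density \<sigma> u = ln (2 * u powr (-\<sigma>) - 1)"

text \<open>Scaled so that \<open>Y powr (-\<sigma>) * gain_density \<sigma> l (p / Y)\<close> is
  the share of the prime \<open>p\<close> in the exponent of \<open>euler_lower\<close>.\<close>

definition gain_density :: "real \<Rightarrow> nat \<Rightarrow> real \<Rightarrow> real" where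
  "gain_density \<sigma> l u = u powr (-\<sigma>) * (\<Sum>j=1..l. (1 - u powr \<sigma>) ^ j)"

context
  fixes \<sigma> :: real
  assumes \<sigma>: "0 < \<sigma>" "\<sigma> < 1"
begin

lemma powr_ge_1: "0 < u \<Longrightarrow> u \<le> 1 \<Longrightarrow> u powr (-\<sigma>) \<ge> 1"
  using powr_mono'[of "-\<sigma>" 0 u] \<sigma> by simp

lemma powr_le_1': "0 \<le> u \<Longrightarrow> u \<le> 1 \<Longrightarrow> u powr \<sigma> \<le> 1"
  using powr_le1[of \<sigma> u] \<sigma> by simp

lemma height_density_mono:
  assumes "0 < x" "x \<le> y" "y \<le> 1"
  shows "height_density \<sigma> y \<le> height_density \<sigma> x"
proof -
  have "y powr (-\<sigma>) \<le> x powr (-\<sigma>)" using assms \<sigma> by (intro powr_mono2') auto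
  thus ?thesis using powr_ge_1[of y] assms unfolding height_density_def by (subst ln_le_cancel_iff) auto
qed

lemma height_density_nonneg: "0 < u \<Longrightarrow> u \<le> 1 \<Longrightarrow> height_density \<sigma> u \<ge> 0"
  using powr_ge_1[of u] unfolding height_density_def by (intro ln_ge_zero) auto

text \<open>The integrand of \<^const>\<open>c_const\<close> has the junk value \<open>-1\<close> at \<open>0\<close>, whereas this one is
  continuous on the closed interval.\<close>

lemma c_const_eq: "c_const \<sigma> = integral {0..1} (\<lambda>t. t powr \<sigma> / (2 - t powr \<sigma>))"
  unfolding c_const_def
proof (rule integral_spike[of "{0}"])
  fix t :: real assume "t \<in> {0..1} - {0}"
  hence t: "0 < t" "t \<le> 1" by auto
  have "t powr \<sigma> \<noteq> 0" "t powr \<sigma> \<le> 1" using t powr_le_1' by auto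
  thus "t powr \<sigma> / (2 - t powr \<sigma>) = 1 / (2 * t powr (-\<sigma>) - 1)"
    using t by (simp add: powr_minus divide_simps)
qed auto

text \<open>A primitive of \<open>ln (2 - u powr \<sigma>) - \<sigma> * ln u\<close>. Integrating
  the first logarithm by parts produces the remaining integral, which at \<open>u = 1\<close> is
  \<open>c_const\<close>.\<close>

definition height_primitive :: "real \<Rightarrow> real" where
  "height_primitive u = u * ln (2 - u powr \<sigma>) - \<sigma> * (u * ln u) + \<sigma> * u
     + \<sigma> * integral {0..u} (\<lambda>t. t powr \<sigma> / (2 - t powr \<sigma>))"

lemma c_integrand_cont: "continuous_on {0..1} (\<lambda>t. t powr \<sigma> / (2 - t powr \<sigma>))"
proof -
  have "2 - t powr \<sigma> \<noteq> 0" if "t \<in> {0..1}" for t using powr_le_1'[of t] that by auto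
  thus ?thesis using \<sigma> by (intro continuous_intros continuous_on_powr') auto
qed

lemma height_primitive_0: "height_primitive 0 = 0"
  by (simp add: height_primitive_def)

lemma height_primitive_1: "height_primitive 1 = \<sigma> * (1 + c_const \<sigma>)"
  by (simp add: height_primitive_def c_const_eq algebra_simps)

lemma height_primitive_cont: "continuous_on {0..1} height_primitive"
proof -
  have 1: "continuous_on {0..1} (\<lambda>u. integral {0..u} (\<lambda>t. t powr \<sigma> / (2 - t powr \<sigma>)))"
    by (intro indefinite_integral_continuous_1 integrable_continuous_real c_integrand_cont)
  have 2: "continuous_on {0..1} (\<lambda>u::real. u * ln u)"
    unfolding continuous_on_eq_continuous_within
  proof
    fix x :: real assume x: "x \<in> {0..1}"
    show "continuous (at x within {0..1}) (\<lambda>u. u * ln u)"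
    proof (cases "x = 0")
      case True
      have "((\<lambda>u::real. u * ln u) \<longlongrightarrow> 0) (at_right 0)" by real_asymp
      thus ?thesis using True by (simp add: continuous_within at_within_Icc_at_right)
    next
      case False
      thus ?thesis using x by (intro continuous_intros) auto
    qed
  qed
  have 3: "2 - u powr \<sigma> > 0" if "u \<in> {0..1}" for u using powr_le_1'[of u] that by auto
  have "continuous_on {0..1} (\<lambda>u. u powr \<sigma>)" using \<sigma> by (intro continuous_on_powr' continuous_intros) auto
  hence 4: "continuous_on {0..1} (\<lambda>u. ln (2 - u powr \<sigma>))"
    using 3 by (intro continuous_on_ln continuous_on_diff continuous_on_const) force+
  show ?thesis
    unfolding height_primitive_def[abs_def]
    by (rule 1 2 4 continuous_on_id continuous_on_const | rule continuous_on_add continuous_on_diff continuous_on_mult)+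
qed

lemma height_primitive_deriv:
  assumes "0 < x" "x < 1"
  shows "(height_primitive has_real_derivative height_density \<sigma> x) (at x)"
proof -
  have "((\<lambda>u. integral {0..u} (\<lambda>t. t powr \<sigma> / (2 - t powr \<sigma>))) has_real_derivative
      x powr \<sigma> / (2 - x powr \<sigma>)) (at x within {0..1})"
    by (rule integral_has_real_derivative[OF c_integrand_cont]) (use assms in auto)
  hence 1: "((\<lambda>u. integral {0..u} (\<lambda>t. t powr \<sigma> / (2 - t powr \<sigma>))) has_real_derivative
      x powr \<sigma> / (2 - x powr \<sigma>)) (at x)"
    using assms at_within_Icc_at[of 0 x 1] by simp
  define y where "y = x powr \<sigma>"
  have y: "0 < y" "y \<le> 1" using powr_le_1'[of x] assms by (auto simp: y_def)
  have x1: "x powr (\<sigma> - 1) = y / x" using assms by (simp add: y_def powr_diff)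
  have "(height_primitive has_real_derivative
     ln (2 - y) + x * (- (\<sigma> * (y / x)) / (2 - y)) - \<sigma> * (ln x + 1) + \<sigma> + \<sigma> * (y / (2 - y))) (at x)"
    unfolding height_primitive_def[abs_def]
    by (rule derivative_eq_intros refl 1 | (use assms y in \<open>simp add: x1 flip: y_def; fail\<close>))+
       (use assms y in \<open>simp add: field_simps x1 flip: y_def\<close>)?
  also have "ln (2 - y) + x * (- (\<sigma> * (y / x)) / (2 - y)) - \<sigma> * (ln x + 1) + \<sigma> + \<sigma> * (y / (2 - y)) =
      ln (2 - y) - \<sigma> * ln x"
  proof -
    have "x * (- (\<sigma> * (y / x)) / (2 - y)) = - (\<sigma> * (y / (2 - y)))" using assms by simp
    thus ?thesis by (simp add: algebra_simps)
  qed
  also have "\<dots> = ln ((2 - y) / y)" using y assms by (simp add: ln_div y_def ln_powr)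
  also have "(2 - y) / y = 2 * x powr (-\<sigma>) - 1"
    using y by (simp add: y_def powr_minus field_simps)
  finally show ?thesis by (simp add: height_density_def)
qed

lemma sum_height_density:
  assumes "Y \<ge> 1"
  shows "(\<Sum>n=1..Y. height_density \<sigma> (real n / real Y)) \<le> real Y * (\<sigma> * (1 + c_const \<sigma>))"
  using antimono_sum_le_antiderivative[OF height_primitive_cont height_primitive_deriv height_density_mono assms]
  by (simp add: height_primitive_0 height_primitive_1)

lemma gain_density_mono:
  assumes "0 < x" "x \<le> y" "y \<le> 1"
  shows "gain_density \<sigma> l y \<le> gain_density \<sigma> l x"
  unfolding gain_density_def
proof (intro mult_mono sum_mono power_mono)
  show "y powr (-\<sigma>) \<le> x powr (-\<sigma>)" using assms \<sigma> by (intro powr_mono2') auto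
  show "1 - y powr \<sigma> \<le> 1 - x powr \<sigma>" using assms \<sigma> by (simp add: powr_mono2)
qed (use assms powr_le_1'[of y] in \<open>auto intro!: sum_nonneg\<close>)

lemma gain_density_nonneg: "0 \<le> u \<Longrightarrow> u \<le> 1 \<Longrightarrow> gain_density \<sigma> l u \<ge> 0"
  using powr_le_1'[of u] unfolding gain_density_def
  by (intro mult_nonneg_nonneg sum_nonneg zero_le_power) auto

lemma gain_density_le:
  assumes "0 < u" "u \<le> 1"
  shows "gain_density \<sigma> l u \<le> real l * u powr (-\<sigma>)"
proof -
  have "(\<Sum>j=1..l. (1 - u powr \<sigma>) ^ j) \<le> (\<Sum>j=1..l. 1)"
    using powr_le_1'[of u] assms by (intro sum_mono power_le_one) auto
  hence "u powr (-\<sigma>) * (\<Sum>j=1..l. (1 - u powr \<sigma>) ^ j) \<le> u powr (-\<sigma>) * (\<Sum>j=1..l. 1)"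
    by (intro mult_left_mono) auto
  thus ?thesis unfolding gain_density_def by (simp add: mult.commute)
qed

text \<open>The termwise primitive of \<open>gain_density\<close> expanded by
  \<open>geometric_binomial\<close>, written so that its value at 1 is \<open>S_const\<close>
  literally.\<close>

definition gain_primitive :: "nat \<Rightarrow> real \<Rightarrow> real" where
  "gain_primitive l u = real l * u powr (1 - \<sigma>) / (1 - \<sigma>)
     + (\<Sum>m=1..l. (-1) ^ m * real ((l + 1) choose (m + 1)) * u powr (1 + \<sigma> * (real m - 1)) / (1 + \<sigma> * (real m - 1)))"

lemma exponent_pos: "m \<ge> 1 \<Longrightarrow> 1 + \<sigma> * (real m - 1) > 0"
  using \<sigma> by (intro add_pos_nonneg mult_nonneg_nonneg) auto

lemma gain_primitive_0: "gain_primitive l 0 = 0"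
  using \<sigma> by (simp add: gain_primitive_def)

lemma gain_primitive_1: "gain_primitive l 1 = S_const \<sigma> l"
  by (simp add: gain_primitive_def S_const_def)

lemma gain_primitive_cont: "continuous_on {0..1} (gain_primitive l)"
proof -
  have c: "continuous_on {0..1} (\<lambda>u::real. u powr a)" if "a > 0" for a
    using that by (intro continuous_on_powr' continuous_intros) auto
  have t: "continuous_on {0..1} (\<lambda>u::real. K * u powr a / b)" if "a > 0" for K a b
    using continuous_on_mult[OF continuous_on_const[of _ "K / b"] c[OF that]] by simp
  show ?thesis unfolding gain_primitive_def[abs_def]
    by (intro continuous_on_add continuous_on_sum t exponent_pos) (use \<sigma> in auto)
qed

lemma gain_primitive_deriv:
  assumes "0 < x"
  shows "(gain_primitive l has_real_derivative gain_density \<sigma> l x) (at x)"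
proof -
  have p: "((\<lambda>u. u powr a / a) has_real_derivative x powr (a - 1)) (at x)" if "a > 0" for a
    using assms that by (auto intro!: derivative_eq_intros)
  have "(gain_primitive l has_real_derivative (real l * x powr (1 - \<sigma> - 1)
     + (\<Sum>m=1..l. (-1) ^ m * real ((l + 1) choose (m + 1)) * x powr (1 + \<sigma> * (real m - 1) - 1)))) (at x)"
    unfolding gain_primitive_def[abs_def] times_divide_eq_right[symmetric]
    by (intro DERIV_add DERIV_cmult DERIV_sum p exponent_pos) (use \<sigma> in auto)
  also have "real l * x powr (1 - \<sigma> - 1)
     + (\<Sum>m=1..l. (-1) ^ m * real ((l + 1) choose (m + 1)) * x powr (1 + \<sigma> * (real m - 1) - 1)) =
     x powr (-\<sigma>) * (real l + (\<Sum>m=1..l. (-1) ^ m * real ((l + 1) choose (m + 1)) * (x powr \<sigma>) ^ m))"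
  proof -
    have e: "x powr (1 + \<sigma> * (real m - 1) - 1) = x powr (-\<sigma>) * (x powr \<sigma>) ^ m" for m
    proof -
      have "x powr (1 + \<sigma> * (real m - 1) - 1) = x powr (-\<sigma> + \<sigma> * real m)" by (simp add: algebra_simps)
      thus ?thesis using assms by (simp only: powr_add powr_powr[symmetric]) (simp add: powr_realpow)
    qed
    show ?thesis unfolding e distrib_left sum_distrib_left by (simp add: mult_ac)
  qed
  also have "\<dots> = gain_density \<sigma> l x"
    unfolding gain_density_def using geometric_binomial[of "x powr \<sigma>" l] assms by simp
  finally show ?thesis .
qed

text \<open>The sign is invisible in the alternating sum; it follows because the constant is the
  integral of a density positive on the open interval.\<close>

lemma S_const_pos:
  assumes "l \<ge> 1"
  shows "S_const \<sigma> l > 0"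
proof -
  have "gain_primitive l 0 < gain_primitive l 1"
  proof (rule DERIV_pos_imp_increasing_open[OF _ _ gain_primitive_cont])
    fix x :: real assume x: "0 < x" "x < 1"
    have "x powr \<sigma> < 1" using powr_less_mono2[of \<sigma> x 1] x \<sigma> by simp
    hence "gain_density \<sigma> l x > 0"
      unfolding gain_density_def using x assms by (intro mult_pos_pos sum_pos) auto
    thus "\<exists>y. DERIV (gain_primitive l) x :> y \<and> y > 0" using gain_primitive_deriv x by blast
  qed auto
  thus ?thesis by (simp add: gain_primitive_0 gain_primitive_1)
qed

lemma sum_gain_density:
  assumes "Y \<ge> 1"
  shows "(\<Sum>n=1..Y. gain_density \<sigma> l (real n / real Y)) \<ge> real Y * (S_const \<sigma> l - gain_primitive l (1 / real Y))"
  using antimono_sum_ge_antiderivative[OF gain_primitive_cont gain_primitive_deriv gain_density_mono gain_density_nonneg assms, of l]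
  by (simp add: gain_primitive_1)

lemma prime_sum_height:
  assumes "e > 0"
  shows "\<forall>\<^sub>F Y in sequentially. (\<Sum>p | prime p \<and> p \<le> Y. height_density \<sigma> (real p / real Y)) \<le>
     (\<sigma> * (1 + c_const \<sigma>) + e) * real Y / ln (real Y)"
proof -
  define I where "I = \<sigma> * (1 + c_const \<sigma>)"
  \<comment> \<open>The parameter \<eta> is spent twice: on the error in
    \<open>chebyshev_theta\<close> and on replacing \<open>ln p\<close> by
    \<open>(1 - \<eta>) * ln Y\<close>.\<close>
  have "((\<lambda>\<eta>. (1 + \<eta>) / (1 - \<eta>) * I) \<longlongrightarrow> (1 + 0) / (1 - 0) * I) (at_right 0)"
    by (intro tendsto_intros) auto
  hence "\<forall>\<^sub>F \<eta> in at_right 0. (1 + \<eta>) / (1 - \<eta>) * I < I + e"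
    by (rule order_tendstoD) (use assms in auto)
  hence "\<forall>\<^sub>F \<eta> in at_right 0. (1 + \<eta>) / (1 - \<eta>) * I < I + e \<and> \<eta> \<in> {0<..<1}"
    by (intro eventually_conj eventually_at_right_real) auto
  then obtain \<eta> where \<eta>: "(1 + \<eta>) / (1 - \<eta>) * I < I + e" "0 < \<eta>" "\<eta> < 1"
    using eventually_happens[of _ "at_right (0::real)"] by (auto simp: trivial_limit_at_right_real)
  obtain C where C: "C \<ge> 0" "\<And>n. chebyshev_theta n \<le> (1 + \<eta>) * real n + C"
    using chebyshev_theta_upper[OF \<eta>(2)] by blast
  \<comment> \<open>The second summand is the error of partial summation relative to
    \<open>Y / ln Y\<close>. It vanishes, as the error in the prime count is about
    \<open>Y powr (1 - \<eta>)\<close> and the largest weight is only logarithmic.\<close>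
  have "((\<lambda>Y. (1 + \<eta>) / (1 - \<eta>) * I + (real Y powr (1 - \<eta>) + C / ((1 - \<eta>) * ln (real Y))) * ln (2 * real Y) * (ln (real Y) / real Y))
     \<longlongrightarrow> (1 + \<eta>) / (1 - \<eta>) * I + 0) sequentially"
  proof (intro tendsto_intros)
    show "((\<lambda>Y. (real Y powr (1 - \<eta>) + C / ((1 - \<eta>) * ln (real Y))) * ln (2 * real Y) * (ln (real Y) / real Y)) \<longlongrightarrow> 0) sequentially"
      using \<eta>(2,3) by real_asymp
  qed
  hence "\<forall>\<^sub>F Y in sequentially. (1 + \<eta>) / (1 - \<eta>) * I + (real Y powr (1 - \<eta>) + C / ((1 - \<eta>) * ln (real Y))) * ln (2 * real Y) * (ln (real Y) / real Y) < I + e"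
    by (rule order_tendstoD) (use \<eta> in auto)
  thus ?thesis using eventually_ge_at_top[of 2]
  proof eventually_elim
    case (elim Y)
    have Y: "real Y > 0" "ln (real Y) > 0" using elim by auto
    define c where "c = (1 + \<eta>) / ((1 - \<eta>) * ln (real Y))"
    define d where "d = real Y powr (1 - \<eta>) + C / ((1 - \<eta>) * ln (real Y))"
    let ?w = "\<lambda>n. height_density \<sigma> (real n / real Y)"
    have d0: "d \<ge> 0" using C \<eta> Y by (auto simp: d_def)
    have c0: "c \<ge> 0" using \<eta> Y by (auto simp: c_def)
    have "(\<Sum>p | prime p \<and> p \<le> Y. ?w p) = (\<Sum>n=1..Y. (if prime n then 1 else 0) * ?w n)"
      unfolding sum_over_primes by (intro sum.cong) auto
    also have "\<dots> \<le> c * (\<Sum>n=1..Y. ?w n) + d * ?w 1"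
    proof (rule abel_comparison_upper)
      fix m assume m: "m \<in> {1..Y}"
      have "(\<Sum>n=1..m. if prime n then 1 else 0) = real (card {p. prime p \<and> p \<le> m})"
        unfolding sum_over_primes[of "\<lambda>_. 1", symmetric] by simp
      also have "\<dots> \<le> real Y powr (1 - \<eta>) + chebyshev_theta m / ((1 - \<eta>) * ln (real Y))"
        using m elim \<eta> by (intro prime_count_le) auto
      finally have "(\<Sum>n=1..m. if prime n then 1 else 0) \<le> real Y powr (1 - \<eta>) + chebyshev_theta m / ((1 - \<eta>) * ln (real Y))" .
      moreover have "chebyshev_theta m / ((1 - \<eta>) * ln (real Y)) \<le> ((1 + \<eta>) * real m + C) / ((1 - \<eta>) * ln (real Y))"
        using \<eta> Y C(2)[of m] by (intro divide_right_mono) auto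
      moreover have "((1 + \<eta>) * real m + C) / ((1 - \<eta>) * ln (real Y)) = c * real m + C / ((1 - \<eta>) * ln (real Y))"
        unfolding c_def by (subst add_divide_distrib) simp
      ultimately show "(\<Sum>n=1..m. if prime n then 1 else 0) \<le> c * real m + d"
        unfolding d_def by linarith
    next
      fix n assume "n \<in> {1..<Y}"
      thus "?w (Suc n) \<le> ?w n" using Y by (intro height_density_mono) (auto simp: divide_right_mono)
    qed (use Y elim in \<open>auto simp: height_density_nonneg\<close>)
    also have "\<dots> \<le> c * (real Y * I) + d * ln (2 * real Y)"
    proof (intro add_mono mult_left_mono c0 d0)
      show "(\<Sum>n=1..Y. ?w n) \<le> real Y * I" unfolding I_def by (rule sum_height_density) (use elim in auto)
      have "?w 1 = ln (2 * real Y powr \<sigma> - 1)"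
        using Y by (simp add: height_density_def powr_divide powr_minus)
      also have "real Y powr \<sigma> \<le> real Y powr 1" using elim \<sigma> by (intro powr_mono) auto
      hence "ln (2 * real Y powr \<sigma> - 1) \<le> ln (2 * real Y)"
        using powr_ge_1[of "1 / real Y"] elim Y by (subst ln_le_cancel_iff) (auto simp: powr_divide powr_minus)
      finally show "?w 1 \<le> ln (2 * real Y)" .
    qed
    also have "\<dots> = ((1 + \<eta>) / (1 - \<eta>) * I + d * ln (2 * real Y) * (ln (real Y) / real Y)) * real Y / ln (real Y)"
      using Y \<eta> by (simp add: c_def field_simps)
    also have "\<dots> \<le> (I + e) * real Y / ln (real Y)"
      using elim Y by (intro divide_right_mono mult_right_mono) (auto simp: d_def)
    finally show ?case by (simp add: I_def)
  qed
qed

lemma prime_sum_gain: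
  assumes "e > 0"
  shows "\<forall>\<^sub>F Y in sequentially. (\<Sum>p | prime p \<and> p \<le> Y. gain_density \<sigma> l (real p / real Y)) \<ge>
     (S_const \<sigma> l - e) * real Y / ln (real Y)"
proof -
  define S where "S = S_const \<sigma> l"
  have "((\<lambda>\<eta>. (1 - \<eta>) * S) \<longlongrightarrow> (1 - 0) * S) (at_right 0)"
    by (intro tendsto_intros)
  hence "\<forall>\<^sub>F \<eta> in at_right 0. (1 - \<eta>) * S > S - e"
    by (rule order_tendstoD) (use assms in auto)
  hence "\<forall>\<^sub>F \<eta> in at_right 0. (1 - \<eta>) * S > S - e \<and> \<eta> \<in> {0<..<1}"
    by (intro eventually_conj eventually_at_right_real) auto
  then obtain \<eta> where \<eta>: "(1 - \<eta>) * S > S - e" "0 < \<eta>" "\<eta> < 1"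
    using eventually_happens[of _ "at_right (0::real)"] by (auto simp: trivial_limit_at_right_real)
  obtain C where C: "C \<ge> 0" "\<And>n. chebyshev_theta n \<ge> (1 - \<eta>) * real n - C"
    using chebyshev_theta_lower[OF \<eta>(2)] by blast
  \<comment> \<open>Partial summation costs \<open>C\<close> times the largest weight, at most
    \<open>l * Y powr \<sigma>\<close>, which is negligible against \<open>Y\<close> as \<sigma> <
    1.\<close>
  have "((\<lambda>Y. (1 - \<eta>) * (S - gain_primitive l (1 / real Y)) - C * (real l * real Y powr \<sigma>) / real Y)
     \<longlongrightarrow> (1 - \<eta>) * (S - gain_primitive l 0) - 0) sequentially"
  proof (intro tendsto_intros)
    show "((\<lambda>Y. C * (real l * real Y powr \<sigma>) / real Y) \<longlongrightarrow> 0) sequentially"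
      using \<sigma> by real_asymp
    have "(\<lambda>Y. 1 / real Y) \<longlonglongrightarrow> 0" by real_asymp
    thus "((\<lambda>Y. gain_primitive l (1 / real Y)) \<longlongrightarrow> gain_primitive l 0) sequentially"
      by (rule continuous_on_tendsto_compose[OF gain_primitive_cont])
         (auto intro!: eventually_sequentiallyI[of 1])
  qed
  hence "\<forall>\<^sub>F Y in sequentially. (1 - \<eta>) * (S - gain_primitive l (1 / real Y)) - C * (real l * real Y powr \<sigma>) / real Y > S - e"
    by (rule order_tendstoD) (use \<eta> in \<open>auto simp: gain_primitive_0\<close>)
  thus ?thesis using eventually_ge_at_top[of 2]
  proof eventually_elim
    case (elim Y)
    have Y: "real Y > 0" "ln (real Y) > 0" using elim by auto
    let ?w = "\<lambda>n. gain_density \<sigma> l (real n / real Y)"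
    have "(S - e) * real Y \<le> ((1 - \<eta>) * (S - gain_primitive l (1 / real Y)) - C * (real l * real Y powr \<sigma>) / real Y) * real Y"
      using elim Y by (intro mult_right_mono) auto
    also have "\<dots> = (1 - \<eta>) * (real Y * (S - gain_primitive l (1 / real Y))) - C * (real l * real Y powr \<sigma>)"
      using Y by (simp add: field_simps)
    also have "\<dots> \<le> (1 - \<eta>) * (\<Sum>n=1..Y. ?w n) - C * ?w 1"
    proof (intro diff_mono mult_left_mono)
      show "real Y * (S - gain_primitive l (1 / real Y)) \<le> (\<Sum>n=1..Y. ?w n)"
        unfolding S_def by (rule sum_gain_density) (use elim in auto)
      have "?w 1 \<le> real l * (real 1 / real Y) powr (-\<sigma>)" using elim by (intro gain_density_le) auto
      thus "?w 1 \<le> real l * real Y powr \<sigma>" using Y by (simp add: powr_divide powr_minus)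
    qed (use \<eta> C in auto)
    also have "\<dots> \<le> (\<Sum>n=1..Y. (if prime n then ln (real n) else 0) * ?w n)"
    proof (rule abel_comparison_lower)
      show "(\<Sum>n=1..m. if prime n then ln (real n) else 0) \<ge> (1 - \<eta>) * real m - C" for m
        using C(2)[of m] unfolding chebyshev_theta_def sum_over_primes .
    next
      fix n assume "n \<in> {1..<Y}"
      thus "?w (Suc n) \<le> ?w n" using Y by (intro gain_density_mono) (auto simp: divide_right_mono)
    qed (use Y elim in \<open>auto simp: gain_density_nonneg\<close>)
    also have "\<dots> = (\<Sum>p | prime p \<and> p \<le> Y. ln (real p) * ?w p)"
      unfolding sum_over_primes by (intro sum.cong) auto
    \<comment> \<open>For a lower bound \<open>ln p \<le> ln Y\<close> suffices, without the
      splitting of \<open>prime_count_le\<close>.\<close>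
    also have "\<dots> \<le> (\<Sum>p | prime p \<and> p \<le> Y. ln (real Y) * ?w p)"
      using Y by (intro sum_mono mult_right_mono gain_density_nonneg) (auto simp: prime_gt_0_nat)
    also have "\<dots> = ln (real Y) * (\<Sum>p | prime p \<and> p \<le> Y. ?w p)" by (simp add: sum_distrib_left)
    finally show ?case using Y by (simp add: S_def pos_divide_le_eq mult.commute)
  qed
qed

end

section \<open>Completely multiplicative resonators\<close>

definition cmult_ext :: "(nat \<Rightarrow> real) \<Rightarrow> nat \<Rightarrow> real" where
  "cmult_ext \<rho> n = (if n = 0 then 0 else \<Prod>p\<in>#prime_factorization n. \<rho> p)"

lemma cmult_ext_0 [simp]: "cmult_ext \<rho> 0 = 0"
  by (simp add: cmult_ext_def)

lemma cmult_ext_1 [simp]: "cmult_ext \<rho> (Suc 0) = 1"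
  by (simp add: cmult_ext_def)

lemma cmult_ext_mult: "cmult_ext \<rho> (m * n) = cmult_ext \<rho> m * cmult_ext \<rho> n"
  by (auto simp: cmult_ext_def prime_factorization_mult)

lemma cmult_ext_power: "cmult_ext \<rho> (n ^ k) = cmult_ext \<rho> n ^ k"
  by (induction k) (auto simp: cmult_ext_mult)

lemma cmult_ext_prime: "prime p \<Longrightarrow> cmult_ext \<rho> p = \<rho> p"
  by (auto simp: cmult_ext_def prime_factorization_prime)

lemma cmult_ext_nonneg: "(\<And>p. prime p \<Longrightarrow> \<rho> p \<ge> 0) \<Longrightarrow> cmult_ext \<rho> n \<ge> 0"
proof -
  assume *: "\<And>p. prime p \<Longrightarrow> \<rho> p \<ge> 0"
  have "(\<forall>p\<in>#M. prime p) \<Longrightarrow> (\<Prod>p\<in>#M. \<rho> p) \<ge> 0" for M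
    by (induction M) (auto simp: *)
  thus ?thesis by (auto simp: cmult_ext_def)
qed

lemma cmult_ext_cong:
  "(\<And>p. prime p \<Longrightarrow> p dvd n \<Longrightarrow> \<rho> p = \<rho>' p) \<Longrightarrow> cmult_ext \<rho> n = cmult_ext \<rho>' n"
  unfolding cmult_ext_def by (auto intro!: arg_cong[of _ _ prod_mset] image_mset_cong)

lemma cmult_ext_eq_0:
  assumes "prime p" "p dvd n" "\<rho> p = 0"
  shows "cmult_ext \<rho> n = 0"
  using assms by (auto simp: cmult_ext_mult cmult_ext_prime elim!: dvdE)

lemma cmult_ext_powr:
  "real n powr a * cmult_ext \<rho> n ^ j = cmult_ext (\<lambda>p. real p powr a * \<rho> p ^ j) n" if "j > 0 \<or> n > 0"
proof (cases "n = 0")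
  case False
  have "real (prod_mset M) powr a * (\<Prod>p\<in>#M. \<rho> p) ^ j = (\<Prod>p\<in>#M. real p powr a * \<rho> p ^ j)" for M :: "nat multiset"
    by (induction M) (auto simp: powr_mult power_mult_distrib)
  from this[of "prime_factorization n"] False show ?thesis
    by (simp add: cmult_ext_def prod_mset_prime_factorization_nat)
qed (use that in \<open>auto simp: power_0_left\<close>)

text \<open>Euler product by induction on \<open>P\<close>. Each positive \<open>n\<close> is
  uniquely \<open>q ^ k * m\<close> with \<open>q\<close> not dividing \<open>m\<close>, and setting
  the value at \<open>q\<close> to 0 makes exactly the other \<open>m\<close> vanish, so the
  induction hypothesis gives the sum over these \<open>m\<close>.\<close>

lemma cmult_ext_has_sum:
  assumes "finite P" "\<And>p. p \<in> P \<Longrightarrow> prime p" "\<And>p. p \<in> P \<Longrightarrow> 0 \<le> \<rho> p" "\<And>p. p \<in> P \<Longrightarrow> \<rho> p < 1"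
    "\<And>p. prime p \<Longrightarrow> p \<notin> P \<Longrightarrow> \<rho> p = 0"
  shows "(cmult_ext \<rho> has_sum (\<Prod>p\<in>P. 1 / (1 - \<rho> p))) UNIV"
  using assms
proof (induction P arbitrary: \<rho> rule: finite_induct)
  case empty
  have "(cmult_ext \<rho> has_sum (\<Sum>n\<in>{1}. cmult_ext \<rho> n)) {1}" by (rule has_sum_finite) auto
  also have "?this \<longleftrightarrow> (cmult_ext \<rho> has_sum (\<Sum>n\<in>{1}. cmult_ext \<rho> n)) UNIV"
  proof (rule has_sum_cong_neutral)
    fix n :: nat assume "n \<in> UNIV - {1}"
    hence "n \<noteq> 1" by simp
    then obtain p where "prime p" "p dvd n" by (meson prime_factor_nat)
    thus "cmult_ext \<rho> n = 0" using empty by (intro cmult_ext_eq_0) auto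
  qed auto
  finally show ?case by simp
next
  case (insert q P)
  define \<rho>' where "\<rho>' = \<rho>(q := 0)"
  have q: "prime q" "0 \<le> \<rho> q" "\<rho> q < 1" using insert by auto
  have IH: "(cmult_ext \<rho>' has_sum (\<Prod>p\<in>P. 1 / (1 - \<rho>' p))) UNIV"
    by (rule insert.IH) (use insert in \<open>auto simp: \<rho>'_def\<close>)
  have eqP: "(\<Prod>p\<in>P. 1 / (1 - \<rho>' p)) = (\<Prod>p\<in>P. 1 / (1 - \<rho> p))"
    using insert.hyps by (intro prod.cong) (auto simp: \<rho>'_def)
  have nn: "cmult_ext \<rho>' n \<ge> 0" for n
    by (rule cmult_ext_nonneg) (metis \<rho>'_def fun_upd_apply insert.prems(2,4) insertE order_refl)
  have gs: "((\<lambda>k. \<rho> q ^ k) has_sum (1 / (1 - \<rho> q))) UNIV"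
    using geometric_sums[of "\<rho> q"] q by (intro sums_nonneg_imp_has_sum) auto
  have "((\<lambda>(k, m). \<rho> q ^ k * cmult_ext \<rho>' m) has_sum (1 / (1 - \<rho> q) * (\<Prod>p\<in>P. 1 / (1 - \<rho>' p)))) (UNIV \<times> UNIV)"
  proof (rule has_sum_mult_abs[OF gs IH])
    show "(\<lambda>x. norm (\<rho> q ^ x)) summable_on UNIV"
      using has_sum_imp_summable[OF gs] q by simp
    show "(\<lambda>x. norm (cmult_ext \<rho>' x)) summable_on UNIV"
      using has_sum_imp_summable[OF IH] nn by simp
  qed
  also have "?this \<longleftrightarrow> ((\<lambda>(k, m). \<rho> q ^ k * cmult_ext \<rho>' m) has_sum (1 / (1 - \<rho> q) * (\<Prod>p\<in>P. 1 / (1 - \<rho>' p))))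
      (UNIV \<times> {m. m > 0 \<and> \<not> q dvd m})"
  proof (rule has_sum_cong_neutral)
    fix x :: "nat \<times> nat" assume "x \<in> UNIV \<times> UNIV - UNIV \<times> {m. m > 0 \<and> \<not> q dvd m}"
    then obtain k m where "x = (k, m)" "m = 0 \<or> q dvd m" by (cases x) auto
    moreover have "cmult_ext \<rho>' m = 0" if "q dvd m"
      by (rule cmult_ext_eq_0[OF q(1) that]) (simp add: \<rho>'_def)
    ultimately show "(case x of (k, m) \<Rightarrow> \<rho> q ^ k * cmult_ext \<rho>' m) = 0" by auto
  qed auto
  also have "\<dots> \<longleftrightarrow> (cmult_ext \<rho> has_sum (1 / (1 - \<rho> q) * (\<Prod>p\<in>P. 1 / (1 - \<rho>' p)))) {n. n > 0}"
  proof (rule has_sum_reindex_bij_witness[where j = "\<lambda>(k, m). q ^ k * m" and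
       i = "\<lambda>n. (multiplicity q n, n div q ^ multiplicity q n)"], goal_cases)
    case (1 x)
    then obtain k m where x: "x = (k, m)" "m > 0" "\<not> q dvd m" by auto
    have "multiplicity q (q ^ k * m) = k"
      using q(1) x by (intro multiplicity_eqI) (auto simp: mult.commute[of q] prime_gt_0_nat)
    thus ?case using x q(1) prime_gt_0_nat[OF q(1)] by simp
  next
    case (2 x) thus ?case using prime_gt_0_nat[OF q(1)] by auto
  next
    case (3 n) thus ?case by (simp add: multiplicity_dvd)
  next
    case (4 n)
    have "\<not> is_unit q" using q(1) by (metis not_prime_unit)
    hence "\<not> q dvd n div q ^ multiplicity q n" using 4 by (intro multiplicity_decompose) auto
    moreover have "n div q ^ multiplicity q n > 0" using 4 by (simp add: div_greater_zero_iff dvd_imp_le multiplicity_dvd prime_gt_0_nat[OF q(1)])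
    ultimately show ?case by simp
  next
    case (5 x)
    then obtain k m where x: "x = (k, m)" "m > 0" "\<not> q dvd m" by auto
    have "cmult_ext \<rho> m = cmult_ext \<rho>' m"
      using x by (intro cmult_ext_cong) (auto simp: \<rho>'_def)
    thus ?case using x by (simp add: cmult_ext_mult cmult_ext_power cmult_ext_prime[OF q(1)])
  qed auto
  also have "\<dots> \<longleftrightarrow> (cmult_ext \<rho> has_sum (1 / (1 - \<rho> q) * (\<Prod>p\<in>P. 1 / (1 - \<rho>' p)))) UNIV"
    by (rule has_sum_cong_neutral) auto
  finally show ?case using insert.hyps eqP by simp
qed

section \<open>Gaussian Fourier integrals\<close>

text \<open>The characteristic function of the standard normal distribution, rescaled.\<close>

lemma gauss_fourier:
  assumes "c > 0"
  shows "integrable lborel (\<lambda>v. of_real (exp (- (c * v)\<^sup>2 / 2)) * cis (x * v))"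
    "(LINT v|lborel. of_real (exp (- (c * v)\<^sup>2 / 2)) * cis (x * v)) =
       complex_of_real (sqrt (2 * pi) / c * exp (- (x / c)\<^sup>2 / 2))"
proof -
  have e: "of_real (std_normal_density v) * iexp (t * v) =
     of_real (1 / sqrt (2 * pi)) * (of_real (exp (- v\<^sup>2 / 2)) * cis (t * v))" for t v
    by (simp add: std_normal_density_def cis_conv_exp)
  have i0: "integrable lborel (\<lambda>v. of_real (exp (- v\<^sup>2 / 2)) * cis (t * v))" for t
  proof -
    have m: "(\<lambda>v. of_real (exp (- v\<^sup>2 / 2)) * cis (t * v)) \<in> borel_measurable borel"
      by (intro borel_measurable_continuous_onI continuous_intros continuous_on_cis) auto
    have "integrable lborel (\<lambda>v. sqrt (2 * pi) * std_normal_density v)"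
      by (intro integrable_mult_right integrable_normal_density) auto
    thus ?thesis
      by (rule Bochner_Integration.integrable_bound)
         (use m in \<open>auto simp: norm_mult std_normal_density_def real_sqrt_mult\<close>)
  qed
  have v0: "(LINT v|lborel. of_real (exp (- v\<^sup>2 / 2)) * cis (t * v)) = of_real (sqrt (2 * pi)) * of_real (exp (- t\<^sup>2 / 2))" for t
  proof -
    have "complex_of_real (exp (- (t\<^sup>2) / 2)) = char std_normal_distribution t"
      by (simp add: char_std_normal_distribution)
    also have "\<dots> = (LINT v|lborel. std_normal_density v *\<^sub>R iexp (t * v))"
      unfolding char_def by (subst integral_density) auto
    also have "\<dots> = (LINT v|lborel. of_real (1 / sqrt (2 * pi)) * (of_real (exp (- v\<^sup>2 / 2)) * cis (t * v)))"
      by (simp only: scaleR_conv_of_real e)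
    also have "\<dots> = of_real (1 / sqrt (2 * pi)) * (LINT v|lborel. of_real (exp (- v\<^sup>2 / 2)) * cis (t * v))"
      by (rule integral_mult_right_zero)
    finally show ?thesis by (simp add: field_simps)
  qed
  have eq: "of_real (exp (- (c * v)\<^sup>2 / 2)) * cis (x * v) =
     of_real (exp (- (0 + c * v)\<^sup>2 / 2)) * cis (x / c * (0 + c * v))" for v
    using assms by simp
  show "integrable lborel (\<lambda>v. of_real (exp (- (c * v)\<^sup>2 / 2)) * cis (x * v))"
    unfolding eq by (rule lborel_integrable_real_affine[OF i0[of "x / c"]]) (use assms in auto)
  have "of_real (sqrt (2 * pi)) * of_real (exp (- (x / c)\<^sup>2 / 2)) =
     \<bar>c\<bar> *\<^sub>R (LINT v|lborel. of_real (exp (- (c * v)\<^sup>2 / 2)) * cis (x * v))"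
    unfolding v0[symmetric] eq by (rule lborel_integral_real_affine) (use assms in auto)
  thus "(LINT v|lborel. of_real (exp (- (c * v)\<^sup>2 / 2)) * cis (x * v)) =
       complex_of_real (sqrt (2 * pi) / c * exp (- (x / c)\<^sup>2 / 2))"
    using assms by (simp add: scaleR_conv_of_real field_simps)
qed

lemma gauss_real:
  assumes "c > 0"
  shows "integrable lborel (\<lambda>v. exp (- (c * v)\<^sup>2 / 2))"
    "(LINT v|lborel. exp (- (c * v)\<^sup>2 / 2)) = sqrt (2 * pi) / c"
proof -
  have "complex_integrable lborel (\<lambda>v. of_real (exp (- (c * v)\<^sup>2 / 2)))"
    using gauss_fourier(1)[OF assms, of 0] by simp
  thus "integrable lborel (\<lambda>v. exp (- (c * v)\<^sup>2 / 2))" unfolding complex_of_real_integrable_eq .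
  have "complex_of_real (LINT v|lborel. exp (- (c * v)\<^sup>2 / 2)) = complex_of_real (sqrt (2 * pi) / c)"
    using gauss_fourier(2)[OF assms, of 0] by (simp flip: integral_complex_of_real)
  thus "(LINT v|lborel. exp (- (c * v)\<^sup>2 / 2)) = sqrt (2 * pi) / c" by (simp only: of_real_eq_iff)
qed

text \<open>Completing the square absorbs the factor \<open>exp (c\<^sup>2 / 2 - L)\<close>, so the
  value is the same as on the imaginary axis. Coefficients read off on \<open>Re = 1\<close> thus
  receive the plain Gaussian damping in \<open>L / c\<close>.\<close>

lemma gauss_shifted:
  assumes c: "c > 0"
  shows "integrable lborel (\<lambda>v. exp (of_real (c\<^sup>2 / 2) * (1 + \<i> * of_real v)\<^sup>2) * exp (- (1 + \<i> * of_real v) * of_real L))"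
    "(LINT v|lborel. exp (of_real (c\<^sup>2 / 2) * (1 + \<i> * of_real v)\<^sup>2) * exp (- (1 + \<i> * of_real v) * of_real L)) =
       complex_of_real (sqrt (2 * pi) / c * exp (- (L / c)\<^sup>2 / 2))"
proof -
  have eq: "exp (of_real (c\<^sup>2 / 2) * (1 + \<i> * of_real v)\<^sup>2) * exp (- (1 + \<i> * of_real v) * of_real L) =
    of_real (exp (c\<^sup>2 / 2 - L)) * (of_real (exp (- (c * v)\<^sup>2 / 2)) * cis ((c\<^sup>2 - L) * v))" for v
  proof -
    have "of_real (c\<^sup>2 / 2) * (1 + \<i> * of_real v)\<^sup>2 + (- (1 + \<i> * of_real v) * of_real L) =
      of_real (c\<^sup>2 / 2 - L) + (of_real (- (c * v)\<^sup>2 / 2) + \<i> * of_real ((c\<^sup>2 - L) * v))"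
      by (simp add: complex_eq_iff power2_eq_square algebra_simps diff_divide_distrib add_divide_distrib)
    thus ?thesis
      unfolding exp_add[symmetric] by (simp only: exp_add cis_conv_exp exp_of_real[symmetric])
  qed
  show "integrable lborel (\<lambda>v. exp (of_real (c\<^sup>2 / 2) * (1 + \<i> * of_real v)\<^sup>2) * exp (- (1 + \<i> * of_real v) * of_real L))"
    unfolding eq by (intro integrable_mult_right gauss_fourier(1) c)
  have "c\<^sup>2 / 2 - L + - ((c\<^sup>2 - L) / c)\<^sup>2 / 2 = - (L / c)\<^sup>2 / 2"
    using c by (simp add: field_simps power2_eq_square)
  hence ex: "exp (c\<^sup>2 / 2 - L) * exp (- ((c\<^sup>2 - L) / c)\<^sup>2 / 2) = exp (- (L / c)\<^sup>2 / 2)"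
    by (simp flip: exp_add)
  have "(LINT v|lborel. exp (of_real (c\<^sup>2 / 2) * (1 + \<i> * of_real v)\<^sup>2) * exp (- (1 + \<i> * of_real v) * of_real L)) =
     of_real (exp (c\<^sup>2 / 2 - L)) * of_real (sqrt (2 * pi) / c * exp (- ((c\<^sup>2 - L) / c)\<^sup>2 / 2))"
    unfolding eq by (subst integral_mult_right_zero) (simp only: gauss_fourier(2)[OF c])
  also have "\<dots> = of_real (sqrt (2 * pi) / c * (exp (c\<^sup>2 / 2 - L) * exp (- ((c\<^sup>2 - L) / c)\<^sup>2 / 2)))"
    by simp
  finally show "(LINT v|lborel. exp (of_real (c\<^sup>2 / 2) * (1 + \<i> * of_real v)\<^sup>2) * exp (- (1 + \<i> * of_real v) * of_real L)) =
       complex_of_real (sqrt (2 * pi) / c * exp (- (L / c)\<^sup>2 / 2))" unfolding ex .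
qed

section \<open>Mean values of a resonator against a Gaussian\<close>

locale resonator =
  fixes r :: "nat \<Rightarrow> real" and c :: real
  assumes r_nonneg: "\<And>n. r n \<ge> 0" and r_0: "r 0 = 0" and r_mult: "\<And>m n. r (m * n) = r m * r n"
    and r_summable: "summable r" and c_pos: "c > 0"
begin

definition K :: "real \<Rightarrow> real" where "K t = exp (- (c * t)\<^sup>2 / 2)"

definition Khat :: "real \<Rightarrow> real" where "Khat x = sqrt (2 * pi) / c * exp (- (x / c)\<^sup>2 / 2)"

definition RM :: "nat \<Rightarrow> real \<Rightarrow> complex" where
  "RM M t = (\<Sum>n=1..M. of_real (r n) * cis (- (t * ln (real n))))"

definition R :: "real \<Rightarrow> complex" where
  "R t = (\<Sum>n. of_real (r n) * cis (- (t * ln (real n))))"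

lemma Khat_nonneg: "Khat x \<ge> 0"
  using c_pos by (simp add: Khat_def)

lemma K_nonneg: "K t \<ge> 0" by (simp add: K_def)

lemma K_measurable [measurable]: "K \<in> borel_measurable borel"
  unfolding K_def[abs_def] by measurable

lemma K_integrable: "integrable lborel K"
  unfolding K_def[abs_def] by (rule gauss_real[OF c_pos])

lemma RM_measurable [measurable]: "RM M \<in> borel_measurable borel"
  unfolding RM_def[abs_def]
  by (intro borel_measurable_continuous_onI continuous_intros continuous_on_cis)

lemma r_summable_cis: "summable (\<lambda>n. norm (of_real (r n) * cis (- (t * ln (real n)))))"
  using r_summable by (simp add: norm_mult r_nonneg)

lemma RM_tendsto: "(\<lambda>M. RM M t) \<longlonglongrightarrow> R t"
proof -
  have "(\<lambda>M. \<Sum>n<Suc M. of_real (r n) * cis (- (t * ln (real n)))) \<longlonglongrightarrow> R t"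
    unfolding R_def by (intro LIMSEQ_Suc summable_LIMSEQ summable_norm_cancel[OF r_summable_cis])
  moreover have "(\<Sum>n<Suc M. of_real (r n) * cis (- (t * ln (real n)))) = RM M t" for M
  proof -
    have "{..<Suc M} = insert 0 {1..M}" by auto
    thus ?thesis by (simp add: RM_def r_0 del: lessThan_Suc)
  qed
  ultimately show ?thesis by simp
qed

lemma R_measurable [measurable]: "R \<in> borel_measurable borel"
  by (rule borel_measurable_LIMSEQ_metric[OF RM_measurable RM_tendsto])

lemma norm_RM_le: "norm (RM M t) \<le> suminf r"
proof -
  have "norm (RM M t) \<le> (\<Sum>n=1..M. r n)"
    unfolding RM_def by (rule sum_norm_le) (simp add: norm_mult r_nonneg)
  also have "\<dots> \<le> suminf r" by (rule sum_le_suminf[OF r_summable]) (auto simp: r_nonneg)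
  finally show ?thesis .
qed

lemma norm_R_le: "norm (R t) \<le> suminf r"
  by (rule LIMSEQ_le_const2[OF tendsto_norm[OF RM_tendsto]]) (use norm_RM_le in auto)

lemma suminf_r_nonneg: "suminf r \<ge> 0"
  by (rule suminf_nonneg[OF r_summable r_nonneg])

text \<open>The integral of \<open>cis (- (t * ln N)) * (norm (RM M t))\<^sup>2 * K t\<close> with
  the square expanded. All terms are nonnegative because the Fourier transform of a Gaussian is
  positive.\<close>

definition I :: "nat \<Rightarrow> nat \<Rightarrow> real" where
  "I M N = (\<Sum>m=1..M. \<Sum>n=1..M. r m * r n * Khat (ln (real N) + ln (real m) - ln (real n)))"

lemma integral_RM:
  "(LINT t|lborel. cis (- (t * ln (real N))) * of_real ((norm (RM M t))\<^sup>2 * K t)) = of_real (I M N)"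
proof -
  have sq: "of_real ((norm (RM M t))\<^sup>2) =
     (\<Sum>m=1..M. \<Sum>n=1..M. of_real (r m * r n) * cis (- (t * ln (real m))) * cis (t * ln (real n)))" for t
    unfolding complex_norm_square RM_def cnj_sum complex_cnj_mult complex_cnj_complex_of_real cis_cnj sum_product
    by (simp add: mult_ac)
  have eq: "cis (- (t * ln (real N))) * of_real ((norm (RM M t))\<^sup>2 * K t) =
     (\<Sum>m=1..M. \<Sum>n=1..M. of_real (r m * r n) *
        (of_real (exp (- (c * t)\<^sup>2 / 2)) * cis (- (ln (real N) + ln (real m) - ln (real n)) * t)))" for t
  proof -
    have "cis (- (ln (real N) + ln (real m) - ln (real n)) * t) =
      cis (- (t * ln (real N))) * (cis (- (t * ln (real m))) * cis (t * ln (real n)))" for m n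
      unfolding cis_mult by (rule arg_cong[of _ _ cis]) (simp add: algebra_simps)
    thus ?thesis
      unfolding of_real_mult sq K_def sum_distrib_left sum_distrib_right by (simp add: mult_ac)
  qed
  have i: "integrable lborel (\<lambda>t. of_real (r m * r n) *
        (of_real (exp (- (c * t)\<^sup>2 / 2)) * cis (- (ln (real N) + ln (real m) - ln (real n)) * t)))" for m n
    by (intro integrable_mult_right gauss_fourier(1) c_pos)
  have "(LINT t|lborel. cis (- (t * ln (real N))) * of_real ((norm (RM M t))\<^sup>2 * K t)) =
     (\<Sum>m=1..M. \<Sum>n=1..M. of_real (r m * r n) * of_real (Khat (- (ln (real N) + ln (real m) - ln (real n)))))"
    unfolding eq
    by (simp only: Bochner_Integration.integral_sum[OF Bochner_Integration.integrable_sum[OF i]]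
          Bochner_Integration.integral_sum[OF i] integral_mult_right_zero gauss_fourier(2)[OF c_pos] Khat_def)
  moreover have "Khat (- x) = Khat x" for x by (simp add: Khat_def)
  ultimately show ?thesis by (simp only: I_def of_real_sum of_real_mult)
qed

text \<open>Only the terms with \<open>n = N * k\<close> are kept: then
  \<open>ln N + ln m - ln n = ln m - ln k\<close> and \<open>r n = r N * r k\<close>. The longer
  truncation \<open>N * M\<close> contains all these multiples.\<close>

lemma I_shift:
  assumes "N > 0"
  shows "I (N * M) N \<ge> r N * I M 1"
proof -
  have "r N * I M 1 = (\<Sum>m=1..M. \<Sum>k=1..M. r m * r (N * k) * Khat (ln (real N) + ln (real m) - ln (real (N * k))))"
    unfolding I_def sum_distrib_left using assms
    by (intro sum.cong refl) (auto simp: r_mult ln_mult)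
  also have "\<dots> = (\<Sum>m=1..M. \<Sum>n\<in>(\<lambda>k. N * k) ` {1..M}. r m * r n * Khat (ln (real N) + ln (real m) - ln (real n)))"
    by (rule sum.cong[OF refl], subst sum.reindex) (use assms in \<open>auto simp: inj_on_def\<close>)
  also have "\<dots> \<le> (\<Sum>m=1..M. \<Sum>n=1..N * M. r m * r n * Khat (ln (real N) + ln (real m) - ln (real n)))"
    using assms by (intro sum_mono sum_mono2) (auto simp: r_nonneg Khat_nonneg Suc_le_eq)
  also have "\<dots> \<le> I (N * M) N"
    unfolding I_def using assms by (intro sum_mono2) (auto simp: r_nonneg Khat_nonneg intro!: sum_nonneg)
  finally show ?thesis .
qed

lemma integral_RM_tendsto:
  "(\<lambda>M. LINT t|lborel. cis (- (t * ln (real N))) * of_real ((norm (RM M t))\<^sup>2 * K t))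
     \<longlonglongrightarrow> (LINT t|lborel. cis (- (t * ln (real N))) * of_real ((norm (R t))\<^sup>2 * K t))"
proof (rule integral_dominated_convergence[where w = "\<lambda>t. (suminf r)\<^sup>2 * K t"])
  have cm: "(\<lambda>t. cis (- (t * ln (real N)))) \<in> borel_measurable borel"
    by (intro borel_measurable_continuous_onI continuous_on_cis continuous_intros)
  note [measurable] = cm
  show "(\<lambda>t. cis (- (t * ln (real N))) * of_real ((norm (R t))\<^sup>2 * K t)) \<in> borel_measurable lborel" by measurable
  show "(\<lambda>t. cis (- (t * ln (real N))) * of_real ((norm (RM M t))\<^sup>2 * K t)) \<in> borel_measurable lborel" for M by measurable
  show "integrable lborel (\<lambda>t. (suminf r)\<^sup>2 * K t)" by (intro integrable_mult_right K_integrable)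
  show "AE t in lborel. (\<lambda>M. cis (- (t * ln (real N))) * of_real ((norm (RM M t))\<^sup>2 * K t)) \<longlonglongrightarrow>
     cis (- (t * ln (real N))) * of_real ((norm (R t))\<^sup>2 * K t)"
    by (intro AE_I2 tendsto_intros RM_tendsto)
  show "AE t in lborel. norm (cis (- (t * ln (real N))) * of_real ((norm (RM M t))\<^sup>2 * K t)) \<le> (suminf r)\<^sup>2 * K t" for M
    by (intro AE_I2) (auto simp: norm_mult norm_power K_nonneg intro!: mult_right_mono power_mono norm_RM_le)
qed

definition mass :: real where
  "mass = (LINT t|lborel. (norm (R t))\<^sup>2 * K t)"

lemma mass_integrable: "integrable lborel (\<lambda>t. (norm (R t))\<^sup>2 * K t)"
proof (rule Bochner_Integration.integrable_bound)
  show "integrable lborel (\<lambda>t. (suminf r)\<^sup>2 * K t)" by (intro integrable_mult_right K_integrable)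
  show "AE t in lborel. norm ((norm (R t))\<^sup>2 * K t) \<le> norm ((suminf r)\<^sup>2 * K t)"
    using suminf_r_nonneg by (intro AE_I2) (auto simp: abs_mult K_nonneg intro!: mult_right_mono power_mono norm_R_le)
qed measurable

lemma I_tendsto_mass: "(\<lambda>M. I M 1) \<longlonglongrightarrow> mass"
proof -
  have "(\<lambda>M. Re (LINT t|lborel. cis (- (t * ln (real 1))) * of_real ((norm (RM M t))\<^sup>2 * K t)))
     \<longlonglongrightarrow> Re (LINT t|lborel. cis (- (t * ln (real 1))) * of_real ((norm (R t))\<^sup>2 * K t))"
    by (intro tendsto_Re integral_RM_tendsto)
  thus ?thesis unfolding integral_RM by (simp add: mass_def flip: of_real_power of_real_mult)
qed

lemma resonance_term:
  assumes "N > 0"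
  shows "Re (LINT t|lborel. cis (- (t * ln (real N))) * of_real ((norm (R t))\<^sup>2 * K t)) \<ge> r N * mass"
proof (rule LIMSEQ_le)
  show "(\<lambda>M. r N * I M 1) \<longlonglongrightarrow> r N * mass" by (intro tendsto_intros I_tendsto_mass)
  have "strict_mono (\<lambda>M. N * M)" using assms by (simp add: strict_mono_def)
  from LIMSEQ_subseq_LIMSEQ[OF integral_RM_tendsto this]
  have "(\<lambda>M. Re (LINT t|lborel. cis (- (t * ln (real N))) * of_real ((norm (RM (N * M) t))\<^sup>2 * K t)))
     \<longlonglongrightarrow> Re (LINT t|lborel. cis (- (t * ln (real N))) * of_real ((norm (R t))\<^sup>2 * K t))"
    by (intro tendsto_Re) (simp add: o_def)
  thus "(\<lambda>M. I (N * M) N) \<longlonglongrightarrow> Re (LINT t|lborel. cis (- (t * ln (real N))) * of_real ((norm (R t))\<^sup>2 * K t))"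
    unfolding integral_RM by simp
  show "\<exists>M0. \<forall>M\<ge>M0. r N * I M 1 \<le> I (N * M) N" using I_shift[OF assms] by blast
qed

lemma summable_r_square: "summable (\<lambda>n. (r n)\<^sup>2)"
proof (rule summable_comparison_test)
  show "summable (\<lambda>n. suminf r * r n)" by (intro summable_mult r_summable)
  have "r n \<le> suminf r" for n
    using sum_le_suminf[OF r_summable, of "{n}"] r_nonneg by auto
  thus "\<exists>N. \<forall>n\<ge>N. norm ((r n)\<^sup>2) \<le> suminf r * r n"
    by (auto simp: power2_eq_square r_nonneg intro!: mult_right_mono)
qed

text \<open>The diagonal \<open>m = n\<close> alone gives the right side; all other terms are
  nonnegative.\<close>

lemma mass_ge: "mass \<ge> (\<Sum>n. (r n)\<^sup>2) * (sqrt (2 * pi) / c)"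
proof (rule LIMSEQ_le)
  show "(\<lambda>M. I M 1) \<longlonglongrightarrow> mass" by (rule I_tendsto_mass)
  show "(\<lambda>M. (\<Sum>n<Suc M. (r n)\<^sup>2) * (sqrt (2 * pi) / c)) \<longlonglongrightarrow> (\<Sum>n. (r n)\<^sup>2) * (sqrt (2 * pi) / c)"
    by (intro tendsto_mult tendsto_const LIMSEQ_Suc summable_LIMSEQ summable_r_square)
  show "\<exists>M0. \<forall>M\<ge>M0. (\<Sum>n<Suc M. (r n)\<^sup>2) * (sqrt (2 * pi) / c) \<le> I M 1"
  proof (intro exI[of _ 0] allI impI)
    fix M
    have "{..<Suc M} = insert 0 {1..M}" by auto
    hence "(\<Sum>n<Suc M. (r n)\<^sup>2) * (sqrt (2 * pi) / c) = (\<Sum>m=1..M. (r m)\<^sup>2 * Khat 0)"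
      by (simp add: r_0 sum_distrib_right sum_divide_distrib Khat_def del: lessThan_Suc)
    also have "\<dots> \<le> I M 1" unfolding I_def
    proof (rule sum_mono)
      fix m assume m: "m \<in> {1..M}"
      have "r m * r m * Khat (ln (real 1) + ln (real m) - ln (real m)) \<le>
         (\<Sum>n=1..M. r m * r n * Khat (ln (real 1) + ln (real m) - ln (real n)))"
        by (rule member_le_sum) (use m in \<open>auto simp: r_nonneg Khat_nonneg\<close>)
      thus "(r m)\<^sup>2 * Khat 0 \<le> (\<Sum>n=1..M. r m * r n * Khat (ln (real 1) + ln (real m) - ln (real n)))"
        by (simp add: power2_eq_square)
    qed
    finally show "(\<Sum>n<Suc M. (r n)\<^sup>2) * (sqrt (2 * pi) / c) \<le> I M 1" .
  qed
qed

text \<open>Positivity of the Fourier transform of \<open>K\<close> lets us keep only the diagonal terms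
  \<open>n = N m\<close> of \<open>\<bar>R\<bar>\<^sup>2\<close>; complete multiplicativity of \<open>r\<close> turns these into \<open>r N\<close> times the total mass.\<close>

lemma resonance:
  assumes "finite \<Gamma>" "\<And>g. g \<in> \<Gamma> \<Longrightarrow> C g \<ge> 0" "\<And>g. g \<in> \<Gamma> \<Longrightarrow> N g > 0"
  defines "D \<equiv> \<lambda>t. \<Sum>g\<in>\<Gamma>. of_real (C g) * cis (- (t * ln (real (N g))))"
  shows "(\<Sum>g\<in>\<Gamma>. C g * r (N g)) * mass \<le> (LINT t|lborel. norm (D t) * ((norm (R t))\<^sup>2 * K t))"
proof -
  have cm: "(\<lambda>t. cis (- (t * x))) \<in> borel_measurable borel" for x
    by (intro borel_measurable_continuous_onI continuous_on_cis continuous_intros)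
  note [measurable] = cm
  have Dm [measurable]: "D \<in> borel_measurable borel" unfolding D_def
    by (intro borel_measurable_continuous_onI continuous_intros continuous_on_cis)
  have i: "integrable lborel (\<lambda>t. cis (- (t * x)) * of_real ((norm (R t))\<^sup>2 * K t))" for x
    by (rule Bochner_Integration.integrable_bound[OF mass_integrable])
       (auto simp: norm_mult norm_power K_nonneg)
  have eq: "D t * of_real ((norm (R t))\<^sup>2 * K t) =
     (\<Sum>g\<in>\<Gamma>. of_real (C g) * (cis (- (t * ln (real (N g)))) * of_real ((norm (R t))\<^sup>2 * K t)))" for t
    unfolding D_def sum_distrib_right by (simp add: mult.assoc)
  have "(\<Sum>g\<in>\<Gamma>. C g * r (N g)) * mass = (\<Sum>g\<in>\<Gamma>. C g * (r (N g) * mass))"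
    by (simp add: sum_distrib_right mult.assoc)
  also have "\<dots> \<le> (\<Sum>g\<in>\<Gamma>. C g * Re (LINT t|lborel. cis (- (t * ln (real (N g)))) * of_real ((norm (R t))\<^sup>2 * K t)))"
    using assms by (intro sum_mono mult_left_mono resonance_term) auto
  also have "\<dots> = Re (LINT t|lborel. D t * of_real ((norm (R t))\<^sup>2 * K t))"
    unfolding eq
    by (simp only: Bochner_Integration.integral_sum[OF integrable_mult_right[OF i]] integral_mult_right_zero Re_sum)
       simp
  also have "\<dots> \<le> norm (LINT t|lborel. D t * of_real ((norm (R t))\<^sup>2 * K t))" by (rule complex_Re_le_cmod)
  also have "\<dots> \<le> (LINT t|lborel. norm (D t * of_real ((norm (R t))\<^sup>2 * K t)))" by (rule integral_norm_bound)
  also have "\<dots> = (LINT t|lborel. norm (D t) * ((norm (R t))\<^sup>2 * K t))"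
    by (simp add: norm_mult norm_power K_nonneg)
  finally show ?thesis .
qed

end

section \<open>Products of shifted zeta values\<close>

lemma has_sum_prod_PiE:
  fixes f :: "'a \<Rightarrow> 'b \<Rightarrow> 'c :: {real_normed_field, banach, second_countable_topology}"
  assumes A: "finite A" and B: "\<And>x. x \<in> A \<Longrightarrow> countable (B x)"
    and f: "\<And>x. x \<in> A \<Longrightarrow> (f x has_sum s x) (B x)"
    and abs: "\<And>x. x \<in> A \<Longrightarrow> (\<lambda>y. norm (f x y)) summable_on B x"
  shows "((\<lambda>g. \<Prod>x\<in>A. f x (g x)) has_sum (\<Prod>x\<in>A. s x)) (PiE A B)"
    "(\<lambda>g. norm (\<Prod>x\<in>A. f x (g x))) summable_on (PiE A B)"
proof -
  have "Infinite_Set_Sum.abs_summable_on (\<lambda>g. \<Prod>x\<in>A. f x (g x)) (PiE A B)"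
    by (rule abs_summable_on_prod_PiE[OF A B]) (auto intro!: abs_summable_equivalent[THEN iffD1] abs)
  thus n: "(\<lambda>g. norm (\<Prod>x\<in>A. f x (g x))) summable_on (PiE A B)"
    by (rule abs_summable_equivalent[THEN iffD2])
  have "(\<Prod>x\<in>A. s x) = (\<Prod>x\<in>A. infsum (f x) (B x))"
    by (intro prod.cong refl infsumI[symmetric] f)
  also have "\<dots> = infsum (\<lambda>g. \<Prod>x\<in>A. f x (g x)) (PiE A B)"
    by (rule infsum_prod_PiE_abs[OF A abs, symmetric])
  finally show "((\<lambda>g. \<Prod>x\<in>A. f x (g x)) has_sum (\<Prod>x\<in>A. s x)) (PiE A B)"
    using has_sum_infsum[OF Infinite_Sum.abs_summable_summable[OF n]] by simp
qed

text \<open>By Cauchy's theorem the vertical integrals differ only by the two horizontal sides, each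
  of length 1.\<close>

lemma rectangle_shift:
  fixes f :: "complex \<Rightarrow> complex"
  assumes hol: "f holomorphic_on S" and S: "convex S" "cbox (Complex 0 a) (Complex 1 b) \<subseteq> S"
    and ab: "a < b" and B: "\<And>x. 0 \<le> x \<Longrightarrow> x \<le> 1 \<Longrightarrow> norm (f (Complex x a)) \<le> B"
      "\<And>x. 0 \<le> x \<Longrightarrow> x \<le> 1 \<Longrightarrow> norm (f (Complex x b)) \<le> B"
  shows "norm (integral {a..b} (\<lambda>v. f (Complex 1 v)) - integral {a..b} (\<lambda>v. f (Complex 0 v))) \<le> 2 * B"
proof -
  let ?a1 = "Complex 0 a" and ?a2 = "Complex 1 a" and ?a3 = "Complex 1 b" and ?a4 = "Complex 0 b"
  have B0: "B \<ge> 0" using order.trans[OF norm_ge_zero B(1)[of 0]] by simp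
  have cont: "continuous_on S f" by (rule holomorphic_on_imp_continuous_on[OF hol])
  have mem: "?a1 \<in> S" "?a2 \<in> S" "?a3 \<in> S" "?a4 \<in> S"
    using S(2) ab by (auto simp: in_cbox_complex_iff subset_iff)
  have seg: "closed_segment x y \<subseteq> S" if "x \<in> S" "y \<in> S" for x y
    using that S(1) by (simp add: closed_segment_subset)
  have ci: "f contour_integrable_on linepath x y" if "x \<in> S" "y \<in> S" for x y
    by (intro contour_integrable_continuous_linepath continuous_on_subset[OF cont] seg that)
  have rp: "rectpath ?a1 ?a3 = linepath ?a1 ?a2 +++ linepath ?a2 ?a3 +++ linepath ?a3 ?a4 +++ linepath ?a4 ?a1"
    by (simp add: rectpath_def Let_def)
  have "(f has_contour_integral 0) (rectpath ?a1 ?a3)"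
  proof (rule Cauchy_theorem_convex_simple[OF hol S(1)])
    show "path_image (rectpath ?a1 ?a3) \<subseteq> S"
      using path_image_rectpath_subset_cbox[of ?a1 ?a3] ab S(2) by auto
  qed auto
  moreover have "(f has_contour_integral (contour_integral (linepath ?a1 ?a2) f + (contour_integral (linepath ?a2 ?a3) f
      + (contour_integral (linepath ?a3 ?a4) f + contour_integral (linepath ?a4 ?a1) f)))) (rectpath ?a1 ?a3)"
    unfolding rp by (intro has_contour_integral_join has_contour_integral_integral ci mem) auto
  ultimately have sum0: "contour_integral (linepath ?a1 ?a2) f + (contour_integral (linepath ?a2 ?a3) f
      + (contour_integral (linepath ?a3 ?a4) f + contour_integral (linepath ?a4 ?a1) f)) = 0"
    using has_contour_integral_unique by blast
  have v: "contour_integral (linepath (Complex x a) (Complex x b)) f = \<i> * integral {a..b} (\<lambda>v. f (Complex x v))"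
    if "Complex x a \<in> S" "Complex x b \<in> S" for x
  proof -
    have "(f has_contour_integral contour_integral (linepath (Complex x a) (Complex x b)) f) (linepath (Complex x a) (Complex x b))"
      by (intro has_contour_integral_integral ci that)
    hence "((\<lambda>v. f (Complex x v)) has_integral (- \<i> * contour_integral (linepath (Complex x a) (Complex x b)) f)) {a..b}"
      using has_contour_integral_linepath_same_Re_iff[of "Complex x a" x "Complex x b" a b f] ab by simp
    hence "integral {a..b} (\<lambda>v. f (Complex x v)) = - \<i> * contour_integral (linepath (Complex x a) (Complex x b)) f"
      by (rule integral_unique)
    hence "\<i> * integral {a..b} (\<lambda>v. f (Complex x v)) = (\<i> * - \<i>) * contour_integral (linepath (Complex x a) (Complex x b)) f"
      by (simp only: mult.assoc)
    thus ?thesis by simp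
  qed
  \<comment> \<open>Both orientations are covered, because the upper side is traversed from right to
    left.\<close>
  have h: "norm (contour_integral (linepath (Complex p y) (Complex q y)) f) \<le> B"
    if "{p, q} = {0, 1}" "Complex 0 y \<in> S" "Complex 1 y \<in> S" "\<And>x. 0 \<le> x \<Longrightarrow> x \<le> 1 \<Longrightarrow> norm (f (Complex x y)) \<le> B" for p q y
  proof -
    have pq: "(p = 0 \<and> q = 1) \<or> (p = 1 \<and> q = 0)" using that(1) by (auto simp: doubleton_eq_iff)
    have "norm (contour_integral (linepath (Complex p y) (Complex q y)) f) \<le> B * norm (Complex q y - Complex p y)"
    proof (rule contour_integral_bound_linepath[OF ci B0])
      fix x assume "x \<in> closed_segment (Complex p y) (Complex q y)"
      then obtain u where u: "0 \<le> u" "u \<le> 1" "x = (1 - u) *\<^sub>R Complex p y + u *\<^sub>R Complex q y"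
        by (auto simp: closed_segment_def)
      have "x = Complex ((1 - u) * p + u * q) y" unfolding u(3) by (simp add: complex_eq_iff algebra_simps)
      moreover have "0 \<le> (1 - u) * p + u * q" "(1 - u) * p + u * q \<le> 1" using pq u by auto
      ultimately show "norm (f x) \<le> B" using that(4) by simp
    qed (use that pq in auto)
    also have "Complex q y - Complex p y = of_real (q - p)" by (simp add: complex_eq_iff)
    also have "norm (of_real (q - p) :: complex) = 1" using pq by auto
    finally show ?thesis by simp
  qed
  have "contour_integral (linepath ?a4 ?a1) f = - contour_integral (linepath ?a1 ?a4) f"
    using contour_integral_reverse_linepath[of ?a1 ?a4 f] continuous_on_subset[OF cont seg[OF mem(1,4)]] by simp
  with sum0 have "\<i> * (integral {a..b} (\<lambda>v. f (Complex 1 v)) - integral {a..b} (\<lambda>v. f (Complex 0 v))) =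
      - (contour_integral (linepath ?a1 ?a2) f + contour_integral (linepath ?a3 ?a4) f)"
    unfolding v[OF mem(1,4)] v[OF mem(2,3)] by (simp add: algebra_simps eq_neg_iff_add_eq_0)
  hence "norm (\<i> * (integral {a..b} (\<lambda>v. f (Complex 1 v)) - integral {a..b} (\<lambda>v. f (Complex 0 v)))) =
      norm (contour_integral (linepath ?a1 ?a2) f + contour_integral (linepath ?a3 ?a4) f)"
    by (simp only: norm_minus_cancel)
  also have "\<dots> \<le> norm (contour_integral (linepath ?a1 ?a2) f) + norm (contour_integral (linepath ?a3 ?a4) f)"
    by (rule norm_triangle_ineq)
  also have "\<dots> \<le> B + B" by (intro add_mono h B mem) auto
  finally show ?thesis by (simp add: norm_mult)
qed

text \<open>Free of the default values of \<open>zeta\<close> where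
  \<open>2 powr (1 - s) = 1\<close>; the shifted contour leaves the strip in which the two are known
  to agree.\<close>

definition zeta_ext :: "complex \<Rightarrow> complex" where
  "zeta_ext s = zeta_reg s / (s - 1)"

lemma zeta_ext_has_sum:
  assumes "Re s > 1"
  shows "((\<lambda>n. of_nat n powr (-s)) has_sum zeta_ext s) {1..}"
    "(\<lambda>n. norm (of_nat n powr (-s) :: complex)) summable_on {1..}"
proof -
  have "((\<lambda>n. of_real 1 * of_nat n powr (-s)) has_sum dseries (\<lambda>_. 1) s) UNIV"
    by (rule has_sum_dseries[OF _ summable_one_powr assms]) auto
  hence "((\<lambda>n. of_nat n powr (-s)) has_sum zeta_ext s) UNIV"
    using zeta_series[OF assms] by (simp add: zeta_ext_def)
  also have "?this \<longleftrightarrow> ((\<lambda>n. of_nat n powr (-s)) has_sum zeta_ext s) {1..}"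
    by (rule has_sum_cong_neutral) (auto simp: not_le Suc_le_eq)
  finally show "((\<lambda>n. of_nat n powr (-s)) has_sum zeta_ext s) {1..}" .
  have "summable (\<lambda>n. norm (norm (of_real 1 * of_nat n powr (-s) :: complex)))"
    using summable_dterm[where a = "\<lambda>_. 1", OF _ summable_one_powr assms] by simp
  hence "(\<lambda>n. norm (of_nat n powr (-s) :: complex)) summable_on UNIV"
    using norm_summable_imp_summable_on by fastforce
  thus "(\<lambda>n. norm (of_nat n powr (-s) :: complex)) summable_on {1..}"
    by (rule summable_on_subset_banach) auto
qed

lemma zeta_ext_bound:
  assumes "\<sigma> > 0"
  obtains C where "C \<ge> 0" "\<And>s. Re s \<ge> \<sigma> \<Longrightarrow> \<bar>Im s\<bar> \<ge> 1 \<Longrightarrow> norm (zeta_ext s) \<le> 1 + C * norm s"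
proof -
  obtain C where C: "C \<ge> 0" "\<And>s. Re s \<ge> \<sigma> \<Longrightarrow> norm (zeta_reg s) \<le> 1 + C * norm (s * (s - 1))"
    using norm_zeta_reg_le[OF assms] by blast
  show ?thesis
  proof (rule that[OF C(1)])
    fix s assume s: "Re s \<ge> \<sigma>" "\<bar>Im s\<bar> \<ge> 1"
    have n: "norm (s - 1) \<ge> 1" using abs_Im_le_cmod[of "s - 1"] s by simp
    have "norm (zeta_ext s) = norm (zeta_reg s) / norm (s - 1)" by (simp add: zeta_ext_def norm_divide)
    also have "\<dots> \<le> (1 + C * norm (s * (s - 1))) / norm (s - 1)" using C(2)[OF s(1)] by (rule divide_right_mono) auto
    also have "\<dots> = 1 / norm (s - 1) + C * norm s" using n by (auto simp: norm_mult add_divide_distrib)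
    also have "1 / norm (s - 1) \<le> 1" using n by (intro divide_le_eq_1_pos[THEN iffD2]) linarith+
    finally show "norm (zeta_ext s) \<le> 1 + C * norm s" by simp
  qed
qed

locale zeta_product =
  fixes \<sigma> :: real and l :: nat
  assumes \<sigma>: "0 < \<sigma>" "\<sigma> < 1"
begin

text \<open>For \<open>Re w \<ge> 1\<close> the product \<open>W w = (\<Prod>j=1..l. \<zeta>(\<sigma> + j w))\<close> expands over tuples
  \<open>g = (g 1, \<dots>, g l)\<close> of positive integers, with coefficient \<open>tuple_weight g\<close> and frequency \<open>ln (tuple_norm g)\<close>.\<close>

definition tuples :: "(nat \<Rightarrow> nat) set" where "tuples = PiE {1..l} (\<lambda>_. {1..})"

definition tuple_norm :: "(nat \<Rightarrow> nat) \<Rightarrow> nat" where "tuple_norm g = (\<Prod>j=1..l. g j ^ j)"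

definition tuple_weight :: "(nat \<Rightarrow> nat) \<Rightarrow> real" where "tuple_weight g = (\<Prod>j=1..l. real (g j) powr (-\<sigma>))"

definition W :: "complex \<Rightarrow> complex" where "W w = (\<Prod>j=1..l. zeta_ext (of_real \<sigma> + of_nat j * w))"

text \<open>The value of \<open>W\<close> at 1, which also bounds \<open>W\<close> on the whole line
  \<open>Re w = 1\<close>.\<close>

definition abs_mass :: real where "abs_mass = (\<Sum>\<^sub>\<infinity>g\<in>tuples. tuple_weight g / real (tuple_norm g))"

lemma tuples_pos: "g \<in> tuples \<Longrightarrow> j \<in> {1..l} \<Longrightarrow> g j > 0"
  by (auto simp: tuples_def PiE_def Pi_def Suc_le_eq)

lemma tuple_norm_pos: "g \<in> tuples \<Longrightarrow> tuple_norm g > 0"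
  unfolding tuple_norm_def using tuples_pos by (intro prod_pos) auto

lemma tuple_weight_nonneg: "tuple_weight g \<ge> 0"
  unfolding tuple_weight_def by (intro prod_nonneg) auto

lemma ln_tuple_norm: "g \<in> tuples \<Longrightarrow> ln (real (tuple_norm g)) = (\<Sum>j=1..l. real j * ln (real (g j)))"
  unfolding tuple_norm_def of_nat_prod using tuples_pos by (subst ln_prod) (auto simp: ln_realpow)

lemma W_term:
  fixes w :: complex
  assumes "g \<in> tuples"
  shows "(\<Prod>j=1..l. of_nat (g j) powr (- (of_real \<sigma> + of_nat j * w))) = of_real (tuple_weight g) * exp (- w * of_real (ln (real (tuple_norm g))))"
proof -
  have "(\<Prod>j=1..l. of_nat (g j) powr (- (of_real \<sigma> + of_nat j * w))) =
     (\<Prod>j=1..l. of_real (real (g j) powr (-\<sigma>)) * exp (- w * of_real (real j * ln (real (g j)))))"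
  proof (rule prod.cong[OF refl])
    fix j assume j: "j \<in> {1..l}"
    have p: "g j > 0" by (rule tuples_pos[OF assms j])
    have "(of_nat (g j) :: complex) powr (- (of_real \<sigma> + of_nat j * w)) =
       exp (of_real (- \<sigma> * ln (real (g j))) + (- w * of_real (real j * ln (real (g j)))))"
      using p by (simp add: powr_def Ln_of_nat algebra_simps)
    also have "\<dots> = of_real (real (g j) powr (-\<sigma>)) * exp (- w * of_real (real j * ln (real (g j))))"
      unfolding exp_add exp_of_real using p by (simp add: powr_def)
    finally show "(of_nat (g j) :: complex) powr (- (of_real \<sigma> + of_nat j * w)) = \<dots>" .
  qed
  also have "\<dots> = of_real (tuple_weight g) * exp (\<Sum>j=1..l. - w * of_real (real j * ln (real (g j))))"
    unfolding prod.distrib by (simp add: tuple_weight_def exp_sum)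
  also have "(\<Sum>j=1..l. - w * of_real (real j * ln (real (g j)))) = - w * of_real (ln (real (tuple_norm g)))"
    unfolding ln_tuple_norm[OF assms] of_real_sum sum_distrib_left ..
  finally show ?thesis .
qed

lemma W_has_sum:
  assumes "Re w \<ge> 1"
  shows "((\<lambda>g. of_real (tuple_weight g) * exp (- w * of_real (ln (real (tuple_norm g))))) has_sum W w) tuples"
    "(\<lambda>g. norm (of_real (tuple_weight g) * exp (- w * of_real (ln (real (tuple_norm g)))))) summable_on tuples"
proof -
  have re: "Re (of_real \<sigma> + of_nat j * w) > 1" if "j \<in> {1..l}" for j
  proof -
    have "1 * 1 \<le> real j * Re w" using that assms by (intro mult_mono) auto
    thus ?thesis using \<sigma> by simp
  qed
  note * = has_sum_prod_PiE[of "{1..l}" "\<lambda>_. {1..}" "\<lambda>j n. of_nat n powr (- (of_real \<sigma> + of_nat j * w))"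
     "\<lambda>j. zeta_ext (of_real \<sigma> + of_nat j * w)", OF _ _ zeta_ext_has_sum(1)[OF re] zeta_ext_has_sum(2)[OF re]]
  have 1: "((\<lambda>g. \<Prod>j=1..l. of_nat (g j) powr (- (of_real \<sigma> + of_nat j * w))) has_sum W w) tuples"
    unfolding W_def tuples_def by (rule *(1)) auto
  have 2: "(\<lambda>g. norm (\<Prod>j=1..l. (of_nat (g j) :: complex) powr (- (of_real \<sigma> + of_nat j * w)))) summable_on tuples"
    unfolding tuples_def by (rule *(2)) auto
  show "((\<lambda>g. of_real (tuple_weight g) * exp (- w * of_real (ln (real (tuple_norm g))))) has_sum W w) tuples"
    using 1 by (rule has_sum_cong[THEN iffD1, rotated]) (rule W_term)
  show "(\<lambda>g. norm (of_real (tuple_weight g) * exp (- w * of_real (ln (real (tuple_norm g)))))) summable_on tuples"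
    using 2 by (rule summable_on_cong[THEN iffD1, rotated]) (simp only: W_term)
qed

lemma norm_W_term: "g \<in> tuples \<Longrightarrow> Re w = 1 \<Longrightarrow>
    norm (of_real (tuple_weight g) * exp (- w * of_real (ln (real (tuple_norm g))))) = tuple_weight g / real (tuple_norm g)"
proof -
  assume g: "g \<in> tuples" and w: "Re w = 1"
  have "Re (- w * of_real (ln (real (tuple_norm g)))) = - ln (real (tuple_norm g))" using w by simp
  thus ?thesis using tuple_norm_pos[OF g]
    by (simp only: norm_mult norm_exp_eq_Re) (simp add: tuple_weight_nonneg exp_minus divide_inverse)
qed

lemma abs_mass_has_sum: "((\<lambda>g. tuple_weight g / real (tuple_norm g)) has_sum abs_mass) tuples"
proof -
  have "(\<lambda>g. norm (of_real (tuple_weight g) * exp (- (1::complex) * of_real (ln (real (tuple_norm g)))))) summable_on tuples"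
    by (rule W_has_sum) auto
  hence "(\<lambda>g. tuple_weight g / real (tuple_norm g)) summable_on tuples"
    by (rule summable_on_cong[THEN iffD1, rotated]) (intro norm_W_term, auto)
  thus ?thesis unfolding abs_mass_def by (rule has_sum_infsum)
qed

lemma abs_mass_nonneg: "abs_mass \<ge> 0"
  unfolding abs_mass_def by (intro infsum_nonneg) (auto simp: tuple_weight_nonneg)

definition partial_prod :: "(nat \<Rightarrow> nat) set \<Rightarrow> complex \<Rightarrow> complex" where
  "partial_prod \<Gamma> w = (\<Sum>g\<in>\<Gamma>. of_real (tuple_weight g) * exp (- w * of_real (ln (real (tuple_norm g)))))"

lemma norm_partial_prod_le:
  assumes "finite \<Gamma>" "\<Gamma> \<subseteq> tuples" "Re w = 1"
  shows "norm (partial_prod \<Gamma> w) \<le> (\<Sum>g\<in>\<Gamma>. tuple_weight g / real (tuple_norm g))"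
  unfolding partial_prod_def by (rule sum_norm_le) (use assms norm_W_term in auto)

lemma sum_abs_mass_le:
  assumes "finite \<Gamma>" "\<Gamma> \<subseteq> tuples"
  shows "(\<Sum>g\<in>\<Gamma>. tuple_weight g / real (tuple_norm g)) \<le> abs_mass"
  using has_sum_mono_neutral[OF has_sum_finite[OF assms(1)] abs_mass_has_sum, of "\<lambda>g. tuple_weight g / real (tuple_norm g)"] assms(2)
  by (auto simp: tuple_weight_nonneg)

text \<open>The tail of the sum of absolute values does not depend on \<open>Im w\<close>, so one
  finite \<open>\<Gamma>\<close> serves the whole line.\<close>

lemma norm_W_minus_partial_prod:
  assumes "finite \<Gamma>" "\<Gamma> \<subseteq> tuples" "Re w = 1"
  shows "norm (W w - partial_prod \<Gamma> w) \<le> abs_mass - (\<Sum>g\<in>\<Gamma>. tuple_weight g / real (tuple_norm g))"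
proof -
  let ?t = "\<lambda>g. of_real (tuple_weight g) * exp (- w * of_real (ln (real (tuple_norm g))))"
  have 1: "(?t has_sum (W w - partial_prod \<Gamma> w)) (tuples - \<Gamma>)"
    unfolding partial_prod_def using has_sum_Diff[OF W_has_sum(1) has_sum_finite[OF assms(1)] assms(2)] assms(3) by simp
  have 2: "((\<lambda>g. tuple_weight g / real (tuple_norm g)) has_sum (abs_mass - (\<Sum>g\<in>\<Gamma>. tuple_weight g / real (tuple_norm g)))) (tuples - \<Gamma>)"
    by (rule has_sum_Diff[OF abs_mass_has_sum has_sum_finite[OF assms(1)] assms(2)])
  show ?thesis
    by (rule norm_infsum_le[OF 1 2]) (use assms norm_W_term in auto)
qed

text \<open>The domain is open and convex and has the upper imaginary axis in its interior: the
  margin \<open>\<sigma> / (l + 1)\<close> keeps \<open>Re (\<sigma> + j * w)\<close> positive for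
  \<open>j \<le> l\<close>, and \<open>Im w > 0\<close> avoids the poles.\<close>

lemma W_holomorphic: "W holomorphic_on {w. Re w > - \<sigma> / real (l + 1) \<and> Im w > 0}"
proof -
  have "(\<lambda>w. zeta_ext (of_real \<sigma> + of_nat j * w)) holomorphic_on {w. Re w > - \<sigma> / real (l + 1) \<and> Im w > 0}"
    if j: "j \<in> {1..l}" for j
  proof -
    have "zeta_reg \<circ> (\<lambda>w. of_real \<sigma> + of_nat j * w) holomorphic_on {w. Re w > - \<sigma> / real (l + 1) \<and> Im w > 0}"
    proof (rule holomorphic_on_compose)
      show "(\<lambda>w. of_real \<sigma> + of_nat j * w) holomorphic_on {w. Re w > - \<sigma> / real (l + 1) \<and> Im w > 0}"
        by (intro holomorphic_intros)
      show "zeta_reg holomorphic_on (\<lambda>w. of_real \<sigma> + of_nat j * w) ` {w. Re w > - \<sigma> / real (l + 1) \<and> Im w > 0}"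
      proof (rule holomorphic_on_subset[OF holomorphic_zeta_reg], safe)
        fix w assume w: "Re w > - \<sigma> / real (l + 1)"
        have "real j * Re w > real j * (- \<sigma> / real (l + 1))" using w j by (intro mult_strict_left_mono) auto
        moreover have "real j * (\<sigma> / real (l + 1)) \<le> real (l + 1) * (\<sigma> / real (l + 1))"
          using j \<sigma> by (intro mult_right_mono) auto
        ultimately show "0 < Re (of_real \<sigma> + of_nat j * w)" by simp
      qed
    qed
    moreover have "of_real \<sigma> + of_nat j * w - 1 \<noteq> 0" if "Im w > 0" for w
    proof -
      have "Im (of_real \<sigma> + of_nat j * w - 1) > 0" using that j by simp
      thus ?thesis by fastforce
    qed
    ultimately show ?thesis unfolding zeta_ext_def o_def by (intro holomorphic_intros) auto
  qed
  thus ?thesis unfolding W_def[abs_def] by (intro holomorphic_on_prod) auto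
qed

text \<open>Each factor grows at most linearly. Any polynomial bound would do, because the Gaussian
  on the horizontal sides decays in a power of \<open>T\<close> inside the exponential.\<close>

lemma W_growth:
  obtains C where "C \<ge> 1" "\<And>w T. 0 \<le> Re w \<Longrightarrow> Re w \<le> 1 \<Longrightarrow> 1 \<le> Im w \<Longrightarrow> Im w \<le> T \<Longrightarrow> norm (W w) \<le> (C * T) ^ l"
proof -
  obtain C where C: "C \<ge> 0" "\<And>s. Re s \<ge> \<sigma> \<Longrightarrow> \<bar>Im s\<bar> \<ge> 1 \<Longrightarrow> norm (zeta_ext s) \<le> 1 + C * norm s"
    using zeta_ext_bound[OF \<sigma>(1)] by blast
  define C' where "C' = 1 + C * (2 * real l + 1)"
  have C'1: "C' \<ge> 1" using C(1) by (simp add: C'_def)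
  show ?thesis
  proof (rule that[OF C'1])
    fix w T assume w: "0 \<le> Re w" "Re w \<le> 1" "1 \<le> Im w" "Im w \<le> T"
    have T: "T \<ge> 1" using w by simp
    have "norm (W w) = (\<Prod>j=1..l. norm (zeta_ext (of_real \<sigma> + of_nat j * w)))"
      by (simp add: W_def prod_norm)
    also have "\<dots> \<le> (\<Prod>j=1..l. C' * T)"
    proof (rule prod_mono, safe)
      fix j assume j: "j \<in> {1..l}"
      let ?s = "of_real \<sigma> + of_nat j * w"
      have "1 * 1 \<le> real j * Im w" using j w by (intro mult_mono) auto
      hence "norm (zeta_ext ?s) \<le> 1 + C * norm ?s" using w by (intro C(2)) auto
      also have "norm ?s \<le> \<sigma> + real j * norm w"
        using norm_triangle_ineq[of "of_real \<sigma>" "of_nat j * w"] \<sigma> by (simp add: norm_mult)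
      also have "\<dots> \<le> 1 * T + real l * (2 * T)"
      proof (intro add_mono mult_mono)
        have "norm w \<le> \<bar>Re w\<bar> + \<bar>Im w\<bar>" by (rule cmod_le)
        thus "norm w \<le> 2 * T" using w by simp
      qed (use \<sigma> j T in auto)
      finally have "norm (zeta_ext ?s) \<le> 1 + C * (1 * T + real l * (2 * T))" using C(1) by (auto simp: mult_left_mono)
      also have "\<dots> = 1 + (C' - 1) * T" by (simp add: C'_def algebra_simps)
      also have "\<dots> \<le> C' * T" using T by (simp add: algebra_simps)
      finally show "norm (zeta_ext ?s) \<le> C' * T" .
    qed auto
    finally show "norm (W w) \<le> (C' * T) ^ l" by simp
  qed
qed

text \<open>Convolving \<open>W\<close> on the imaginary axis with the Gaussian \<open>exp (- (c v)\<^sup>2 / 2)\<close> damps the coefficients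
  by its Fourier transform. This shortens the Dirichlet series to \<open>exp (O(c\<^sup>2))\<close>, while \<open>W\<close> may be
  evaluated to the left of its region of absolute convergence.\<close>

definition smooth_weight :: "real \<Rightarrow> (nat \<Rightarrow> nat) \<Rightarrow> real" where
  "smooth_weight c g = tuple_weight g * exp (- (ln (real (tuple_norm g)) / c)\<^sup>2 / 2)"

definition smooth_sum :: "real \<Rightarrow> (nat \<Rightarrow> nat) set \<Rightarrow> real \<Rightarrow> complex" where
  "smooth_sum c \<Gamma> t = (\<Sum>g\<in>\<Gamma>. of_real (smooth_weight c g) * cis (- (t * ln (real (tuple_norm g)))))"

lemma smooth_weight_nonneg: "smooth_weight c g \<ge> 0"
  by (simp add: smooth_weight_def tuple_weight_nonneg)

text \<open>From \<open>(x / c - c)\<^sup>2 \<ge> 0\<close> with \<open>x = ln n\<close>, the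
  damping is at most \<open>exp (c\<^sup>2 / 2) / n\<close>, which compares the sum with the
  convergent one at \<open>Re w = 1\<close>.\<close>

lemma sum_smooth_weight_le:
  assumes c: "c > 0" and \<Gamma>: "finite \<Gamma>" "\<Gamma> \<subseteq> tuples"
  shows "(\<Sum>g\<in>\<Gamma>. smooth_weight c g) \<le> exp (c\<^sup>2 / 2) * abs_mass"
proof -
  have "(\<Sum>g\<in>\<Gamma>. smooth_weight c g) \<le> (\<Sum>g\<in>\<Gamma>. exp (c\<^sup>2 / 2) * (tuple_weight g / real (tuple_norm g)))"
  proof (rule sum_mono)
    fix g assume g: "g \<in> \<Gamma>"
    let ?x = "ln (real (tuple_norm g))"
    have N: "tuple_norm g > 0" using tuple_norm_pos g \<Gamma> by auto
    have "(?x / c - c)\<^sup>2 \<ge> 0" by simp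
    hence "- (?x / c)\<^sup>2 / 2 \<le> c\<^sup>2 / 2 - ?x" using c by (simp add: power2_diff)
    hence "exp (- (?x / c)\<^sup>2 / 2) \<le> exp (c\<^sup>2 / 2 - ?x)" by simp
    also have "\<dots> = exp (c\<^sup>2 / 2) / real (tuple_norm g)" using N by (simp add: exp_diff)
    finally have "tuple_weight g * exp (- (?x / c)\<^sup>2 / 2) \<le> tuple_weight g * (exp (c\<^sup>2 / 2) / real (tuple_norm g))"
      by (rule mult_left_mono) (rule tuple_weight_nonneg)
    thus "smooth_weight c g \<le> exp (c\<^sup>2 / 2) * (tuple_weight g / real (tuple_norm g))"
      unfolding smooth_weight_def by (simp add: mult.commute)
  qed
  also have "\<dots> \<le> exp (c\<^sup>2 / 2) * abs_mass"
    unfolding sum_distrib_left[symmetric] by (intro mult_left_mono sum_abs_mass_le \<Gamma>) auto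
  finally show ?thesis .
qed

lemma norm_smooth_sum_le: "norm (smooth_sum c \<Gamma> t) \<le> (\<Sum>g\<in>\<Gamma>. smooth_weight c g)"
  unfolding smooth_sum_def by (rule sum_norm_le) (simp add: norm_mult smooth_weight_nonneg)

lemma smooth_sum_integral:
  assumes c: "c > 0"
  shows "integrable lborel (\<lambda>v. exp (of_real (c\<^sup>2 / 2) * (1 + \<i> * of_real v)\<^sup>2) * partial_prod \<Gamma> (Complex 1 (t0 + v)))"
    "(LINT v|lborel. exp (of_real (c\<^sup>2 / 2) * (1 + \<i> * of_real v)\<^sup>2) * partial_prod \<Gamma> (Complex 1 (t0 + v))) =
      of_real (sqrt (2 * pi) / c) * smooth_sum c \<Gamma> t0"
proof -
  have eq: "exp (of_real (c\<^sup>2 / 2) * (1 + \<i> * of_real v)\<^sup>2) * partial_prod \<Gamma> (Complex 1 (t0 + v)) =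
    (\<Sum>g\<in>\<Gamma>. of_real (tuple_weight g) * cis (- (t0 * ln (real (tuple_norm g)))) *
      (exp (of_real (c\<^sup>2 / 2) * (1 + \<i> * of_real v)\<^sup>2) * exp (- (1 + \<i> * of_real v) * of_real (ln (real (tuple_norm g))))))" for v
  proof -
    have "exp (- Complex 1 (t0 + v) * of_real x) = cis (- (t0 * x)) * exp (- (1 + \<i> * of_real v) * of_real x)" for x
    proof -
      have "- Complex 1 (t0 + v) * of_real x = \<i> * of_real (- (t0 * x)) + (- (1 + \<i> * of_real v) * of_real x)"
        by (simp add: complex_eq_iff algebra_simps)
      thus ?thesis by (simp only: exp_add cis_conv_exp)
    qed
    note * = this
    show ?thesis unfolding partial_prod_def sum_distrib_left
      by (rule sum.cong[OF refl], subst *) (simp only: mult_ac)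
  qed
  show "integrable lborel (\<lambda>v. exp (of_real (c\<^sup>2 / 2) * (1 + \<i> * of_real v)\<^sup>2) * partial_prod \<Gamma> (Complex 1 (t0 + v)))"
    unfolding eq by (intro Bochner_Integration.integrable_sum integrable_mult_right gauss_shifted(1) c)
  show "(LINT v|lborel. exp (of_real (c\<^sup>2 / 2) * (1 + \<i> * of_real v)\<^sup>2) * partial_prod \<Gamma> (Complex 1 (t0 + v))) =
      of_real (sqrt (2 * pi) / c) * smooth_sum c \<Gamma> t0"
    unfolding eq
    by (simp only: Bochner_Integration.integral_sum[OF integrable_mult_right[OF gauss_shifted(1)[OF c]]]
          integral_mult_right_zero gauss_shifted(2)[OF c] smooth_sum_def smooth_weight_def sum_distrib_left) (simp add: mult_ac)
qed

end

section \<open>The contour shift and the resonance inequality\<close>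

context zeta_product
begin

lemma norm_gauss_kernel:
  "norm (exp (of_real (c\<^sup>2 / 2) * (of_real x + \<i> * of_real v)\<^sup>2)) = exp (c\<^sup>2 / 2 * (x\<^sup>2 - v\<^sup>2))"
proof -
  have "Re (of_real (c\<^sup>2 / 2) * (of_real x + \<i> * of_real v)\<^sup>2) = c\<^sup>2 / 2 * (x\<^sup>2 - v\<^sup>2)"
    by (simp add: power2_eq_square)
  thus ?thesis by (simp only: norm_exp_eq_Re)
qed

lemma gauss_real_shifted:
  assumes "c > 0"
  shows "integrable lborel (\<lambda>u. exp (- (c * (u - t0))\<^sup>2 / 2))"
    "(LINT u|lborel. exp (- (c * (u - t0))\<^sup>2 / 2)) = sqrt (2 * pi) / c"
proof -
  have e: "- t0 + 1 * u = u - t0" for u by simp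
  show "integrable lborel (\<lambda>u. exp (- (c * (u - t0))\<^sup>2 / 2))"
    using lborel_integrable_real_affine[OF gauss_real(1)[OF assms], of 1 "- t0"] unfolding e by simp
  show "(LINT u|lborel. exp (- (c * (u - t0))\<^sup>2 / 2)) = sqrt (2 * pi) / c"
    using lborel_integral_real_affine[of 1 "\<lambda>v. exp (- (c * v)\<^sup>2 / 2)" "- t0"] gauss_real(2)[OF assms]
    unfolding e by simp
qed

text \<open>Origin of the summands: \<open>M\<close> is the integral over the imaginary axis;
  \<open>1\<close> is the replacement of \<open>W\<close> by a finite sum on \<open>Re = 1\<close>,
  where \<open>close\<close> offsets the size \<open>exp (c\<^sup>2 / 2)\<close> of the kernel; the
  third is the finite sum outside the window of half-width \<open>U\<close>; the last is the pair of
  horizontal sides.\<close>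

lemma smooth_sum_bound:
  assumes c: "c > 0" and \<Gamma>: "finite \<Gamma>" "\<Gamma> \<subseteq> tuples"
    and close: "abs_mass - (\<Sum>g\<in>\<Gamma>. tuple_weight g / real (tuple_norm g)) \<le> exp (- c\<^sup>2 / 2)"
    and U: "U > 0" "t0 - U \<ge> 1" "t0 + U \<le> T"
    and growth: "\<And>w. 0 \<le> Re w \<Longrightarrow> Re w \<le> 1 \<Longrightarrow> 1 \<le> Im w \<Longrightarrow> Im w \<le> T \<Longrightarrow> norm (W w) \<le> G"
    and M: "\<And>u. u \<in> {t0 - U..t0 + U} \<Longrightarrow> norm (W (Complex 0 u)) \<le> M"
  shows "norm (smooth_sum c \<Gamma> t0) \<le> M + 1 + sqrt 2 * abs_mass * exp (c\<^sup>2 / 2 - c\<^sup>2 * U\<^sup>2 / 4)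
     + c / sqrt (2 * pi) * (2 * (G * exp (c\<^sup>2 / 2 * (1 - U\<^sup>2))))"
proof -
  define a b where "a = t0 - U" and "b = t0 + U"
  have ab: "a < b" "a \<ge> 1" "b \<le> T" using U by (auto simp: a_def b_def)
  define S where "S = {w. Re w > - \<sigma> / real (l + 1) \<and> Im w > 0}"
  define f where "f = (\<lambda>w. exp (of_real (c\<^sup>2 / 2) * (w - \<i> * of_real t0)\<^sup>2) * W w)"
  define E where "E = (\<lambda>v. exp (of_real (c\<^sup>2 / 2) * (1 + \<i> * complex_of_real v)\<^sup>2))"
  have G0: "G \<ge> 0" using growth[of "Complex 0 a"] ab by (intro order.trans[OF norm_ge_zero]) auto
  have M0: "M \<ge> 0" using M[of t0] U by (intro order.trans[OF norm_ge_zero]) auto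
  have fhol: "f holomorphic_on S"
    unfolding f_def S_def by (intro holomorphic_intros W_holomorphic)
  have "S = {w. Re w > - \<sigma> / real (l + 1)} \<inter> {w. Im w > 0}" by (auto simp: S_def)
  hence convS: "convex S" by (simp add: convex_Int convex_halfspace_Re_gt convex_halfspace_Im_gt)
  have neg: "- \<sigma> / real (l + 1) < 0" using \<sigma> by (simp add: field_simps)
  have sub: "cbox (Complex 0 a) (Complex 1 b) \<subseteq> S"
    using ab neg by (auto simp: S_def in_cbox_complex_iff intro: less_le_trans)
  have nf: "norm (f (Complex x u)) = exp (c\<^sup>2 / 2 * (x\<^sup>2 - (u - t0)\<^sup>2)) * norm (W (Complex x u))" for x u
  proof -
    have "Complex x u - \<i> * of_real t0 = of_real x + \<i> * of_real (u - t0)" by (simp add: complex_eq_iff)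
    thus ?thesis unfolding f_def norm_mult by (simp only: norm_gauss_kernel)
  qed
  define B where "B = G * exp (c\<^sup>2 / 2 * (1 - U\<^sup>2))"
  have horiz: "norm (f (Complex x u)) \<le> B" if "0 \<le> x" "x \<le> 1" "u = a \<or> u = b" for x u
  proof -
    have "(u - t0)\<^sup>2 = U\<^sup>2" using that(3) by (auto simp: a_def b_def)
    moreover have "x\<^sup>2 \<le> 1" using that by (simp add: power_le_one)
    ultimately have "exp (c\<^sup>2 / 2 * (x\<^sup>2 - (u - t0)\<^sup>2)) \<le> exp (c\<^sup>2 / 2 * (1 - U\<^sup>2))"
      by (simp add: mult_left_mono)
    moreover have "norm (W (Complex x u)) \<le> G" using that ab by (intro growth) auto
    ultimately show ?thesis unfolding nf B_def using G0 by (subst mult.commute) (intro mult_mono, auto)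
  qed
  have shift: "norm (integral {a..b} (\<lambda>v. f (Complex 1 v)) - integral {a..b} (\<lambda>v. f (Complex 0 v))) \<le> 2 * B"
    by (rule rectangle_shift[OF fhol convS sub ab(1)]) (use horiz in auto)
  have fcont: "continuous_on {a..b} (\<lambda>u. f (Complex x u))" if "x \<in> {0, 1}" for x
  proof -
    have "continuous_on {a..b} (f \<circ> (\<lambda>u. Complex x u))"
    proof (rule continuous_on_compose)
      show "continuous_on {a..b} (\<lambda>u. Complex x u)" by (simp add: Complex_eq) (intro continuous_intros)
      show "continuous_on ((\<lambda>u. Complex x u) ` {a..b}) f"
        by (rule continuous_on_subset[OF holomorphic_on_imp_continuous_on[OF fhol]])
           (use that sub in \<open>auto simp: in_cbox_complex_iff subset_iff\<close>)
    qed
    thus ?thesis by (simp add: o_def)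
  qed
  have fint: "set_integrable lborel {a..b} (\<lambda>u. f (Complex x u))" if "x \<in> {0, 1}" for x
    by (rule borel_integrable_atLeastAtMost') (rule fcont[OF that])
  have fLint: "(LINT u|lborel. indicator {a..b} u *\<^sub>R f (Complex x u)) = integral {a..b} (\<lambda>u. f (Complex x u))"
    if "x \<in> {0, 1}" for x
    using set_borel_integral_eq_integral(2)[OF fint[OF that]] by (simp add: set_lebesgue_integral_def)
  have left: "norm (integral {a..b} (\<lambda>v. f (Complex 0 v))) \<le> M * (sqrt (2 * pi) / c)"
  proof -
    have "norm (integral {a..b} (\<lambda>v. f (Complex 0 v))) \<le> (LINT u|lborel. norm (indicator {a..b} u *\<^sub>R f (Complex 0 u)))"
      unfolding fLint[of 0, simplified, symmetric] by (rule integral_norm_bound)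
    also have "\<dots> \<le> (LINT u|lborel. M * exp (- (c * (u - t0))\<^sup>2 / 2))"
    proof (rule integral_mono)
      show "integrable lborel (\<lambda>u. norm (indicator {a..b} u *\<^sub>R f (Complex 0 u)))"
        using fint[of 0] by (intro integrable_norm) (simp add: set_integrable_def)
      show "integrable lborel (\<lambda>u. M * exp (- (c * (u - t0))\<^sup>2 / 2))"
        by (intro integrable_mult_right gauss_real_shifted c)
      fix u
      show "norm (indicator {a..b} u *\<^sub>R f (Complex 0 u)) \<le> M * exp (- (c * (u - t0))\<^sup>2 / 2)"
      proof (cases "u \<in> {a..b}")
        case True
        have "norm (f (Complex 0 u)) = exp (- (c * (u - t0))\<^sup>2 / 2) * norm (W (Complex 0 u))"
          unfolding nf by (simp add: power_mult_distrib)
        also have "\<dots> \<le> exp (- (c * (u - t0))\<^sup>2 / 2) * M"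
          using True M[of u] by (intro mult_left_mono) (auto simp: a_def b_def)
        finally show ?thesis using True by (simp add: mult.commute)
      qed (simp add: M0)
    qed
    also have "\<dots> = M * (sqrt (2 * pi) / c)" by (simp only: integral_mult_right_zero gauss_real_shifted(2)[OF c])
    finally show ?thesis .
  qed
  define P where "P = (\<lambda>u. E (u - t0) * partial_prod \<Gamma> (Complex 1 u))"
  have aff: "- t0 + 1 * u = u - t0" for u :: real by simp
  have Pint: "integrable lborel P"
    using lborel_integrable_real_affine[OF smooth_sum_integral(1)[OF c, of \<Gamma> t0], of 1 "- t0"]
    unfolding aff P_def E_def by simp
  have PL: "(LINT u|lborel. P u) = of_real (sqrt (2 * pi) / c) * smooth_sum c \<Gamma> t0"
    using lborel_integral_real_affine[of 1 "\<lambda>v. E v * partial_prod \<Gamma> (Complex 1 (t0 + v))" "- t0"] smooth_sum_integral(2)[OF c, of \<Gamma> t0]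
    unfolding aff P_def E_def by simp
  have nE: "norm (E v) = exp (c\<^sup>2 / 2 * (1 - v\<^sup>2))" for v
    unfolding E_def using norm_gauss_kernel[of c 1 v] by simp
  have c2: "c / sqrt 2 > 0" using c by simp
  have diff: "norm ((LINT u|lborel. P u) - (LINT u|lborel. indicator {a..b} u *\<^sub>R f (Complex 1 u))) \<le>
      sqrt (2 * pi) / c + abs_mass * exp (c\<^sup>2 / 2 - c\<^sup>2 * U\<^sup>2 / 4) * (sqrt (2 * pi) / (c / sqrt 2))"
  proof -
    have if1: "integrable lborel (\<lambda>u. indicator {a..b} u *\<^sub>R f (Complex 1 u))"
      using fint[of 1] by (simp add: set_integrable_def)
    have "(LINT u|lborel. P u) - (LINT u|lborel. indicator {a..b} u *\<^sub>R f (Complex 1 u)) =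
       (LINT u|lborel. P u - indicator {a..b} u *\<^sub>R f (Complex 1 u))"
      by (rule Bochner_Integration.integral_diff[OF Pint if1, symmetric])
    also have "norm \<dots> \<le> (LINT u|lborel. norm (P u - indicator {a..b} u *\<^sub>R f (Complex 1 u)))"
      by (rule integral_norm_bound)
    also have "\<dots> \<le> (LINT u|lborel. exp (- (c * (u - t0))\<^sup>2 / 2) +
        abs_mass * exp (c\<^sup>2 / 2 - c\<^sup>2 * U\<^sup>2 / 4) * exp (- (c / sqrt 2 * (u - t0))\<^sup>2 / 2))"
    proof (rule integral_mono)
      show "integrable lborel (\<lambda>u. norm (P u - indicator {a..b} u *\<^sub>R f (Complex 1 u)))"
        by (intro integrable_norm Bochner_Integration.integrable_diff Pint if1)
      show "integrable lborel (\<lambda>u. exp (- (c * (u - t0))\<^sup>2 / 2) +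
        abs_mass * exp (c\<^sup>2 / 2 - c\<^sup>2 * U\<^sup>2 / 4) * exp (- (c / sqrt 2 * (u - t0))\<^sup>2 / 2))"
        by (intro Bochner_Integration.integrable_add integrable_mult_right gauss_real_shifted c c2)
      fix u
      have W1: "norm (W (Complex 1 u) - partial_prod \<Gamma> (Complex 1 u)) \<le> exp (- c\<^sup>2 / 2)"
        using norm_W_minus_partial_prod[OF \<Gamma>, of "Complex 1 u"] close by simp
      have partial_prod1: "norm (partial_prod \<Gamma> (Complex 1 u)) \<le> abs_mass"
        using norm_partial_prod_le[OF \<Gamma>, of "Complex 1 u"] sum_abs_mass_le[OF \<Gamma>] by simp
      show "norm (P u - indicator {a..b} u *\<^sub>R f (Complex 1 u)) \<le> exp (- (c * (u - t0))\<^sup>2 / 2) +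
        abs_mass * exp (c\<^sup>2 / 2 - c\<^sup>2 * U\<^sup>2 / 4) * exp (- (c / sqrt 2 * (u - t0))\<^sup>2 / 2)"
      proof (cases "u \<in> {a..b}")
        case True
        have "Complex 1 u - \<i> * of_real t0 = 1 + \<i> * of_real (u - t0)" by (simp add: complex_eq_iff)
        hence "f (Complex 1 u) = E (u - t0) * W (Complex 1 u)" by (simp only: f_def E_def)
        hence "P u - indicator {a..b} u *\<^sub>R f (Complex 1 u) = - (E (u - t0) * (W (Complex 1 u) - partial_prod \<Gamma> (Complex 1 u)))"
          using True by (simp add: P_def algebra_simps)
        hence "norm (P u - indicator {a..b} u *\<^sub>R f (Complex 1 u)) =
            norm (E (u - t0)) * norm (W (Complex 1 u) - partial_prod \<Gamma> (Complex 1 u))"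
          by (simp only: norm_minus_cancel norm_mult)
        also have "\<dots> \<le> exp (c\<^sup>2 / 2 * (1 - (u - t0)\<^sup>2)) * exp (- c\<^sup>2 / 2)"
          unfolding nE using W1 by (intro mult_left_mono) auto
        also have "\<dots> = exp (- (c * (u - t0))\<^sup>2 / 2)"
        proof -
          have "c\<^sup>2 / 2 * (1 - X) + - c\<^sup>2 / 2 = - (c\<^sup>2 * X) / 2" for X :: real
            by (simp add: right_diff_distrib diff_divide_distrib)
          thus ?thesis unfolding exp_add[symmetric] power_mult_distrib by simp
        qed
        finally show ?thesis using abs_mass_nonneg by (simp add: add_increasing2)
      next
        case False
        hence "(u - t0)\<^sup>2 \<ge> U\<^sup>2" using U(1) by (auto simp: a_def b_def abs_le_square_iff[symmetric])
        \<comment> \<open>Half of the Gaussian decay yields the small factor in \<open>U\<close>,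
          the other half keeps the integral over \<open>u\<close> finite; hence the width parameter
          \<open>c / sqrt 2\<close>.\<close>
        hence ex: "c\<^sup>2 / 2 * (1 - (u - t0)\<^sup>2) \<le> (c\<^sup>2 / 2 - c\<^sup>2 * U\<^sup>2 / 4) + (- (c / sqrt 2 * (u - t0))\<^sup>2 / 2)"
        proof -
          have "(c / sqrt 2 * (u - t0))\<^sup>2 = c\<^sup>2 * (u - t0)\<^sup>2 / 2"
            by (simp only: power_mult_distrib power_divide) simp
          moreover have "c\<^sup>2 / 2 * (1 - X) = c\<^sup>2 / 2 - c\<^sup>2 * X / 2" for X :: real
            by (simp add: right_diff_distrib)
          moreover have "c\<^sup>2 * U\<^sup>2 \<le> c\<^sup>2 * (u - t0)\<^sup>2"
            using \<open>(u - t0)\<^sup>2 \<ge> U\<^sup>2\<close> by (rule mult_left_mono) simp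
          ultimately show ?thesis by (simp only:)
        qed
        have "norm (P u - indicator {a..b} u *\<^sub>R f (Complex 1 u)) = norm (E (u - t0)) * norm (partial_prod \<Gamma> (Complex 1 u))"
          using False by (simp add: P_def norm_mult)
        also have "\<dots> \<le> exp ((c\<^sup>2 / 2 - c\<^sup>2 * U\<^sup>2 / 4) + (- (c / sqrt 2 * (u - t0))\<^sup>2 / 2)) * abs_mass"
          unfolding nE using partial_prod1 ex by (intro mult_mono) auto
        also have "\<dots> = abs_mass * exp (c\<^sup>2 / 2 - c\<^sup>2 * U\<^sup>2 / 4) * exp (- (c / sqrt 2 * (u - t0))\<^sup>2 / 2)"
          unfolding exp_add by (simp only: mult_ac)
        finally show ?thesis by (simp add: add_increasing)
      qed
    qed
    also have "\<dots> = sqrt (2 * pi) / c + abs_mass * exp (c\<^sup>2 / 2 - c\<^sup>2 * U\<^sup>2 / 4) * (sqrt (2 * pi) / (c / sqrt 2))"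
      by (simp only: Bochner_Integration.integral_add[OF gauss_real_shifted(1)[OF c] integrable_mult_right[OF gauss_real_shifted(1)[OF c2]]]
            integral_mult_right_zero gauss_real_shifted(2)[OF c] gauss_real_shifted(2)[OF c2])
    finally show ?thesis .
  qed
  define q where "q = sqrt (2 * pi) / c"
  have q: "q > 0" using c by (simp add: q_def)
  have "q * norm (smooth_sum c \<Gamma> t0) = norm (LINT u|lborel. P u)"
    unfolding PL norm_mult using q by (simp add: q_def norm_divide abs_of_pos c)
  also have "\<dots> \<le> norm ((LINT u|lborel. P u) - (LINT u|lborel. indicator {a..b} u *\<^sub>R f (Complex 1 u)))
      + norm (integral {a..b} (\<lambda>v. f (Complex 1 v)) - integral {a..b} (\<lambda>v. f (Complex 0 v)))
      + norm (integral {a..b} (\<lambda>v. f (Complex 0 v)))"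
  proof -
    have "norm x \<le> norm (x - a) + norm (a - b) + norm b" for x a b :: complex
      using norm_triangle_ineq[of "x - a" a] norm_triangle_ineq[of "a - b" b] by simp
    thus ?thesis unfolding fLint[of 1, simplified] .
  qed
  also have "\<dots> \<le> (q + abs_mass * exp (c\<^sup>2 / 2 - c\<^sup>2 * U\<^sup>2 / 4) * (sqrt (2 * pi) / (c / sqrt 2))) + 2 * B + M * q"
    using diff shift left by (intro add_mono) (auto simp: q_def)
  also have "\<dots> = q * (M + 1 + sqrt 2 * abs_mass * exp (c\<^sup>2 / 2 - c\<^sup>2 * U\<^sup>2 / 4) + c / sqrt (2 * pi) * (2 * B))"
    using c by (simp add: q_def field_simps)
  finally show ?thesis using q unfolding B_def by (simp only: mult_le_cancel_left_pos)
qed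

text \<open>The coefficients are real. This transfers bounds for positive \<open>t\<close> to the
  symmetric range of the resonance integral.\<close>

lemma smooth_sum_uminus: "norm (smooth_sum c \<Gamma> (- t)) = norm (smooth_sum c \<Gamma> t)"
proof -
  have "smooth_sum c \<Gamma> (- t) = cnj (smooth_sum c \<Gamma> t)" by (simp add: smooth_sum_def cis_cnj)
  thus ?thesis by simp
qed

text \<open>Three ranges: for \<open>\<bar>t\<bar> \<le> t1\<close> both factors are bounded
  trivially, up to \<open>t2\<close> the bound \<open>M\<close> is used, beyond it the Gaussian.
  After division by \<open>mass\<close>, \<open>mass_ge\<close> turns the error terms into the ratio
  of \<open>(suminf r)\<^sup>2\<close> to the sum of squares.\<close>

lemma resonance_bound:
  assumes c: "c > 0" and \<Gamma>: "finite \<Gamma>" "\<Gamma> \<subseteq> tuples" and res: "resonator r k"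
    and t1: "0 \<le> t1" and M: "\<And>t. t \<in> {t1..t2} \<Longrightarrow> norm (smooth_sum c \<Gamma> t) \<le> M"
    and t12: "t1 \<le> t2" and rsq: "(\<Sum>n. (r n)\<^sup>2) > 0"
  shows "(\<Sum>g\<in>\<Gamma>. smooth_weight c g * r (tuple_norm g)) \<le>
     M + exp (c\<^sup>2 / 2) * abs_mass * ((suminf r)\<^sup>2 / (\<Sum>n. (r n)\<^sup>2)) * (k * t1 + 2 * exp (- (k * t2)\<^sup>2 / 4))"
proof -
  interpret resonator r k by (rule res)
  define D0 where "D0 = exp (c\<^sup>2 / 2) * abs_mass"
  define Q where "Q = D0 * (suminf r)\<^sup>2"
  have D0: "norm (smooth_sum c \<Gamma> t) \<le> D0" for t
    using norm_smooth_sum_le[of c \<Gamma> t] sum_smooth_weight_le[OF c \<Gamma>] by (simp add: D0_def)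
  have D00: "D0 \<ge> 0" using abs_mass_nonneg by (simp add: D0_def)
  hence Q0: "Q \<ge> 0" by (simp add: Q_def)
  have M0: "M \<ge> 0" using order.trans[OF norm_ge_zero M[of t1]] t12 by simp
  define m where "m = (\<Sum>n. (r n)\<^sup>2) * (sqrt (2 * pi) / k)"
  have m: "m > 0" "m \<le> mass" using rsq c_pos mass_ge by (auto simp: m_def)
  have k2: "k / sqrt 2 > 0" using c_pos by simp
  have Dm [measurable]: "smooth_sum c \<Gamma> \<in> borel_measurable borel" unfolding smooth_sum_def[abs_def]
    by (intro borel_measurable_continuous_onI continuous_intros continuous_on_cis)
  have iB: "integrable lborel (\<lambda>t. M * ((norm (R t))\<^sup>2 * K t) +
      (Q * indicator {-t1..t1} t + Q * exp (- (k * t2)\<^sup>2 / 4) * exp (- (k / sqrt 2 * t)\<^sup>2 / 2)))"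
    by (intro Bochner_Integration.integrable_add integrable_mult_right mass_integrable gauss_real(1)[OF k2]
         integrable_real_indicator) (use t1 in auto)
  have "(\<Sum>g\<in>\<Gamma>. smooth_weight c g * r (tuple_norm g)) * mass \<le> (LINT t|lborel. norm (smooth_sum c \<Gamma> t) * ((norm (R t))\<^sup>2 * K t))"
    unfolding smooth_sum_def using \<Gamma> tuple_norm_pos by (intro resonance) (auto simp: smooth_weight_nonneg)
  also have "\<dots> \<le> (LINT t|lborel. M * ((norm (R t))\<^sup>2 * K t) +
      (Q * indicator {-t1..t1} t + Q * exp (- (k * t2)\<^sup>2 / 4) * exp (- (k / sqrt 2 * t)\<^sup>2 / 2)))"
  proof (rule integral_mono[OF _ iB])
    show "integrable lborel (\<lambda>t. norm (smooth_sum c \<Gamma> t) * ((norm (R t))\<^sup>2 * K t))"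
    proof (rule Bochner_Integration.integrable_bound)
      show "integrable lborel (\<lambda>t. D0 * ((norm (R t))\<^sup>2 * K t))" by (intro integrable_mult_right mass_integrable)
      show "AE t in lborel. norm (norm (smooth_sum c \<Gamma> t) * ((norm (R t))\<^sup>2 * K t)) \<le> norm (D0 * ((norm (R t))\<^sup>2 * K t))"
        using D0 D00 by (intro AE_I2) (auto simp: abs_mult K_nonneg intro!: mult_right_mono)
    qed measurable
    fix t
    have RK: "(norm (R t))\<^sup>2 * K t \<ge> 0" by (simp add: K_nonneg)
    have Rb: "norm (smooth_sum c \<Gamma> t) * (norm (R t))\<^sup>2 \<le> Q"
      unfolding Q_def by (intro mult_mono D0 power_mono norm_R_le D00) auto
    have all: "norm (smooth_sum c \<Gamma> t) * ((norm (R t))\<^sup>2 * K t) \<le> Q * K t"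
      using mult_right_mono[OF Rb K_nonneg[of t]] by (simp add: mult.assoc)
    have Q1: "0 \<le> Q * indicator {-t1..t1} t" "0 \<le> Q * exp (- (k * t2)\<^sup>2 / 4) * exp (- (k / sqrt 2 * t)\<^sup>2 / 2)"
      using Q0 by auto
    have M1: "0 \<le> M * ((norm (R t))\<^sup>2 * K t)" using M0 RK by simp
    consider "\<bar>t\<bar> \<le> t1" | "t1 < \<bar>t\<bar>" "\<bar>t\<bar> \<le> t2" | "\<bar>t\<bar> > t2" by linarith
    thus "norm (smooth_sum c \<Gamma> t) * ((norm (R t))\<^sup>2 * K t) \<le> M * ((norm (R t))\<^sup>2 * K t) +
      (Q * indicator {-t1..t1} t + Q * exp (- (k * t2)\<^sup>2 / 4) * exp (- (k / sqrt 2 * t)\<^sup>2 / 2))"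
    proof cases
      case 1
      have "t \<in> {-t1..t1}" using 1 by (auto simp: abs_le_iff)
      hence "Q * K t \<le> Q * indicator {-t1..t1} t" using Q0 by (auto simp: K_def intro!: mult_left_le)
      thus ?thesis using all Q1 M1 by linarith
    next
      case 2
      have "norm (smooth_sum c \<Gamma> \<bar>t\<bar>) \<le> M" using 2 by (intro M) auto
      hence "norm (smooth_sum c \<Gamma> t) \<le> M" using smooth_sum_uminus[of c \<Gamma> t] by (cases "t \<ge> 0") auto
      hence "norm (smooth_sum c \<Gamma> t) * ((norm (R t))\<^sup>2 * K t) \<le> M * ((norm (R t))\<^sup>2 * K t)"
        using RK by (rule mult_right_mono)
      thus ?thesis using Q1 by linarith
    next
      case 3
      have "t2\<^sup>2 \<le> t\<^sup>2" using 3 t1 t12 by (simp add: abs_le_square_iff[symmetric])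
      hence "- (k * t)\<^sup>2 / 2 \<le> - (k * t2)\<^sup>2 / 4 + - (k / sqrt 2 * t)\<^sup>2 / 2"
        using mult_left_mono[of "t2\<^sup>2" "t\<^sup>2" "k\<^sup>2"] by (simp add: power_mult_distrib power_divide)
      hence "K t \<le> exp (- (k * t2)\<^sup>2 / 4) * exp (- (k / sqrt 2 * t)\<^sup>2 / 2)"
        unfolding K_def exp_add[symmetric] by simp
      hence "Q * K t \<le> Q * (exp (- (k * t2)\<^sup>2 / 4) * exp (- (k / sqrt 2 * t)\<^sup>2 / 2))"
        using Q0 by (rule mult_left_mono)
      thus ?thesis using all Q1 M1 by (simp only: mult.assoc)
    qed
  qed
  also have "\<dots> = M * mass + (Q * (2 * t1) + Q * exp (- (k * t2)\<^sup>2 / 4) * (sqrt (2 * pi) / (k / sqrt 2)))"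
  proof -
    have i1: "integrable lborel (\<lambda>t. M * ((norm (R t))\<^sup>2 * K t))" by (intro integrable_mult_right mass_integrable)
    have i2: "integrable lborel (\<lambda>t. Q * indicator {-t1..t1} t)"
      by (intro integrable_mult_right integrable_real_indicator) (use t1 in auto)
    have i3: "integrable lborel (\<lambda>t. Q * exp (- (k * t2)\<^sup>2 / 4) * exp (- (k / sqrt 2 * t)\<^sup>2 / 2))"
      by (intro integrable_mult_right gauss_real(1)[OF k2])
    have e2: "(LINT t|lborel. indicator {-t1..t1} t) = 2 * t1" using t1 by simp
    show ?thesis
      by (simp only: Bochner_Integration.integral_add[OF i1 Bochner_Integration.integrable_add[OF i2 i3]]
        Bochner_Integration.integral_add[OF i2 i3] integral_mult_right_zero e2 gauss_real(2)[OF k2] mass_def)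
  qed
  finally have main: "(\<Sum>g\<in>\<Gamma>. smooth_weight c g * r (tuple_norm g)) * mass \<le> M * mass + Q * (2 * t1 + exp (- (k * t2)\<^sup>2 / 4) * (sqrt (2 * pi) / (k / sqrt 2)))"
    by (simp add: distrib_left)
  define X where "X = 2 * t1 + exp (- (k * t2)\<^sup>2 / 4) * (sqrt (2 * pi) / (k / sqrt 2))"
  have X0: "X \<ge> 0" using t1 c_pos by (simp add: X_def)
  have "(\<Sum>g\<in>\<Gamma>. smooth_weight c g * r (tuple_norm g)) \<le> (M * mass + Q * X) / mass"
    using main m by (simp add: pos_le_divide_eq X_def)
  also have "\<dots> = M + Q * X / mass" using m by (simp add: add_divide_distrib)
  also have "Q * X / mass \<le> Q * X / m" using m Q0 X0 by (intro divide_left_mono) auto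
  also have "Q * X / m = D0 * ((suminf r)\<^sup>2 / (\<Sum>n. (r n)\<^sup>2)) * (k / sqrt (2 * pi) * X)"
    using c_pos by (simp add: Q_def m_def)
  also have "k / sqrt (2 * pi) * X \<le> k * t1 + 2 * exp (- (k * t2)\<^sup>2 / 4)"
  proof -
    have s2: "sqrt (2 * pi) \<ge> 2" using pi_gt3 by (intro real_le_rsqrt) auto
    have "k / sqrt (2 * pi) * X = k * t1 * (2 / sqrt (2 * pi)) + sqrt 2 * exp (- (k * t2)\<^sup>2 / 4)"
      using c_pos by (simp add: X_def field_simps)
    moreover have "k * t1 * (2 / sqrt (2 * pi)) \<le> k * t1 * 1"
      using c_pos t1 s2 by (intro mult_left_mono) auto
    moreover have "sqrt 2 * exp (- (k * t2)\<^sup>2 / 4) \<le> 2 * exp (- (k * t2)\<^sup>2 / 4)"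
      by (intro mult_right_mono) (auto intro: real_le_lsqrt)
    ultimately show ?thesis by linarith
  qed
  hence "D0 * ((suminf r)\<^sup>2 / (\<Sum>n. (r n)\<^sup>2)) * (k / sqrt (2 * pi) * X) \<le>
      D0 * ((suminf r)\<^sup>2 / (\<Sum>n. (r n)\<^sup>2)) * (k * t1 + 2 * exp (- (k * t2)\<^sup>2 / 4))"
    using D00 rsq by (intro mult_left_mono) auto
  finally show ?thesis by (simp add: D0_def)
qed

end

section \<open>Rankin's trick and Euler products\<close>

lemma sum_powr_le:
  assumes "0 < s" "s < 1" "Y \<ge> 1"
  shows "(\<Sum>n=1..Y. real n powr (-s)) \<le> real Y powr (1 - s) / (1 - s)"
proof -
  have "(\<Sum>n=1..Y. (real n / real Y) powr (-s)) \<le> real Y * (1 powr (1 - s) / (1 - s) - 0 powr (1 - s) / (1 - s))"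
  proof (rule antimono_sum_le_antiderivative)
    show "continuous_on {0..1} (\<lambda>u::real. u powr (1 - s) / (1 - s))"
    proof -
      have c: "continuous_on {0..1} (\<lambda>u::real. u powr (1 - s))"
        using assms by (intro continuous_on_powr' continuous_on_id continuous_on_const) auto
      show ?thesis using continuous_on_mult[OF c continuous_on_const[of _ "1 / (1 - s)"]] by simp
    qed
    show "((\<lambda>u. u powr (1 - s) / (1 - s)) has_real_derivative x powr (-s)) (at x)" if "0 < x" for x
      using assms that by (auto intro!: derivative_eq_intros)
    show "y powr (-s) \<le> x powr (-s)" if "0 < x" "x \<le> y" for x y :: real
      using assms that by (intro powr_mono2') auto
  qed (use assms in auto)
  also have "\<dots> = real Y / (1 - s)" using assms by simp
  also have "(\<Sum>n=1..Y. (real n / real Y) powr (-s)) = (\<Sum>n=1..Y. real n powr (-s)) * real Y powr s"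
  proof -
    have "(real n / real Y) powr (-s) = real n powr (-s) * real Y powr s" for n
      using assms by (simp add: powr_divide powr_minus field_simps)
    thus ?thesis by (simp add: sum_distrib_right)
  qed
  finally have "(\<Sum>n=1..Y. real n powr (-s)) * real Y powr s * real Y powr (-s) \<le> real Y / (1 - s) * real Y powr (-s)"
    by (rule mult_right_mono) auto
  moreover have "real Y powr s * real Y powr (-s) = 1" using assms by (simp flip: powr_add)
  moreover have "real Y / (1 - s) * real Y powr (-s) = real Y powr (1 - s) / (1 - s)"
    using assms by (simp add: powr_diff powr_minus field_simps)
  ultimately show ?thesis using assms by (simp add: mult.assoc)
qed

context zeta_product
begin

text \<open>Rankin's trick with \<open>x = ln n\<close>: for \<open>x \<le> c\<close> the damping is
  at least \<open>exp (- 1 / 2)\<close>, and for \<open>x > c\<close> the factor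
  \<open>1 - exp (\<alpha> * (x - c))\<close> is negative. Ignoring the damping thus costs only a
  sum weighted by \<open>n powr \<alpha>\<close>.\<close>

lemma sum_smooth_weight_lower:
  assumes c: "c > 0" and \<alpha>: "\<alpha> > 0" and \<Gamma>: "finite \<Gamma>" "\<Gamma> \<subseteq> tuples" and r: "\<And>n. r n \<ge> 0"
  shows "(\<Sum>g\<in>\<Gamma>. smooth_weight c g * r (tuple_norm g)) \<ge> exp (- 1 / 2) *
    ((\<Sum>g\<in>\<Gamma>. tuple_weight g * r (tuple_norm g)) - exp (- (\<alpha> * c)) * (\<Sum>g\<in>\<Gamma>. tuple_weight g * r (tuple_norm g) * real (tuple_norm g) powr \<alpha>))"
proof -
  have "exp (- 1 / 2) * ((\<Sum>g\<in>\<Gamma>. tuple_weight g * r (tuple_norm g)) - exp (- (\<alpha> * c)) * (\<Sum>g\<in>\<Gamma>. tuple_weight g * r (tuple_norm g) * real (tuple_norm g) powr \<alpha>)) =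
    (\<Sum>g\<in>\<Gamma>. tuple_weight g * r (tuple_norm g) * (exp (- 1 / 2) * (1 - exp (- (\<alpha> * c)) * real (tuple_norm g) powr \<alpha>)))"
    by (simp add: sum_distrib_left sum_subtractf[symmetric] algebra_simps)
  also have "\<dots> \<le> (\<Sum>g\<in>\<Gamma>. smooth_weight c g * r (tuple_norm g))"
  proof (rule sum_mono)
    fix g assume g: "g \<in> \<Gamma>"
    define x where "x = ln (real (tuple_norm g))"
    have N: "tuple_norm g > 0" using g \<Gamma> tuple_norm_pos by auto
    have x0: "x \<ge> 0" using N by (simp add: x_def)
    have e: "exp (- (\<alpha> * c)) * real (tuple_norm g) powr \<alpha> = exp (\<alpha> * (x - c))"
      using N by (simp add: powr_def x_def right_diff_distrib flip: exp_add)
    have "exp (- 1 / 2) * (1 - exp (- (\<alpha> * c)) * real (tuple_norm g) powr \<alpha>) \<le> exp (- (x / c)\<^sup>2 / 2)"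
    proof (cases "x \<le> c")
      case True
      have "(x / c)\<^sup>2 \<le> 1" using True x0 c by (intro power_le_one) auto
      hence "exp (- 1 / 2) \<le> exp (- (x / c)\<^sup>2 / 2)" by simp
      moreover have "exp (- 1 / 2) * (1 - exp (\<alpha> * (x - c))) \<le> exp (- 1 / 2 :: real) * 1"
        by (intro mult_left_mono) auto
      ultimately show ?thesis unfolding e by linarith
    next
      case False
      have "exp (\<alpha> * (x - c)) \<ge> 1" using False \<alpha> by simp
      hence "exp (- 1 / 2) * (1 - exp (\<alpha> * (x - c))) \<le> 0" by (intro mult_nonneg_nonpos) auto
      thus ?thesis unfolding e using exp_ge_zero[of "- (x / c)\<^sup>2 / 2"] by linarith
    qed
    from mult_left_mono[OF this, of "tuple_weight g * r (tuple_norm g)"]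
    show "tuple_weight g * r (tuple_norm g) * (exp (- 1 / 2) * (1 - exp (- (\<alpha> * c)) * real (tuple_norm g) powr \<alpha>)) \<le> smooth_weight c g * r (tuple_norm g)"
      using tuple_weight_nonneg[of g] r[of "tuple_norm g"] by (simp add: smooth_weight_def x_def mult_ac)
  qed
  finally show ?thesis .
qed

text \<open>The sum over tuples of \<open>tuple_weight g * cmult_ext \<rho> (tuple_norm g) *
  tuple_norm g powr \<alpha>\<close>. Coordinate \<open>j\<close> enters \<open>tuple_norm\<close>
  with exponent \<open>j\<close>, whence \<open>j * \<alpha>\<close> and
  \<open>\<rho> p ^ j\<close>.\<close>

definition euler :: "nat set \<Rightarrow> (nat \<Rightarrow> real) \<Rightarrow> real \<Rightarrow> real" where
  "euler P \<rho> \<alpha> = (\<Prod>j=1..l. \<Prod>p\<in>P. 1 / (1 - real p powr (- \<sigma> + real j * \<alpha>) * \<rho> p ^ j))"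

lemma euler_has_sum:
  assumes P: "finite P" "\<And>p. p \<in> P \<Longrightarrow> prime p" and \<rho>: "\<And>p. p \<in> P \<Longrightarrow> 0 \<le> \<rho> p" "\<And>p. p \<in> P \<Longrightarrow> \<rho> p < 1"
    "\<And>p. prime p \<Longrightarrow> p \<notin> P \<Longrightarrow> \<rho> p = 0" and \<alpha>: "\<alpha> \<ge> 0" "real l * \<alpha> \<le> \<sigma>"
  shows "((\<lambda>g. tuple_weight g * cmult_ext \<rho> (tuple_norm g) * real (tuple_norm g) powr \<alpha>) has_sum euler P \<rho> \<alpha>) tuples"
proof -
  let ?f = "\<lambda>j n. real n powr (- \<sigma> + real j * \<alpha>) * cmult_ext \<rho> n ^ j"
  have nn: "cmult_ext \<rho> n \<ge> 0" for n using \<rho> by (intro cmult_ext_nonneg) (metis order_refl)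
  have f: "(?f j has_sum (\<Prod>p\<in>P. 1 / (1 - real p powr (- \<sigma> + real j * \<alpha>) * \<rho> p ^ j))) {1..}"
    if j: "j \<in> {1..l}" for j
  proof -
    have a: "- \<sigma> + real j * \<alpha> \<le> 0"
      using mult_right_mono[of "real j" "real l" \<alpha>] j \<alpha> by simp
    have "(cmult_ext (\<lambda>p. real p powr (- \<sigma> + real j * \<alpha>) * \<rho> p ^ j) has_sum
       (\<Prod>p\<in>P. 1 / (1 - real p powr (- \<sigma> + real j * \<alpha>) * \<rho> p ^ j))) UNIV"
    proof (rule cmult_ext_has_sum[OF P])
      fix p assume p: "p \<in> P"
      show "0 \<le> real p powr (- \<sigma> + real j * \<alpha>) * \<rho> p ^ j" using \<rho>(1)[OF p] by simp
      have "real p powr (- \<sigma> + real j * \<alpha>) \<le> real p powr 0"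
        using a prime_ge_1_nat[OF P(2)[OF p]] by (intro powr_mono) auto
      hence 1: "real p powr (- \<sigma> + real j * \<alpha>) \<le> 1" using prime_gt_0_nat[OF P(2)[OF p]] by simp
      have 2: "\<rho> p ^ j < 1" using \<rho>(1,2)[OF p] j by (intro power_less_one_iff[THEN iffD2]) auto
      have "real p powr (- \<sigma> + real j * \<alpha>) * \<rho> p ^ j \<le> 1 * \<rho> p ^ j"
        using 1 \<rho>(1)[OF p] by (intro mult_right_mono) auto
      with 2 show "real p powr (- \<sigma> + real j * \<alpha>) * \<rho> p ^ j < 1" by simp
    qed (use \<rho>(3) j in auto)
    also have "cmult_ext (\<lambda>p. real p powr (- \<sigma> + real j * \<alpha>) * \<rho> p ^ j) = ?f j"
      using j by (intro ext cmult_ext_powr[symmetric]) auto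
    also have "(?f j has_sum (\<Prod>p\<in>P. 1 / (1 - real p powr (- \<sigma> + real j * \<alpha>) * \<rho> p ^ j))) UNIV \<longleftrightarrow>
       (?f j has_sum (\<Prod>p\<in>P. 1 / (1 - real p powr (- \<sigma> + real j * \<alpha>) * \<rho> p ^ j))) {1..}"
      by (rule has_sum_cong_neutral) (auto simp: not_le Suc_le_eq)
    finally show ?thesis .
  qed
  have "((\<lambda>g. \<Prod>j=1..l. ?f j (g j)) has_sum euler P \<rho> \<alpha>) tuples"
    unfolding euler_def tuples_def
  proof (rule has_sum_prod_PiE(1))
    show "(\<lambda>n. norm (?f j n)) summable_on {1..}" if "j \<in> {1..l}" for j
      using has_sum_imp_summable[OF f[OF that]] nn by (simp add: abs_mult)
  qed (use f in auto)
  thus ?thesis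
  proof (rule has_sum_cong[THEN iffD1, rotated])
    fix g assume g: "g \<in> tuples"
    have "(\<Prod>j=1..l. ?f j (g j)) = (\<Prod>j=1..l. real (g j) powr (-\<sigma>) * real (g j ^ j) powr \<alpha> * cmult_ext \<rho> (g j) ^ j)"
    proof (rule prod.cong[OF refl])
      fix j assume j: "j \<in> {1..l}"
      have "g j > 0" by (rule tuples_pos[OF g j])
      hence "real (g j ^ j) powr \<alpha> = real (g j) powr (real j * \<alpha>)"
        by (simp add: powr_powr flip: powr_realpow)
      moreover have "real (g j) powr (- \<sigma> + real j * \<alpha>) = real (g j) powr (-\<sigma>) * real (g j) powr (real j * \<alpha>)"
        by (rule powr_add)
      ultimately show "?f j (g j) = real (g j) powr (-\<sigma>) * real (g j ^ j) powr \<alpha> * cmult_ext \<rho> (g j) ^ j"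
        by (simp only:)
    qed
    also have "\<dots> = tuple_weight g * (\<Prod>j=1..l. real (g j ^ j) powr \<alpha>) * (\<Prod>j=1..l. cmult_ext \<rho> (g j) ^ j)"
      by (simp add: prod.distrib tuple_weight_def)
    also have "(\<Prod>j=1..l. real (g j ^ j) powr \<alpha>) = real (tuple_norm g) powr \<alpha>"
      unfolding tuple_norm_def of_nat_prod by (rule prod_powr_distrib[symmetric])
    also have "(\<Prod>j=1..l. cmult_ext \<rho> (g j) ^ j) = cmult_ext \<rho> (tuple_norm g)"
    proof -
      have "cmult_ext \<rho> (prod h A) = (\<Prod>a\<in>A. cmult_ext \<rho> (h a))" if "finite A" for h :: "nat \<Rightarrow> nat" and A
        using that by (induction A) (auto simp: cmult_ext_mult)
      thus ?thesis by (simp add: tuple_norm_def cmult_ext_power)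
    qed
    finally show "(\<Prod>j=1..l. ?f j (g j)) = tuple_weight g * cmult_ext \<rho> (tuple_norm g) * real (tuple_norm g) powr \<alpha>" by simp
  qed
qed

text \<open>\<open>1 / (1 - x) \<ge> exp x\<close> in each factor.\<close>

lemma euler_lower:
  assumes P: "finite P" "\<And>p. p \<in> P \<Longrightarrow> prime p" and \<rho>: "\<And>p. p \<in> P \<Longrightarrow> 0 \<le> \<rho> p" "\<And>p. p \<in> P \<Longrightarrow> \<rho> p < 1"
  shows "euler P \<rho> 0 \<ge> exp (\<Sum>p\<in>P. real p powr (-\<sigma>) * (\<Sum>j=1..l. \<rho> p ^ j))"
proof -
  have "exp (\<Sum>p\<in>P. real p powr (-\<sigma>) * (\<Sum>j=1..l. \<rho> p ^ j)) =
     exp (\<Sum>j=1..l. \<Sum>p\<in>P. real p powr (-\<sigma>) * \<rho> p ^ j)"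
    unfolding sum_distrib_left by (subst sum.swap) simp
  also have "\<dots> = (\<Prod>j=1..l. \<Prod>p\<in>P. exp (real p powr (-\<sigma>) * \<rho> p ^ j))"
    by (simp add: exp_sum P)
  also have "\<dots> \<le> euler P \<rho> 0"
    unfolding euler_def
  proof (intro prod_mono conjI prod_nonneg ballI exp_ge_zero)
    fix j p assume j: "j \<in> {1..l}" and p: "p \<in> P"
    define x where "x = real p powr (-\<sigma>) * \<rho> p ^ j"
    have "real p powr (-\<sigma>) \<le> real p powr 0"
      using \<sigma> prime_ge_1_nat[OF P(2)[OF p]] by (intro powr_mono) auto
    hence 1: "real p powr (-\<sigma>) \<le> 1" using prime_gt_0_nat[OF P(2)[OF p]] by simp
    have 2: "\<rho> p ^ j < 1" using \<rho>(1,2)[OF p] j by (intro power_less_one_iff[THEN iffD2]) auto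
    have "x \<le> 1 * \<rho> p ^ j" unfolding x_def using 1 \<rho>(1)[OF p] by (intro mult_right_mono) auto
    hence x: "x < 1" using 2 by simp
    have "1 - x \<le> exp (- x)" using exp_ge_add_one_self[of "- x"] by simp
    hence "inverse (exp (- x)) \<le> inverse (1 - x)" using x by (intro le_imp_inverse_le) auto
    hence "exp x \<le> 1 / (1 - x)" by (simp add: exp_minus divide_inverse)
    thus "exp (real p powr (-\<sigma>) * \<rho> p ^ j) \<le> 1 / (1 - real p powr (- \<sigma> + real j * 0) * \<rho> p ^ j)"
      by (simp add: x_def)
  qed
  finally show ?thesis .
qed

text \<open>\<open>1 / (1 - x) \<le> exp (x / (1 - x))\<close>, where
  \<open>x \<le> 2 powr (-s)\<close> stays away from 1 uniformly in \<open>p\<close> and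
  \<open>j\<close>. Primes are then replaced by all integers up to \<open>Y\<close>, since only the
  exponent of \<open>Y\<close> matters.\<close>

lemma euler_upper:
  assumes P: "P \<subseteq> {1..Y}" "\<And>p. p \<in> P \<Longrightarrow> prime p" and \<rho>: "\<And>p. p \<in> P \<Longrightarrow> 0 \<le> \<rho> p" "\<And>p. p \<in> P \<Longrightarrow> \<rho> p < 1"
    and \<alpha>: "\<alpha> \<ge> 0" "real l * \<alpha> < \<sigma>" and Y: "Y \<ge> 1"
  defines "s \<equiv> \<sigma> - real l * \<alpha>"
  shows "euler P \<rho> \<alpha> \<le> exp (real l / (1 - 2 powr (-s)) / (1 - s) * real Y powr (1 - s))"
proof -
  have s: "0 < s" "s < 1" using \<alpha> \<sigma> by (auto simp: s_def) (smt (verit) mult_nonneg_nonneg of_nat_0_le_iff)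
  define z where "z = 2 powr (-s)"
  have z: "0 < z" "z < 1" using s powr_less_mono[of "-s" 0 2] by (auto simp: z_def)
  have fP: "finite P" by (rule finite_subset[OF P(1)]) auto
  have key: "0 \<le> 1 / (1 - real p powr (- \<sigma> + real j * \<alpha>) * \<rho> p ^ j) \<and>
      1 / (1 - real p powr (- \<sigma> + real j * \<alpha>) * \<rho> p ^ j) \<le> exp (real p powr (-s) / (1 - z))"
    if j: "j \<in> {1..l}" and p: "p \<in> P" for j p
  proof
    define x where "x = real p powr (- \<sigma> + real j * \<alpha>) * \<rho> p ^ j"
    have p2: "real p \<ge> 2" using prime_ge_2_nat[OF P(2)[OF p]] by simp
    have "real j * \<alpha> \<le> real l * \<alpha>" using j \<alpha> by (intro mult_right_mono) auto
    hence "real p powr (- \<sigma> + real j * \<alpha>) \<le> real p powr (-s)"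
      using p2 by (intro powr_mono) (auto simp: s_def)
    hence "x \<le> real p powr (-s) * 1"
      unfolding x_def using \<rho>[OF p] by (intro mult_mono power_le_one) auto
    hence xp: "x \<le> real p powr (-s)" by simp
    also have "real p powr (-s) \<le> z" unfolding z_def using p2 s by (intro powr_mono2') auto
    finally have xz: "x \<le> z" .
    have x0: "x \<ge> 0" using \<rho>[OF p] by (simp add: x_def)
    show "0 \<le> 1 / (1 - real p powr (- \<sigma> + real j * \<alpha>) * \<rho> p ^ j)" using xz z by (simp add: x_def)
    have "1 / (1 - x) = 1 + x / (1 - x)" using xz z by (simp add: field_simps)
    also have "\<dots> \<le> exp (x / (1 - x))" by (rule exp_ge_add_one_self)
    also have "x / (1 - x) \<le> real p powr (-s) / (1 - z)"
      using xp xz z x0 by (intro frac_le) auto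
    finally show "1 / (1 - real p powr (- \<sigma> + real j * \<alpha>) * \<rho> p ^ j) \<le> exp (real p powr (-s) / (1 - z))"
      by (simp add: x_def)
  qed
  have "euler P \<rho> \<alpha> \<le> (\<Prod>j=1..l. \<Prod>p\<in>P. exp (real p powr (-s) / (1 - z)))"
    unfolding euler_def by (intro prod_mono conjI prod_nonneg ballI) (use key in blast)+
  also have "\<dots> = exp (real l / (1 - z) * (\<Sum>p\<in>P. real p powr (-s)))"
    by (simp add: fP exp_sum[symmetric] sum_divide_distrib[symmetric] exp_of_nat_mult[symmetric])
  also have "\<dots> \<le> exp (real l / (1 - z) * (real Y powr (1 - s) / (1 - s)))"
  proof -
    have "(\<Sum>p\<in>P. real p powr (-s)) \<le> (\<Sum>n=1..Y. real n powr (-s))"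
      using P(1) by (intro sum_mono2) auto
    also have "\<dots> \<le> real Y powr (1 - s) / (1 - s)" using s Y by (intro sum_powr_le) auto
    finally have "real l / (1 - z) * (\<Sum>p\<in>P. real p powr (-s)) \<le> real l / (1 - z) * (real Y powr (1 - s) / (1 - s))"
      using z by (intro mult_left_mono) auto
    thus ?thesis by simp
  qed
  finally show ?thesis by (simp add: z_def)
qed

text \<open>The windows \<open>[t - U, t + U]\<close> for \<open>t\<close> between
  \<open>2 * U\<close> and \<open>T / 2\<close> stay inside \<open>[U, T]\<close>, where
  \<open>M\<close> applies; hence resonance is used with these two endpoints. The left side is the
  Euler product minus the Rankin loss, and all parameters are still free.\<close>

lemma core_inequality:
  assumes Y: "Y \<ge> 2" and c: "c > 0" and k: "k > 0" and \<alpha>: "\<alpha> > 0" "real l * \<alpha> < \<sigma>"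
    and U: "U \<ge> 1" "4 * U \<le> T"
    and growth: "\<And>w. 0 \<le> Re w \<Longrightarrow> Re w \<le> 1 \<Longrightarrow> 1 \<le> Im w \<Longrightarrow> Im w \<le> T \<Longrightarrow> norm (W w) \<le> G"
    and M: "\<And>u. u \<in> {U..T} \<Longrightarrow> norm (W (Complex 0 u)) \<le> M"
  defines "s \<equiv> \<sigma> - real l * \<alpha>"
  shows "exp (- 1 / 2) * (exp (real Y powr (-\<sigma>) * (\<Sum>p | prime p \<and> p \<le> Y. gain_density \<sigma> l (real p / real Y))) - 1
      - exp (real l / (1 - 2 powr (-s)) / (1 - s) * real Y powr (1 - s) - \<alpha> * c))
    \<le> M + 1 + sqrt 2 * abs_mass * exp (c\<^sup>2 / 2 - c\<^sup>2 * U\<^sup>2 / 4) + c / sqrt (2 * pi) * (2 * (G * exp (c\<^sup>2 / 2 * (1 - U\<^sup>2))))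
      + exp (c\<^sup>2 / 2) * abs_mass * exp (\<Sum>p | prime p \<and> p \<le> Y. height_density \<sigma> (real p / real Y)) *
        (k * (2 * U) + 2 * exp (- (k * (T / 2))\<^sup>2 / 4))"
proof -
  define P where "P = {p. prime p \<and> p \<le> Y}"
  have P: "finite P" "\<And>p. p \<in> P \<Longrightarrow> prime p" "P \<subseteq> {1..Y}"
    using finite_primes_le[of Y] by (auto simp: P_def Suc_le_eq prime_gt_0_nat)
  define x where "x = (\<lambda>p. (real p / real Y) powr \<sigma>)"
  have x: "0 < x p" "x p \<le> 1" if "p \<in> P" for p
  proof -
    have "p > 0" "p \<le> Y" using that by (auto simp: P_def prime_gt_0_nat)
    thus "0 < x p" "x p \<le> 1" using Y \<sigma> by (auto simp: x_def intro!: powr_le1)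
  qed
  define \<rho> where "\<rho> = (\<lambda>p. if p \<in> P then 1 - x p else 0)"
  have \<rho>: "\<And>p. p \<in> P \<Longrightarrow> 0 \<le> \<rho> p" "\<And>p. p \<in> P \<Longrightarrow> \<rho> p < 1" "\<And>p. prime p \<Longrightarrow> p \<notin> P \<Longrightarrow> \<rho> p = 0"
    using x by (auto simp: \<rho>_def)
  define r where "r = cmult_ext \<rho>"
  have r0: "r n \<ge> 0" for n unfolding r_def using \<rho> by (intro cmult_ext_nonneg) (metis order_refl)
  have rs: "(r has_sum (\<Prod>p\<in>P. 1 / (1 - \<rho> p))) UNIV"
    unfolding r_def by (rule cmult_ext_has_sum[OF P(1,2) \<rho>])
  have rsums: "r sums (\<Prod>p\<in>P. 1 / (1 - \<rho> p))" by (rule has_sum_imp_sums[OF rs])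
  have res: "resonator r k"
    by unfold_locales (use r0 rsums k in \<open>auto simp: r_def cmult_ext_mult sums_iff\<close>)
  have r2: "(\<lambda>n. (r n)\<^sup>2) sums (\<Prod>p\<in>P. 1 / (1 - (\<rho> p)\<^sup>2))"
  proof -
    have "(cmult_ext (\<lambda>p. (\<rho> p)\<^sup>2) has_sum (\<Prod>p\<in>P. 1 / (1 - (\<rho> p)\<^sup>2))) UNIV"
    proof (rule cmult_ext_has_sum[OF P(1,2)])
      show "(\<rho> p)\<^sup>2 < 1" if "p \<in> P" for p
        using \<rho>(1,2)[OF that] by (simp add: power_less_one_iff)
    qed (use \<rho>(3) in auto)
    moreover have "cmult_ext (\<lambda>p. (\<rho> p)\<^sup>2) n = (r n)\<^sup>2" for n
    proof (cases "n = 0")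
      case False
      have "(r n)\<^sup>2 = cmult_ext (\<lambda>p. real p powr 0 * (\<rho> p)\<^sup>2) n"
        using cmult_ext_powr[of 2 n 0 \<rho>] False by (simp add: r_def)
      also have "\<dots> = cmult_ext (\<lambda>p. (\<rho> p)\<^sup>2) n"
        by (rule cmult_ext_cong) (auto simp: prime_gt_0_nat)
      finally show ?thesis ..
    qed (simp add: r_def)
    ultimately have "((\<lambda>n. (r n)\<^sup>2) has_sum (\<Prod>p\<in>P. 1 / (1 - (\<rho> p)\<^sup>2))) UNIV" by (simp add: fun_eq_iff[symmetric] cong: has_sum_cong)
    thus ?thesis by (rule has_sum_imp_sums)
  qed
  have rsq: "(\<Sum>n. (r n)\<^sup>2) = (\<Prod>p\<in>P. 1 / (1 - (\<rho> p)\<^sup>2))" using r2 by (simp add: sums_iff)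
  have rsq0: "(\<Sum>n. (r n)\<^sup>2) > 0"
    unfolding rsq using \<rho> by (intro prod_pos) (auto simp: power_less_one_iff)
  \<comment> \<open>For each prime, with \<open>x = 1 - \<rho> p\<close>, the quotient is
    \<open>x * (2 - x) / x\<^sup>2\<close>, the exponential of
    \<open>height_density\<close>.\<close>
  have ratio: "(suminf r)\<^sup>2 / (\<Sum>n. (r n)\<^sup>2) = exp (\<Sum>p\<in>P. height_density \<sigma> (real p / real Y))"
  proof -
    have "(suminf r)\<^sup>2 / (\<Sum>n. (r n)\<^sup>2) = (\<Prod>p\<in>P. (1 / (1 - \<rho> p))\<^sup>2 / (1 / (1 - (\<rho> p)\<^sup>2)))"
      unfolding rsq sums_unique[OF rsums, symmetric] prod_power_distrib prod_dividef[symmetric] ..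
    also have "\<dots> = (\<Prod>p\<in>P. exp (height_density \<sigma> (real p / real Y)))"
    proof (rule prod.cong[OF refl])
      fix p assume p: "p \<in> P"
      have e: "2 * (real p / real Y) powr (-\<sigma>) - 1 = (2 - x p) / x p"
        using x[OF p] by (simp add: x_def powr_minus field_simps)
      have "(1 / (1 - \<rho> p))\<^sup>2 / (1 / (1 - (\<rho> p)\<^sup>2)) = (2 - x p) / x p"
      proof -
        have 1: "1 - \<rho> p = x p" and 2: "1 - (\<rho> p)\<^sup>2 = x p * (2 - x p)"
          using p by (auto simp: \<rho>_def power2_eq_square algebra_simps)
        show ?thesis unfolding 1 2 using x[OF p] by (simp add: power2_eq_square field_simps)
      qed
      also have "\<dots> = exp (height_density \<sigma> (real p / real Y))"
        unfolding height_density_def e using x[OF p] by simp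
      finally show "(1 / (1 - \<rho> p))\<^sup>2 / (1 / (1 - (\<rho> p)\<^sup>2)) = exp (height_density \<sigma> (real p / real Y))" .
    qed
    finally show ?thesis by (simp add: exp_sum P)
  qed
  define u where "u = (\<lambda>g. tuple_weight g * r (tuple_norm g))"
  have eu: "(u has_sum euler P \<rho> 0) tuples"
  proof -
    have "((\<lambda>g. tuple_weight g * r (tuple_norm g) * real (tuple_norm g) powr 0) has_sum euler P \<rho> 0) tuples"
      unfolding r_def by (rule euler_has_sum[OF P(1,2) \<rho>]) (use \<sigma> in auto)
    thus ?thesis
    proof (rule has_sum_cong[THEN iffD1, rotated])
      fix g assume "g \<in> tuples"
      hence "real (tuple_norm g) powr 0 = 1" using tuple_norm_pos[of g] by simp
      thus "tuple_weight g * r (tuple_norm g) * real (tuple_norm g) powr 0 = u g" by (simp add: u_def)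
    qed
  qed
  have ea: "((\<lambda>g. u g * real (tuple_norm g) powr \<alpha>) has_sum euler P \<rho> \<alpha>) tuples"
    unfolding u_def r_def by (rule euler_has_sum[OF P(1,2) \<rho>]) (use \<alpha> in auto)
  have ev1: "\<forall>\<^sub>F \<Gamma> in finite_subsets_at_top tuples. sum u \<Gamma> > euler P \<rho> 0 - 1"
    using eu unfolding has_sum_def by (rule order_tendstoD) simp
  have ev2: "\<forall>\<^sub>F \<Gamma> in finite_subsets_at_top tuples. (\<Sum>g\<in>\<Gamma>. tuple_weight g / real (tuple_norm g)) > abs_mass - exp (- c\<^sup>2 / 2)"
    using abs_mass_has_sum unfolding has_sum_def by (rule order_tendstoD) simp
  have ev3: "\<forall>\<^sub>F \<Gamma> in finite_subsets_at_top tuples. finite \<Gamma> \<and> \<Gamma> \<subseteq> tuples"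
    by (intro eventually_finite_subsets_at_top_weakI) auto
  have "\<forall>\<^sub>F \<Gamma> in finite_subsets_at_top tuples. (sum u \<Gamma> > euler P \<rho> 0 - 1 \<and>
      (\<Sum>g\<in>\<Gamma>. tuple_weight g / real (tuple_norm g)) > abs_mass - exp (- c\<^sup>2 / 2)) \<and> finite \<Gamma> \<and> \<Gamma> \<subseteq> tuples"
    by (rule eventually_conj[OF eventually_conj[OF ev1 ev2] ev3])
  \<comment> \<open>One finite set nearly exhausts both the Euler product and
    \<open>abs_mass\<close>; its size does not enter the final bound.\<close>
  then obtain \<Gamma> where \<Gamma>: "finite \<Gamma>" "\<Gamma> \<subseteq> tuples" and \<Gamma>u: "sum u \<Gamma> > euler P \<rho> 0 - 1"
     and close: "abs_mass - (\<Sum>g\<in>\<Gamma>. tuple_weight g / real (tuple_norm g)) \<le> exp (- c\<^sup>2 / 2)"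
    using eventually_happens'[OF finite_subsets_at_top_neq_bot] by (smt (verit))
  have u0: "u g \<ge> 0" for g using r0 tuple_weight_nonneg by (simp add: u_def)
  have \<Gamma>a: "(\<Sum>g\<in>\<Gamma>. u g * real (tuple_norm g) powr \<alpha>) \<le> euler P \<rho> \<alpha>"
    by (rule has_sum_mono_neutral[OF has_sum_finite[OF \<Gamma>(1)] ea]) (use \<Gamma> u0 in auto)
  define D where "D = M + 1 + sqrt 2 * abs_mass * exp (c\<^sup>2 / 2 - c\<^sup>2 * U\<^sup>2 / 4) + c / sqrt (2 * pi) * (2 * (G * exp (c\<^sup>2 / 2 * (1 - U\<^sup>2))))"
  have smooth_sum: "norm (smooth_sum c \<Gamma> t) \<le> D" if "t \<in> {2 * U..T / 2}" for t
    unfolding D_def by (rule smooth_sum_bound[OF c \<Gamma> close, of U t T]) (use that U growth M in auto)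
  have "(\<Sum>g\<in>\<Gamma>. smooth_weight c g * r (tuple_norm g)) \<le> D + exp (c\<^sup>2 / 2) * abs_mass * ((suminf r)\<^sup>2 / (\<Sum>n. (r n)\<^sup>2)) *
      (k * (2 * U) + 2 * exp (- (k * (T / 2))\<^sup>2 / 4))"
    by (rule resonance_bound[OF c \<Gamma> res _ smooth_sum _ rsq0]) (use U in auto)
  moreover have "exp (- 1 / 2) * (sum u \<Gamma> - exp (- (\<alpha> * c)) * (\<Sum>g\<in>\<Gamma>. u g * real (tuple_norm g) powr \<alpha>)) \<le> (\<Sum>g\<in>\<Gamma>. smooth_weight c g * r (tuple_norm g))"
    unfolding u_def by (rule sum_smooth_weight_lower[OF c \<alpha>(1) \<Gamma> r0])
  moreover have "exp (- 1 / 2) * (exp (real Y powr (-\<sigma>) * (\<Sum>p | prime p \<and> p \<le> Y. gain_density \<sigma> l (real p / real Y))) - 1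
      - exp (real l / (1 - 2 powr (-s)) / (1 - s) * real Y powr (1 - s) - \<alpha> * c)) \<le>
     exp (- 1 / 2) * (sum u \<Gamma> - exp (- (\<alpha> * c)) * (\<Sum>g\<in>\<Gamma>. u g * real (tuple_norm g) powr \<alpha>))"
  proof (intro mult_left_mono diff_mono)
    have "real Y powr (-\<sigma>) * (\<Sum>p | prime p \<and> p \<le> Y. gain_density \<sigma> l (real p / real Y)) =
       (\<Sum>p\<in>P. real Y powr (-\<sigma>) * gain_density \<sigma> l (real p / real Y))"
      unfolding P_def by (rule sum_distrib_left)
    also have "\<dots> = (\<Sum>p\<in>P. real p powr (-\<sigma>) * (\<Sum>j=1..l. \<rho> p ^ j))"
    proof (rule sum.cong[OF refl])
      fix p assume p: "p \<in> P"
      have "real Y powr (-\<sigma>) * (real p / real Y) powr (-\<sigma>) = real p powr (-\<sigma>)"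
        using Y by (simp flip: powr_mult)
      thus "real Y powr (-\<sigma>) * gain_density \<sigma> l (real p / real Y) = real p powr (-\<sigma>) * (\<Sum>j=1..l. \<rho> p ^ j)"
        using p by (simp add: gain_density_def \<rho>_def x_def flip: mult.assoc)
    qed
    finally have "exp (real Y powr (-\<sigma>) * (\<Sum>p | prime p \<and> p \<le> Y. gain_density \<sigma> l (real p / real Y))) \<le> euler P \<rho> 0"
      using euler_lower[OF P(1,2) \<rho>(1,2)] by simp
    thus "exp (real Y powr (-\<sigma>) * (\<Sum>p | prime p \<and> p \<le> Y. gain_density \<sigma> l (real p / real Y))) - 1 \<le> sum u \<Gamma>"
      using \<Gamma>u by linarith
    have "euler P \<rho> \<alpha> \<le> exp (real l / (1 - 2 powr (-s)) / (1 - s) * real Y powr (1 - s))"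
      unfolding s_def by (rule euler_upper[OF P(3,2) \<rho>(1,2)]) (use \<alpha> Y in auto)
    hence "exp (- (\<alpha> * c)) * (\<Sum>g\<in>\<Gamma>. u g * real (tuple_norm g) powr \<alpha>) \<le>
       exp (- (\<alpha> * c)) * exp (real l / (1 - 2 powr (-s)) / (1 - s) * real Y powr (1 - s))"
      using \<Gamma>a by (intro mult_left_mono) auto
    also have "\<dots> = exp (real l / (1 - 2 powr (-s)) / (1 - s) * real Y powr (1 - s) - \<alpha> * c)"
      by (simp add: exp_diff exp_minus divide_inverse)
    finally show "exp (- (\<alpha> * c)) * (\<Sum>g\<in>\<Gamma>. u g * real (tuple_norm g) powr \<alpha>) \<le>
       exp (real l / (1 - 2 powr (-s)) / (1 - s) * real Y powr (1 - s) - \<alpha> * c)" .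
  qed auto
  ultimately show ?thesis unfolding ratio D_def P_def by linarith
qed

end

section \<open>Large values\<close>

context zeta_product
begin

text \<open>The resonator uses the primes up to \<open>cutoff \<kappa> T\<close>, about \<open>\<kappa> ln T\<close> in number.\<close>

definition cutoff :: "real \<Rightarrow> real \<Rightarrow> nat" where
  "cutoff \<kappa> T = nat \<lfloor>\<kappa> * ln T * ln (ln T)\<rfloor>"

lemma norm_W_eq_zeta:
  "norm (W (Complex 0 t)) = (\<Prod>j=1..l. cmod (zeta (Complex \<sigma> (real j * t))))"
proof -
  have "of_real \<sigma> + of_nat j * Complex 0 t = Complex \<sigma> (real j * t)" for j
    by (simp add: complex_eq_iff)
  moreover have "zeta_ext (Complex \<sigma> y) = zeta (Complex \<sigma> y)" for y
    using \<sigma> by (simp add: zeta_ext_def zeta_eq_zeta_reg)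
  ultimately show ?thesis by (simp add: W_def prod_norm)
qed

lemma cutoff_tendsto:
  assumes "\<kappa> > 0"
  shows "filterlim (cutoff \<kappa>) sequentially at_top"
    "((\<lambda>T. real (cutoff \<kappa> T) / (\<kappa> * ln T * ln (ln T))) \<longlongrightarrow> 1) at_top"
    "((\<lambda>T. ln (real (cutoff \<kappa> T)) / ln (ln T)) \<longlongrightarrow> 1) at_top"
proof -
  have top: "filterlim (\<lambda>T. \<kappa> * ln T * ln (ln T)) at_top at_top" using assms by real_asymp
  show 1: "filterlim (cutoff \<kappa>) sequentially at_top"
    unfolding cutoff_def by (intro filterlim_compose[OF filterlim_nat_sequentially] filterlim_compose[OF filterlim_floor_sequentially] top)
  show 2: "((\<lambda>T. real (cutoff \<kappa> T) / (\<kappa> * ln T * ln (ln T))) \<longlongrightarrow> 1) at_top"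
  proof (rule tendsto_sandwich)
    have ev: "\<forall>\<^sub>F T in at_top. \<kappa> * ln T * ln (ln T) > 0"
      using top by (simp add: filterlim_at_top_dense)
    show "\<forall>\<^sub>F T in at_top. (\<kappa> * ln T * ln (ln T) - 1) / (\<kappa> * ln T * ln (ln T)) \<le> real (cutoff \<kappa> T) / (\<kappa> * ln T * ln (ln T))"
      using ev
    proof eventually_elim
      case (elim T)
      have "\<kappa> * ln T * ln (ln T) - 1 \<le> real (cutoff \<kappa> T)" unfolding cutoff_def by linarith
      thus ?case using elim by (intro divide_right_mono) auto
    qed
    show "\<forall>\<^sub>F T in at_top. real (cutoff \<kappa> T) / (\<kappa> * ln T * ln (ln T)) \<le> 1"
      using ev by eventually_elim (auto simp: cutoff_def divide_le_eq_1)
    show "((\<lambda>T. (\<kappa> * ln T * ln (ln T) - 1) / (\<kappa> * ln T * ln (ln T))) \<longlongrightarrow> 1) at_top"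
      using assms by real_asymp
  qed auto
  have "((\<lambda>T. (ln (real (cutoff \<kappa> T) / (\<kappa> * ln T * ln (ln T))) + ln (\<kappa> * ln T * ln (ln T))) / ln (ln T)) \<longlongrightarrow> 1) at_top"
  proof -
    have "((\<lambda>T. ln (real (cutoff \<kappa> T) / (\<kappa> * ln T * ln (ln T)))) \<longlongrightarrow> ln 1) at_top"
      by (intro tendsto_ln 2) auto
    moreover have "((\<lambda>T. inverse (ln (ln T))) \<longlongrightarrow> (0::real)) at_top" by real_asymp
    ultimately have "((\<lambda>T. ln (real (cutoff \<kappa> T) / (\<kappa> * ln T * ln (ln T))) * inverse (ln (ln T))) \<longlongrightarrow> ln 1 * 0) at_top"
      by (rule tendsto_mult)
    moreover have "((\<lambda>T. ln (\<kappa> * ln T * ln (ln T)) / ln (ln T)) \<longlongrightarrow> 1) at_top" using assms by real_asymp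
    ultimately have "((\<lambda>T. ln (real (cutoff \<kappa> T) / (\<kappa> * ln T * ln (ln T))) * inverse (ln (ln T)) + ln (\<kappa> * ln T * ln (ln T)) / ln (ln T)) \<longlongrightarrow> ln 1 * 0 + 1) at_top"
      by (rule tendsto_add)
    thus ?thesis by (simp add: add_divide_distrib divide_inverse distrib_right)
  qed
  moreover have "\<forall>\<^sub>F T in at_top. (ln (real (cutoff \<kappa> T) / (\<kappa> * ln T * ln (ln T))) + ln (\<kappa> * ln T * ln (ln T))) / ln (ln T) =
      ln (real (cutoff \<kappa> T)) / ln (ln T)"
  proof -
    have "\<forall>\<^sub>F T in at_top. cutoff \<kappa> T \<ge> 1"
      using 1 by (simp add: filterlim_at_top)
    moreover have "\<forall>\<^sub>F T in at_top. \<kappa> * ln T * ln (ln T) > 0"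
      using top by (simp add: filterlim_at_top_dense)
    ultimately show ?thesis
    proof eventually_elim
      case (elim T)
      have "ln (real (cutoff \<kappa> T) / (\<kappa> * ln T * ln (ln T))) = ln (real (cutoff \<kappa> T)) - ln (\<kappa> * ln T * ln (ln T))"
        using elim by (intro ln_divide_pos) auto
      thus ?case by simp
    qed
  qed
  ultimately show "((\<lambda>T. ln (real (cutoff \<kappa> T)) / ln (ln T)) \<longlongrightarrow> 1) at_top"
    by (rule Lim_transform_eventually)
qed

text \<open>As \<open>ln (cutoff \<kappa> T)\<close> is asymptotic to \<open>ln (ln T)\<close>, the
  factor \<open>ln (ln T)\<close> of the cutoff cancels in the first quotient and leaves the power
  \<open>- \<sigma>\<close> in the second, the shape of the final exponent.\<close>

lemma cutoff_over_ln:
  assumes "\<kappa> > 0"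
  shows "((\<lambda>T. real (cutoff \<kappa> T) / ln (real (cutoff \<kappa> T)) / ln T) \<longlongrightarrow> \<kappa>) at_top"
    "((\<lambda>T. real (cutoff \<kappa> T) powr (1 - \<sigma>) / ln (real (cutoff \<kappa> T)) / (ln T powr (1 - \<sigma>) / ln (ln T) powr \<sigma>)) \<longlongrightarrow> \<kappa> powr (1 - \<sigma>)) at_top"
proof -
  let ?q = "\<lambda>T. real (cutoff \<kappa> T) / (\<kappa> * ln T * ln (ln T))" and ?w = "\<lambda>T. ln (real (cutoff \<kappa> T)) / ln (ln T)"
  have ev: "\<forall>\<^sub>F T in at_top. cutoff \<kappa> T \<ge> 2 \<and> ln T > 1 \<and> ln (ln T) > (0::real)"
  proof (intro eventually_conj)
    show "\<forall>\<^sub>F T in at_top. cutoff \<kappa> T \<ge> 2" using cutoff_tendsto(1)[OF assms] by (simp add: filterlim_at_top)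
    show "\<forall>\<^sub>F T in at_top. ln T > (1::real)" by real_asymp
    show "\<forall>\<^sub>F T in at_top. ln (ln T) > (0::real)" by real_asymp
  qed
  have "((\<lambda>T. \<kappa> * ?q T / ?w T) \<longlongrightarrow> \<kappa> * 1 / 1) at_top"
    by (intro tendsto_intros cutoff_tendsto assms) auto
  moreover have "\<forall>\<^sub>F T in at_top. \<kappa> * ?q T / ?w T = real (cutoff \<kappa> T) / ln (real (cutoff \<kappa> T)) / ln T"
    using ev by eventually_elim (use assms in \<open>auto simp: field_simps\<close>)
  ultimately show "((\<lambda>T. real (cutoff \<kappa> T) / ln (real (cutoff \<kappa> T)) / ln T) \<longlongrightarrow> \<kappa>) at_top"
    using Lim_transform_eventually by fastforce
  have "((\<lambda>T. \<kappa> powr (1 - \<sigma>) * ?q T powr (1 - \<sigma>) / ?w T) \<longlongrightarrow> \<kappa> powr (1 - \<sigma>) * 1 powr (1 - \<sigma>) / 1) at_top"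
    by (intro tendsto_intros cutoff_tendsto assms) auto
  moreover have "\<forall>\<^sub>F T in at_top. \<kappa> powr (1 - \<sigma>) * ?q T powr (1 - \<sigma>) / ?w T =
      real (cutoff \<kappa> T) powr (1 - \<sigma>) / ln (real (cutoff \<kappa> T)) / (ln T powr (1 - \<sigma>) / ln (ln T) powr \<sigma>)"
    using ev
  proof eventually_elim
    case (elim T)
    have "real (cutoff \<kappa> T) powr (1 - \<sigma>) = (?q T * \<kappa> * ln T * ln (ln T)) powr (1 - \<sigma>)"
      using elim assms by (simp add: field_simps)
    also have "\<dots> = ?q T powr (1 - \<sigma>) * \<kappa> powr (1 - \<sigma>) * ln T powr (1 - \<sigma>) * ln (ln T) powr (1 - \<sigma>)"
      by (simp only: powr_mult)
    finally have 1: "real (cutoff \<kappa> T) powr (1 - \<sigma>) = ?q T powr (1 - \<sigma>) * \<kappa> powr (1 - \<sigma>) * ln T powr (1 - \<sigma>) * ln (ln T) powr (1 - \<sigma>)" .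
    have 2: "ln (ln T) powr (1 - \<sigma>) * ln (ln T) powr \<sigma> = ln (ln T)" using elim by (simp flip: powr_add)
    have "real (cutoff \<kappa> T) powr (1 - \<sigma>) / ln (real (cutoff \<kappa> T)) / (ln T powr (1 - \<sigma>) / ln (ln T) powr \<sigma>) =
      ?q T powr (1 - \<sigma>) * \<kappa> powr (1 - \<sigma>) * (ln (ln T) powr (1 - \<sigma>) * ln (ln T) powr \<sigma>) / ln (real (cutoff \<kappa> T))"
      unfolding 1 using elim by simp
    also have "\<dots> = \<kappa> powr (1 - \<sigma>) * ?q T powr (1 - \<sigma>) / ?w T"
      unfolding 2 by simp
    finally show ?case ..
  qed
  ultimately show "((\<lambda>T. real (cutoff \<kappa> T) powr (1 - \<sigma>) / ln (real (cutoff \<kappa> T)) / (ln T powr (1 - \<sigma>) / ln (ln T) powr \<sigma>)) \<longlongrightarrow> \<kappa> powr (1 - \<sigma>)) at_top"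
    using Lim_transform_eventually by fastforce
qed

text \<open>No error term is required: the resonator is built for the midpoint
  \<open>\<kappa>'\<close> between \<kappa> and its upper bound, and the larger main term at
  \<open>\<kappa>'\<close> pays for all losses.\<close>

lemma large_values:
  assumes l: "l \<ge> 1" and \<beta>: "0 < \<beta>" "\<beta> < 1" and half: "1 / 2 < \<sigma>"
    and \<kappa>: "0 < \<kappa>" "\<kappa> < (1 - \<beta>) / (\<sigma> * (1 + c_const \<sigma>))"
  shows "\<forall>\<^sub>F T in at_top. \<exists>t\<in>{T powr \<beta>..T}.
    (\<Prod>j=1..l. cmod (zeta (Complex \<sigma> (real j * t)))) \<ge>
      exp (\<kappa> powr (1 - \<sigma>) * S_const \<sigma> l * (ln T powr (1 - \<sigma>) / ln (ln T) powr \<sigma>))"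
proof -
  define I where "I = \<sigma> * (1 + c_const \<sigma>)"
  \<comment> \<open>If \<open>I\<close> were not positive, the upper bound for \<kappa> would not be
    positive either (division by 0 gives 0).\<close>
  have I: "I > 0" using \<kappa> \<beta> by (smt (verit) I_def divide_nonneg_nonpos)
  define \<kappa>' where "\<kappa>' = (\<kappa> + (1 - \<beta>) / I) / 2"
  have \<kappa>': "\<kappa> < \<kappa>'" "\<kappa>' * I < 1 - \<beta>" "\<kappa>' > 0"
  proof -
    have "\<kappa> < (1 - \<beta>) / I" using \<kappa> by (simp add: I_def)
    thus "\<kappa> < \<kappa>'" by (simp add: \<kappa>'_def)
    have "(\<kappa> + q) / 2 < q" if "\<kappa> < q" for q :: real using that by simp
    from this[OF \<open>\<kappa> < (1 - \<beta>) / I\<close>] have "\<kappa>' < (1 - \<beta>) / I" unfolding \<kappa>'_def .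
    thus "\<kappa>' * I < 1 - \<beta>" using I by (simp add: pos_less_divide_eq)
    show "\<kappa>' > 0" using \<open>\<kappa> < \<kappa>'\<close> \<kappa> by simp
  qed
  \<comment> \<open>Budget in powers of \<open>T\<close>: the smoothed series costs \<epsilon>, the
    ratio of maximum to mean \<open>1 - \<beta> - 3 * \<epsilon>\<close> (one \<epsilon> already
    spent on the prime sum), and the initial range gives \<open>\<beta> - 1\<close> up to a
    logarithm. The total is \<open>- 2 * \<epsilon>\<close>.\<close>
  define \<epsilon> where "\<epsilon> = (1 - \<beta> - \<kappa>' * I) / 4"
  have "q + (1 - \<beta> - q) / 4 = 1 - \<beta> - 3 * ((1 - \<beta> - q) / 4)" for q :: real by (simp add: field_simps)
  hence \<epsilon>: "\<epsilon> > 0" "\<kappa>' * I + \<epsilon> = 1 - \<beta> - 3 * \<epsilon>" unfolding \<epsilon>_def using \<kappa>' by auto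
  define S where "S = S_const \<sigma> l"
  have S: "S > 0" unfolding S_def by (rule S_const_pos[OF \<sigma> l])
  define \<Lambda> where "\<Lambda> = (\<lambda>T::real. ln T powr (1 - \<sigma>) / ln (ln T) powr \<sigma>)"
  define B where "B = (\<lambda>T. \<kappa> powr (1 - \<sigma>) * S * \<Lambda> T)"
  \<comment> \<open>The exponent of \<open>Y\<close> in the Rankin loss. It has to lie below 1/2
    because \<open>c T\<close> is only of order \<open>sqrt (ln T)\<close>, and \<alpha> is then
    determined by \<open>1 - \<sigma> + l * \<alpha> = \<theta>\<close>.\<close>
  define \<theta> where "\<theta> = (1 - \<sigma> + 1 / 2) / 2"
  have \<theta>: "1 - \<sigma> < \<theta>" "\<theta> < 1 / 2" "0 < \<theta>" using half \<sigma> by (auto simp: \<theta>_def field_simps)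
  define \<alpha> where "\<alpha> = (\<theta> - (1 - \<sigma>)) / real l"
  have la: "real l * \<alpha> = \<theta> - (1 - \<sigma>)" using l by (simp add: \<alpha>_def)
  have \<alpha>: "\<alpha> > 0" "real l * \<alpha> < \<sigma>" using \<theta> l unfolding la by (auto simp: \<alpha>_def)
  have s: "1 - (\<sigma> - real l * \<alpha>) = \<theta>" unfolding la by simp
  define K0 where "K0 = real l / (1 - 2 powr (- (\<sigma> - real l * \<alpha>))) / \<theta>"
  obtain C where C: "C \<ge> 1" "\<And>w T. 0 \<le> Re w \<Longrightarrow> Re w \<le> 1 \<Longrightarrow> 1 \<le> Im w \<Longrightarrow> Im w \<le> T \<Longrightarrow> norm (W w) \<le> (C * T) ^ l"
    by (rule W_growth) blast
  define Y where "Y = cutoff \<kappa>'"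
  define c where "c = (\<lambda>T. sqrt (2 * \<epsilon> * ln T))"
  \<comment> \<open>A Gaussian of width \<open>T / ln T\<close>: its tail term at
    \<open>T / 2\<close> is \<open>exp (- (ln T)\<^sup>2 / 16)\<close>, smaller than any power of
    \<open>T\<close>, at the price of a single logarithm in the initial range.\<close>
  define k where "k = (\<lambda>T::real. ln T / T)"
  define H where "H = (\<lambda>T. \<Sum>p | prime p \<and> p \<le> Y T. height_density \<sigma> (real p / real (Y T)))"
  define A where "A = (\<lambda>T. real (Y T) powr (-\<sigma>) * (\<Sum>p | prime p \<and> p \<le> Y T. gain_density \<sigma> l (real p / real (Y T))))"
  note Ytop = cutoff_tendsto(1)[OF \<kappa>'(3), folded Y_def]
  have Y2: "\<forall>\<^sub>F T in at_top. Y T \<ge> 2" using Ytop by (simp add: filterlim_at_top)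
  have evH: "\<forall>\<^sub>F T in at_top. H T \<le> (1 - \<beta> - 3 * \<epsilon>) * ln T"
  proof -
    define e where "e = \<epsilon> / (2 * \<kappa>')"
    have e: "e > 0" "(I + e) * \<kappa>' < \<kappa>' * I + \<epsilon>" using \<epsilon> \<kappa>' by (auto simp: e_def field_simps)
    have "((\<lambda>T. (I + e) * (real (Y T) / ln (real (Y T)) / ln T)) \<longlongrightarrow> (I + e) * \<kappa>') at_top"
      unfolding Y_def by (intro tendsto_intros cutoff_over_ln \<kappa>')
    from order_tendstoD(2)[OF this e(2)]
    have "\<forall>\<^sub>F T in at_top. (I + e) * (real (Y T) / ln (real (Y T)) / ln T) < 1 - \<beta> - 3 * \<epsilon>" unfolding \<epsilon>(2) .
    moreover have "\<forall>\<^sub>F T in at_top. H T \<le> (I + e) * real (Y T) / ln (real (Y T))"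
      using filterlim_iff[THEN iffD1, OF Ytop, rule_format, OF prime_sum_height[OF \<sigma> e(1)]]
      by (simp add: H_def I_def)
    moreover have "\<forall>\<^sub>F T in at_top. ln T > (0::real)" by real_asymp
    ultimately show ?thesis
    proof eventually_elim
      case (elim T)
      have "(I + e) * (real (Y T) / ln (real (Y T)) / ln T) * ln T \<le> (1 - \<beta> - 3 * \<epsilon>) * ln T"
        using elim by (intro mult_right_mono) auto
      thus ?case using elim by simp
    qed
  qed
  have \<Lambda>top: "filterlim \<Lambda> at_top at_top" unfolding \<Lambda>_def using \<sigma> by real_asymp
  have evA: "\<forall>\<^sub>F T in at_top. A T \<ge> B T + 3 \<and> B T \<ge> 3"
  proof -
    have "\<kappa> powr (1 - \<sigma>) < \<kappa>' powr (1 - \<sigma>)" using \<kappa>' \<kappa> \<sigma> by (intro powr_less_mono2) auto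
    define d where "d = \<kappa>' powr (1 - \<sigma>) - \<kappa> powr (1 - \<sigma>)"
    have d: "d > 0" using \<open>\<kappa> powr (1 - \<sigma>) < \<kappa>' powr (1 - \<sigma>)\<close> by (simp add: d_def)
    \<comment> \<open>This \<open>e\<close> spends half of the surplus \<open>S * d\<close> gained
      by passing from \<kappa> to \<open>\<kappa>'\<close>. The rest, multiplied by
      \<open>\<Lambda> T\<close>, still tends to infinity and provides the
      \<open>+ 3\<close>.\<close>
    define e where "e = S * d / (2 * \<kappa>' powr (1 - \<sigma>))"
    have kp: "\<kappa>' powr (1 - \<sigma>) > 0" using \<kappa>' by simp
    have e: "e > 0" using S d kp by (simp add: e_def)
    have "(S - e) * \<kappa>' powr (1 - \<sigma>) = S * \<kappa>' powr (1 - \<sigma>) - S * d / 2"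
      using kp by (simp add: e_def left_diff_distrib)
    also have "\<dots> = \<kappa> powr (1 - \<sigma>) * S + S * d / 2" by (simp add: d_def field_simps)
    finally have lim: "(S - e) * \<kappa>' powr (1 - \<sigma>) > \<kappa> powr (1 - \<sigma>) * S + S * d / 4" using S d by simp
    have "((\<lambda>T. (S - e) * (real (Y T) powr (1 - \<sigma>) / ln (real (Y T)) / \<Lambda> T)) \<longlongrightarrow> (S - e) * \<kappa>' powr (1 - \<sigma>)) at_top"
      unfolding Y_def \<Lambda>_def by (intro tendsto_intros cutoff_over_ln \<kappa>')
    from order_tendstoD(1)[OF this lim]
    have "\<forall>\<^sub>F T in at_top. (S - e) * (real (Y T) powr (1 - \<sigma>) / ln (real (Y T)) / \<Lambda> T) > \<kappa> powr (1 - \<sigma>) * S + S * d / 4" .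
    moreover have "\<forall>\<^sub>F T in at_top. (\<Sum>p | prime p \<and> p \<le> Y T. gain_density \<sigma> l (real p / real (Y T))) \<ge> (S - e) * real (Y T) / ln (real (Y T))"
      using filterlim_iff[THEN iffD1, OF Ytop, rule_format, OF prime_sum_gain[OF \<sigma> e]] by (simp add: S_def)
    moreover have "\<forall>\<^sub>F T in at_top. \<Lambda> T \<ge> max (3 / (\<kappa> powr (1 - \<sigma>) * S)) (3 / (S * d / 4))"
      using \<Lambda>top unfolding filterlim_at_top by blast
    ultimately show ?thesis using Y2
    proof eventually_elim
      case (elim T)
      have pos: "\<kappa> powr (1 - \<sigma>) * S > 0" "S * d / 4 > 0" using \<kappa> S d by auto
      have L: "\<Lambda> T \<ge> 3 / (\<kappa> powr (1 - \<sigma>) * S)" "\<Lambda> T \<ge> 3 / (S * d / 4)" using elim(3) by (auto simp only: max.bounded_iff)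
      have L0: "\<Lambda> T > 0" using L(1) pos(1) by (smt (verit) divide_pos_pos)
      have B3: "B T \<ge> 3" using L(1) pos(1) unfolding B_def by (simp only: pos_divide_le_eq mult.commute[of "\<Lambda> T"])
      have d3: "S * d / 4 * \<Lambda> T \<ge> 3" using L(2) pos(2) by (simp only: pos_divide_le_eq mult.commute[of "\<Lambda> T"])
      have "B T + 3 \<le> (\<kappa> powr (1 - \<sigma>) * S + S * d / 4) * \<Lambda> T" using d3 by (simp add: B_def distrib_right)
      also have "\<dots> \<le> (S - e) * (real (Y T) powr (1 - \<sigma>) / ln (real (Y T)) / \<Lambda> T) * \<Lambda> T"
        using elim(1) L0 by (intro mult_right_mono) auto
      also have "\<dots> = real (Y T) powr (-\<sigma>) * ((S - e) * real (Y T) / ln (real (Y T)))"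
        using L0 elim(4) by (simp add: powr_diff powr_minus field_simps)
      also have "\<dots> \<le> A T" unfolding A_def using elim(2) by (intro mult_left_mono) auto
      finally show ?case using B3 by simp
    qed
  qed
  have ev1: "\<forall>\<^sub>F T in at_top. sqrt 2 * abs_mass * exp ((c T)\<^sup>2 / 2 - (c T)\<^sup>2 * (T powr \<beta>)\<^sup>2 / 4) \<le> 1 / 4"
  proof -
    have "((\<lambda>T. sqrt 2 * abs_mass * exp (\<epsilon> * ln T - \<epsilon> * ln T * (T powr \<beta>)\<^sup>2 / 2)) \<longlongrightarrow> 0) at_top"
      using \<epsilon>(1) \<beta> by real_asymp
    note lim = this
    have q: "(0::real) < 1 / 4" by simp
    from order_tendstoD(2)[OF lim q] eventually_ge_at_top[of 1]
    show ?thesis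
      by eventually_elim (use \<epsilon> in \<open>auto simp: c_def field_simps\<close>)
  qed
  have ev2: "\<forall>\<^sub>F T in at_top. c T / sqrt (2 * pi) * (2 * ((C * T) ^ l * exp ((c T)\<^sup>2 / 2 * (1 - (T powr \<beta>)\<^sup>2)))) \<le> 1 / 4"
  proof -
    have "((\<lambda>T. sqrt (2 * \<epsilon> * ln T) / sqrt (2 * pi) * (2 * ((C * T) ^ l * exp (\<epsilon> * ln T * (1 - (T powr \<beta>)\<^sup>2))))) \<longlongrightarrow> 0) at_top"
      using \<epsilon>(1) \<beta> C(1) by real_asymp
    note lim = this
    have q: "(0::real) < 1 / 4" by simp
    from order_tendstoD(2)[OF lim q] eventually_ge_at_top[of 1]
    show ?thesis
      by eventually_elim (use \<epsilon> in \<open>auto simp: c_def\<close>)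
  qed
  have ev3: "\<forall>\<^sub>F T in at_top. exp ((c T)\<^sup>2 / 2) * abs_mass * exp (H T) *
        (k T * (2 * T powr \<beta>) + 2 * exp (- (k T * (T / 2))\<^sup>2 / 4)) \<le> 1 / 4"
  proof -
    have "((\<lambda>T. exp (\<epsilon> * ln T) * abs_mass * exp ((1 - \<beta> - 3 * \<epsilon>) * ln T) *
        (ln T / T * (2 * T powr \<beta>) + 2 * exp (- (ln T / T * (T / 2))\<^sup>2 / 4))) \<longlongrightarrow> 0) at_top"
      using \<epsilon>(1) \<beta> by real_asymp
    note lim = this
    have q: "(0::real) < 1 / 4" by simp
    from order_tendstoD(2)[OF lim q] eventually_ge_at_top[of 1] evH
    show ?thesis
    proof eventually_elim
      case (elim T)
      have "exp ((c T)\<^sup>2 / 2) * abs_mass * exp (H T) * (k T * (2 * T powr \<beta>) + 2 * exp (- (k T * (T / 2))\<^sup>2 / 4)) \<le>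
         exp (\<epsilon> * ln T) * abs_mass * exp ((1 - \<beta> - 3 * \<epsilon>) * ln T) * (k T * (2 * T powr \<beta>) + 2 * exp (- (k T * (T / 2))\<^sup>2 / 4))"
        using elim \<epsilon> abs_mass_nonneg by (intro mult_right_mono mult_mono) (auto simp: c_def k_def)
      also have "\<dots> \<le> 1 / 4" using elim by (simp add: k_def)
      finally show ?case by simp
    qed
  qed
  have ev4: "\<forall>\<^sub>F T in at_top. exp (K0 * real (Y T) powr \<theta> - \<alpha> * c T) \<le> 1"
  proof -
    have K0: "K0 \<ge> 0" 
    proof -
      have "2 powr (- (\<sigma> - real l * \<alpha>)) < 2 powr (0::real)" using \<alpha> by (intro powr_less_mono) auto
      thus ?thesis using \<theta> by (simp add: K0_def)
    qed
    have "\<forall>\<^sub>F T in at_top. K0 * (\<kappa>' * ln T * ln (ln T)) powr \<theta> \<le> \<alpha> * sqrt (2 * \<epsilon> * ln T)"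
    proof -
      have "((\<lambda>T. K0 * (\<kappa>' * ln T * ln (ln T)) powr \<theta> / (\<alpha> * sqrt (2 * \<epsilon> * ln T))) \<longlongrightarrow> 0) at_top"
        using \<theta> \<alpha>(1) \<epsilon>(1) \<kappa>'(3) by real_asymp
      note lim = this
      have q: "(0::real) < 1" by simp
      from order_tendstoD(2)[OF lim q] eventually_gt_at_top[of 1]
      show ?thesis
      proof eventually_elim
        case (elim T)
        hence "\<alpha> * sqrt (2 * \<epsilon> * ln T) > 0" using \<alpha> \<epsilon> by simp
        thus ?case using elim(1) by (simp only: pos_divide_less_eq)
      qed
    qed
    moreover have "\<forall>\<^sub>F T in at_top. \<kappa>' * ln T * ln (ln T) > 0" using \<kappa>' by real_asymp
    ultimately show ?thesis
    proof eventually_elim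
      case (elim T)
      have "real (Y T) \<le> \<kappa>' * ln T * ln (ln T)" unfolding Y_def cutoff_def using elim by (intro of_nat_floor) auto
      hence "real (Y T) powr \<theta> \<le> (\<kappa>' * ln T * ln (ln T)) powr \<theta>" using \<theta> by (intro powr_mono2) auto
      hence "K0 * real (Y T) powr \<theta> \<le> K0 * (\<kappa>' * ln T * ln (ln T)) powr \<theta>" using K0 by (rule mult_left_mono)
      thus ?case using elim by (simp add: c_def)
    qed
  qed
  have ev5: "\<forall>\<^sub>F T in at_top. T powr \<beta> \<ge> 1 \<and> 4 * T powr \<beta> \<le> T \<and> c T > 0 \<and> k T > 0"
  proof (intro eventually_conj)
    show "\<forall>\<^sub>F T in at_top. T powr \<beta> \<ge> 1" using \<beta> by real_asymp
    show "\<forall>\<^sub>F T in at_top. 4 * T powr \<beta> \<le> T" using \<beta> by real_asymp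
    show "\<forall>\<^sub>F T in at_top. c T > 0" unfolding c_def using \<epsilon>(1) by real_asymp
    show "\<forall>\<^sub>F T in at_top. k T > 0" unfolding k_def by real_asymp
  qed
  show ?thesis using Y2 evA ev1 ev2 ev3 ev4 ev5
  proof eventually_elim
    case (elim T)
    show ?case
    proof (rule ccontr)
      assume "\<not> ?case"
      hence "norm (W (Complex 0 u)) \<le> exp (B T)" if "u \<in> {T powr \<beta>..T}" for u
        using that unfolding norm_W_eq_zeta B_def S_def \<Lambda>_def by (meson linorder_not_le less_imp_le)
      hence "exp (- 1 / 2) * (exp (A T) - 1 - exp (K0 * real (Y T) powr \<theta> - \<alpha> * c T)) \<le>
         exp (B T) + 1 + sqrt 2 * abs_mass * exp ((c T)\<^sup>2 / 2 - (c T)\<^sup>2 * (T powr \<beta>)\<^sup>2 / 4)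
          + c T / sqrt (2 * pi) * (2 * ((C * T) ^ l * exp ((c T)\<^sup>2 / 2 * (1 - (T powr \<beta>)\<^sup>2))))
          + exp ((c T)\<^sup>2 / 2) * abs_mass * exp (H T) * (k T * (2 * T powr \<beta>) + 2 * exp (- (k T * (T / 2))\<^sup>2 / 4))"
        unfolding A_def H_def K0_def s[symmetric]
        by (intro core_inequality[OF elim(1) _ _ \<alpha>]) (use elim C(2) in auto)
      also have "\<dots> \<le> exp (B T) + 2" using elim(3,4,5) by linarith
      finally have 1: "exp (- 1 / 2) * (exp (A T) - 1 - exp (K0 * real (Y T) powr \<theta> - \<alpha> * c T)) \<le> exp (B T) + 2" .
      \<comment> \<open>With \<open>E = exp (B T) \<ge> 4\<close> and
        \<open>exp (A T) \<ge> 4 * E\<close>, the left side is at least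
        \<open>(4 * E - 2) / 2\<close>, which exceeds \<open>E + 2\<close>.\<close>
      have e1: "exp (- 1 / 2) \<ge> (1 / 2 :: real)" using exp_ge_add_one_self[of "- 1 / 2 :: real"] by simp
      have e3: "exp 3 \<ge> (4 :: real)" using exp_ge_add_one_self[of "3 :: real"] by simp
      have eB: "exp (B T) \<ge> 4" using exp_ge_add_one_self[of "B T"] elim(2) by linarith
      have "4 * exp (B T) \<le> exp 3 * exp (B T)" using e3 by (intro mult_right_mono) auto
      also have "\<dots> \<le> exp (A T)" using elim(2) by (simp flip: exp_add)
      finally have eA: "4 * exp (B T) \<le> exp (A T)" .
      have "1 / 2 * (exp (A T) - 1 - exp (K0 * real (Y T) powr \<theta> - \<alpha> * c T)) \<le>
        exp (- 1 / 2) * (exp (A T) - 1 - exp (K0 * real (Y T) powr \<theta> - \<alpha> * c T))"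
        using e1 eA eB elim(6) by (intro mult_right_mono) linarith+
      hence "1 / 2 * (exp (A T) - 1 - exp (K0 * real (Y T) powr \<theta> - \<alpha> * c T)) \<le> exp (B T) + 2"
        using 1 by linarith
      with eA eB elim(6) show False by argo
    qed
  qed
qed

end

theorem theorem3:
  fixes l :: nat and \<beta> \<sigma> \<kappa> :: real
  assumes RH
    and "l \<ge> 1"
    and "0 < \<beta>" "\<beta> < 1"
    and "1/2 < \<sigma>" "\<sigma> < 1"
    and "0 < \<kappa>" "\<kappa> < (1 - \<beta>) / (\<sigma> * (1 + c_const \<sigma>))"
  shows "\<exists>e :: real \<Rightarrow> real. (e \<longlongrightarrow> 0) at_top \<and>
    (\<forall>\<^sub>F T in at_top. \<exists>t \<in> {T powr \<beta> .. T}.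
       (\<Prod>j=1..l. cmod (zeta (Complex \<sigma> (real j * t))))
         \<ge> exp (\<kappa> powr (1 - \<sigma>) * (S_const \<sigma> l + e T)
                * ln T powr (1 - \<sigma>) / ln (ln T) powr \<sigma>))"
\<comment> \<open>The gap between \<kappa> and its bound has already absorbed the error, so the zero
  function serves as the o(1) term.\<close>
proof (intro exI[of _ "\<lambda>_. 0"] conjI tendsto_const)
  interpret zeta_product \<sigma> l by unfold_locales (use assms in auto)
  show "\<forall>\<^sub>F T in at_top. \<exists>t \<in> {T powr \<beta> .. T}.
       (\<Prod>j=1..l. cmod (zeta (Complex \<sigma> (real j * t))))
         \<ge> exp (\<kappa> powr (1 - \<sigma>) * (S_const \<sigma> l + 0)
                * ln T powr (1 - \<sigma>) / ln (ln T) powr \<sigma>)"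
    using large_values[of \<beta> \<kappa>] assms by simp
qed

end
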